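(* Let $\Lambda$ be an indecomposable symmetric SB-algebra over a field $K$ whose extended quiver $Q_e$ has $n\ge 2$ vertices, and let $i$ be a vertex of $Q_e$. Then the complex $T_i=\bigoplus_{j=1}^{n}T_{ij}$ is a tilting complex over $\Lambda$.
   Context: Let $K$ be a field. A symmetric SB-algebra is a symmetric special biserial $K$-algebra. An indecomposable symmetric SB-algebra $\Lambda$ is given by the following standard presentation. The extended quiver $Q_e=Q_e(\Lambda)$ is a finite connected quiver with vertices $1,\dots,n$ in which every vertex is the source of exactly two arrows and the target of exactly two arrows. There is a permutation $\rho$ of the set of arrows such that $\rho(\alpha)$ starts at the target of $\alpha$; $\sigma(\alpha)$ denotes the other arrow starting at the target of $\alpha$. The orbits of $\rho$ (as cyclic sequences of arrows) are the $A$-cycles, the orbits of $\sigma$ are the $G$-cycles. Every $A$-cycle $c$ carries a multiplicity $f(c)\in\mathbb N=\{1,2,\dots\}$. Paths are multiplied from left to right, and $\Lambda=KQ_e/I$, where $I$ is generated by all products $\alpha\sigma(\alpha)$ and, for each vertex $r$, by $C_\alpha^{f(c)}-C_{\alpha'}^{f(c')}$, where $\alpha\neq\alpha'$ are the two arrows starting at $r$, $c,c'$ (possibly equal) are the $A$-cycles containing them, and $C_\alpha=\alpha\rho(\alpha)\cdots\rho^{-1}(\alpha)$ is the closed path running once around $c$ starting with $\alpha$. $P_j=\Lambda e_j$ is the indecomposable projective left module at $j$; an element $x\in e_j\Lambda e_i$ (e.g. a path from $j$ to $i$) defines the morphism $P_j\to P_i$ of right multiplication by $x$. For $j\ne i$,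 $T_{ij}$ is $P_j$ concentrated in degree $0$. The complex $T_{ii}$ is concentrated in degrees $0$ and $1$ with $P_i$ in degree $1$, and is defined as follows. Case 1: there is a loop $\alpha_i$ at $i$ which by itself is an $A$-cycle. Let $\beta_i\ne\alpha_i$ be the arrow ending at $i$ and preceding $\alpha_i$ on its $G$-cycle, $j\ne i$ its source. Then $T_{ii}$ is $P_j\xrightarrow{\beta_i}P_i$. Case 2: there is a loop $\alpha_i$ at $i$ which by itself is a $G$-cycle. Let $\beta_i\neq\alpha_i$ be the arrow preceding $\alpha_i$ on its $A$-cycle, $j\ne i$ its source. Then $T_{ii}$ is $P_j\oplus P_j\xrightarrow{(\beta_i,\ \beta_i\alpha_i)}P_i$. Case 3: there is no loop at $i$. Let $\beta_i^1:i_1\to i$ and $\beta_i^2:i_2\to i$ be the two arrows ending at $i$ (so $i_1,i_2$ are the vertices, different from $i$ but possibly equal to each other, preceding $i$ on the two passages of $A$-cycles through $i$). Then $T_{ii}$ is $P_{i_1}\oplus P_{i_2}\xrightarrow{(\beta_i^1,\ \beta_i^2)}P_i$. (Since $n\ge2$ these cases are exhaustive and mutually exclusive.) A tilting complex $T$ over $\Lambda$ is a bounded complex of finitely generated projective modules with $\operatorname{Hom}_{D^b(\Lambda)}(T,T[r])=0$ for all $r\ne0$ such that the smallest triangulated subcategory containing all direct summands of $T$ contains all finitely generated projective modules (as complexes in degree 0). *)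

theory Defs
  imports
    "HOL-Algebra.QuotRing"
    "HOL-Algebra.Module"
    "HOL-Combinatorics.Orbits"
    "HOL-Combinatorics.Permutations"
    "HOL-Library.Nat_Bijection"
    "Graph_Theory.Digraph_Component"
begin

section \<open>Left modules over a not necessarily commutative ring\<close>

text \<open>The library locale \<^locale>\<open>module\<close> asks for a commutative ring of scalars.  We keep its
  record type; the fields for a multiplication and a unit of the module play no role.\<close>

locale left_module = R?: ring R + M?: abelian_group M
  for R (structure) and M :: "('r, 'm) module" (structure) +
  assumes smult_closed: "\<lbrakk>a \<in> carrier R; x \<in> carrier M\<rbrakk> \<Longrightarrow> a \<odot>\<^bsub>M\<^esub> x \<in> carrier M"
    and smult_l_distr: "\<lbrakk>a \<in> carrier R; b \<in> carrier R; x \<in> carrier M\<rbrakk> \<Longrightarrow>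
      (a \<oplus>\<^bsub>R\<^esub> b) \<odot>\<^bsub>M\<^esub> x = (a \<odot>\<^bsub>M\<^esub> x) \<oplus>\<^bsub>M\<^esub> (b \<odot>\<^bsub>M\<^esub> x)"
    and smult_r_distr: "\<lbrakk>a \<in> carrier R; x \<in> carrier M; y \<in> carrier M\<rbrakk> \<Longrightarrow>
      a \<odot>\<^bsub>M\<^esub> (x \<oplus>\<^bsub>M\<^esub> y) = (a \<odot>\<^bsub>M\<^esub> x) \<oplus>\<^bsub>M\<^esub> (a \<odot>\<^bsub>M\<^esub> y)"
    and smult_assoc: "\<lbrakk>a \<in> carrier R; b \<in> carrier R; x \<in> carrier M\<rbrakk> \<Longrightarrow>
      (a \<otimes>\<^bsub>R\<^esub> b) \<odot>\<^bsub>M\<^esub> x = a \<odot>\<^bsub>M\<^esub> (b \<odot>\<^bsub>M\<^esub> x)"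
    and smult_one: "x \<in> carrier M \<Longrightarrow> \<one>\<^bsub>R\<^esub> \<odot>\<^bsub>M\<^esub> x = x"

definition lmod_hom :: "'r ring \<Rightarrow> ('r, 'm) module \<Rightarrow> ('r, 'm) module \<Rightarrow> ('m \<Rightarrow> 'm) set" where
  "lmod_hom R M N = {h \<in> carrier M \<rightarrow> carrier N.
     (\<forall>x\<in>carrier M. \<forall>y\<in>carrier M. h (x \<oplus>\<^bsub>M\<^esub> y) = h x \<oplus>\<^bsub>N\<^esub> h y) \<and>
     (\<forall>a\<in>carrier R. \<forall>x\<in>carrier M. h (a \<odot>\<^bsub>M\<^esub> x) = a \<odot>\<^bsub>N\<^esub> h x)}"

definition fg_module :: "'r ring \<Rightarrow> ('r, 'm) module \<Rightarrow> bool" where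
  "fg_module R M \<longleftrightarrow> left_module R M \<and>
     (\<exists>S. finite S \<and> S \<subseteq> carrier M \<and> (\<forall>N. submodule N R M \<and> S \<subseteq> N \<longrightarrow> N = carrier M))"

text \<open>Projective object of the category of finitely generated left modules.  The test modules
  have carriers in the type of the carrier of \<open>P\<close>; below this type is \<open>nat \<Rightarrow> 'r\<close>, in which every
  finitely generated module has an isomorphic copy.\<close>

definition fg_projective :: "'r ring \<Rightarrow> ('r, 'm) module \<Rightarrow> bool" where
  "fg_projective R P \<longleftrightarrow> fg_module R P \<and>
     (\<forall>M N. \<forall>g\<in>lmod_hom R M N. \<forall>h\<in>lmod_hom R P N.
        fg_module R M \<and> fg_module R N \<and> g ` carrier M = carrier N \<longrightarrow>
        (\<exists>h'\<in>lmod_hom R P M. \<forall>x\<in>carrier P. g (h' x) = h x))"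

definition zero_lmod :: "('r, 'm) module" where
  "zero_lmod = \<lparr>carrier = {undefined}, monoid.mult = undefined, one = undefined, zero = undefined,
     add = (\<lambda>_ _. undefined), smult = (\<lambda>_ _. undefined)\<rparr>"

text \<open>Finite direct sums within the carrier type \<open>nat \<Rightarrow> 'r\<close>: a family \<open>y\<close> of
  sequences indexed by \<open>A\<close> is stored in one sequence by the pairing bijection on \<^typ>\<open>nat\<close>.\<close>

definition coord :: "nat \<Rightarrow> (nat \<Rightarrow> 'r) \<Rightarrow> nat \<Rightarrow> 'r" where
  "coord j x = (\<lambda>m. x (prod_encode (j, m)))"

definition pack :: "nat set \<Rightarrow> (nat \<Rightarrow> nat \<Rightarrow> 'r) \<Rightarrow> nat \<Rightarrow> 'r" where
  "pack A y = (\<lambda>l. case prod_decode l of (j, m) \<Rightarrow> if j \<in> A then y j m else undefined)"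

definition dsum :: "nat set \<Rightarrow> (nat \<Rightarrow> ('r, nat \<Rightarrow> 'r) module) \<Rightarrow> ('r, nat \<Rightarrow> 'r) module" where
  "dsum A M = \<lparr>carrier = pack A ` {y. \<forall>j\<in>A. y j \<in> carrier (M j)},
     monoid.mult = undefined, one = undefined,
     zero = pack A (\<lambda>j. \<zero>\<^bsub>M j\<^esub>),
     add = (\<lambda>x y. pack A (\<lambda>j. coord j x \<oplus>\<^bsub>M j\<^esub> coord j y)),
     smult = (\<lambda>a x. pack A (\<lambda>j. a \<odot>\<^bsub>M j\<^esub> coord j x))\<rparr>"

definition two :: "'b \<Rightarrow> 'b \<Rightarrow> nat \<Rightarrow> 'b" where
  "two x y = (\<lambda>j. if j = 0 then x else y)"

abbreviation dsum2 ::
    "('r, nat \<Rightarrow> 'r) module \<Rightarrow> ('r, nat \<Rightarrow> 'r) module \<Rightarrow> ('r, nat \<Rightarrow> 'r) module" where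
  "dsum2 M N \<equiv> dsum {0, 1} (two M N)"


section \<open>Cochain complexes\<close>

record ('r, 'm) cplx =
  cobj :: "int \<Rightarrow> ('r, 'm) module"
  cdiff :: "int \<Rightarrow> 'm \<Rightarrow> 'm"

definition is_cplx :: "'r ring \<Rightarrow> ('r, 'm) cplx \<Rightarrow> bool" where
  "is_cplx R X \<longleftrightarrow> (\<forall>k. left_module R (cobj X k) \<and>
     cdiff X k \<in> lmod_hom R (cobj X k) (cobj X (k + 1)) \<and>
     (\<forall>x\<in>carrier (cobj X k). cdiff X (k + 1) (cdiff X k x) = \<zero>\<^bsub>cobj X (k + 2)\<^esub>))"

definition bounded_cplx :: "('r, 'm) cplx \<Rightarrow> bool" where
  "bounded_cplx X \<longleftrightarrow> (\<exists>N. \<forall>k. N < \<bar>k\<bar> \<longrightarrow> carrier (cobj X k) = {\<zero>\<^bsub>cobj X k\<^esub>})"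

definition chain_maps ::
    "'r ring \<Rightarrow> ('r, 'm) cplx \<Rightarrow> ('r, 'm) cplx \<Rightarrow> (int \<Rightarrow> 'm \<Rightarrow> 'm) set" where
  "chain_maps R X Y = {\<phi>. \<forall>k. \<phi> k \<in> lmod_hom R (cobj X k) (cobj Y k) \<and>
     (\<forall>x\<in>carrier (cobj X k). \<phi> (k + 1) (cdiff X k x) = cdiff Y k (\<phi> k x))}"

definition homotopic :: "'r ring \<Rightarrow> ('r, 'm) cplx \<Rightarrow> ('r, 'm) cplx \<Rightarrow>
    (int \<Rightarrow> 'm \<Rightarrow> 'm) \<Rightarrow> (int \<Rightarrow> 'm \<Rightarrow> 'm) \<Rightarrow> bool" where
  "homotopic R X Y \<phi> \<psi> \<longleftrightarrow> (\<exists>h. \<forall>k. h k \<in> lmod_hom R (cobj X k) (cobj Y (k - 1)) \<and>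
     (\<forall>x\<in>carrier (cobj X k).
        \<phi> k x = \<psi> k x \<oplus>\<^bsub>cobj Y k\<^esub> (cdiff Y (k - 1) (h k x) \<oplus>\<^bsub>cobj Y k\<^esub> h (k + 1) (cdiff X k x))))"

definition chain_comp :: "(int \<Rightarrow> 'm \<Rightarrow> 'm) \<Rightarrow> (int \<Rightarrow> 'm \<Rightarrow> 'm) \<Rightarrow> int \<Rightarrow> 'm \<Rightarrow> 'm"  (infixl \<open>\<circ>\<^sub>c\<close> 55) where
  "\<psi> \<circ>\<^sub>c \<phi> = (\<lambda>k. \<psi> k \<circ> \<phi> k)"

definition chain_id :: "int \<Rightarrow> 'm \<Rightarrow> 'm" where
  "chain_id = (\<lambda>k x. x)"

definition chain_zero :: "('r, 'm) cplx \<Rightarrow> int \<Rightarrow> 'm \<Rightarrow> 'm" where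
  "chain_zero Y = (\<lambda>k x. \<zero>\<^bsub>cobj Y k\<^esub>)"

definition cocycles :: "('r, 'm) cplx \<Rightarrow> int \<Rightarrow> 'm set" where
  "cocycles X k = {x \<in> carrier (cobj X k). cdiff X k x = \<zero>\<^bsub>cobj X (k + 1)\<^esub>}"

definition coboundaries :: "('r, 'm) cplx \<Rightarrow> int \<Rightarrow> 'm set" where
  "coboundaries X k = cdiff X (k - 1) ` carrier (cobj X (k - 1))"

definition cohomology :: "('r, 'm) cplx \<Rightarrow> int \<Rightarrow> 'm set set" where
  "cohomology X k = (\<lambda>z. coboundaries X k +>\<^bsub>cobj X k\<^esub> z) ` cocycles X k"

definition cohomology_map ::
    "('r, 'm) cplx \<Rightarrow> (int \<Rightarrow> 'm \<Rightarrow> 'm) \<Rightarrow> int \<Rightarrow> 'm set \<Rightarrow> 'm set" where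
  "cohomology_map Y \<phi> k c = (\<Union>z\<in>c. coboundaries Y k +>\<^bsub>cobj Y k\<^esub> \<phi> k z)"

definition quasi_isos ::
    "'r ring \<Rightarrow> ('r, 'm) cplx \<Rightarrow> ('r, 'm) cplx \<Rightarrow> (int \<Rightarrow> 'm \<Rightarrow> 'm) set" where
  "quasi_isos R X Y = {\<phi> \<in> chain_maps R X Y.
     \<forall>k. bij_betw (cohomology_map Y \<phi> k) (cohomology X k) (cohomology Y k)}"

definition shift :: "('r, 'm) cplx \<Rightarrow> int \<Rightarrow> ('r, 'm) cplx" where
  "shift X r = \<lparr>cobj = (\<lambda>k. cobj X (k + r)),
     cdiff = (\<lambda>k x. if even r then cdiff X (k + r) x
                   else \<ominus>\<^bsub>cobj X (k + r + 1)\<^esub> cdiff X (k + r) x)\<rparr>"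

definition dsum_cplx :: "nat set \<Rightarrow> (nat \<Rightarrow> ('r, nat \<Rightarrow> 'r) cplx) \<Rightarrow> ('r, nat \<Rightarrow> 'r) cplx" where
  "dsum_cplx A X = \<lparr>cobj = (\<lambda>k. dsum A (\<lambda>j. cobj (X j) k)),
     cdiff = (\<lambda>k x. pack A (\<lambda>j. cdiff (X j) k (coord j x)))\<rparr>"

text \<open>The mapping cone, with \<open>d (x, y) = (- d x, \<phi> x + d y)\<close> on \<open>X\<^sup>k\<^sup>+\<^sup>1 \<oplus> Y\<^sup>k\<close>.\<close>

definition cone :: "('r, nat \<Rightarrow> 'r) cplx \<Rightarrow> ('r, nat \<Rightarrow> 'r) cplx \<Rightarrow>
    (int \<Rightarrow> (nat \<Rightarrow> 'r) \<Rightarrow> nat \<Rightarrow> 'r) \<Rightarrow> ('r, nat \<Rightarrow> 'r) cplx" where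
  "cone X Y \<phi> = \<lparr>cobj = (\<lambda>k. dsum2 (cobj X (k + 1)) (cobj Y k)),
     cdiff = (\<lambda>k z. pack {0, 1} (two
        (\<ominus>\<^bsub>cobj X (k + 2)\<^esub> cdiff X (k + 1) (coord 0 z))
        (\<phi> (k + 1) (coord 0 z) \<oplus>\<^bsub>cobj Y (k + 1)\<^esub> cdiff Y k (coord 1 z))))\<rparr>"

definition stalk :: "('r, 'm) module \<Rightarrow> ('r, 'm) cplx" where
  "stalk M = \<lparr>cobj = (\<lambda>k. if k = 0 then M else zero_lmod),
     cdiff = (\<lambda>k x. if k = - 1 then \<zero>\<^bsub>M\<^esub> else undefined)\<rparr>"

text \<open>The complex \<open>M \<rightarrow> N\<close> given by \<open>h\<close>, with \<open>M\<close> in degree 0 and \<open>N\<close> in degree 1.\<close>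

definition two_term :: "('r, 'm) module \<Rightarrow> ('r, 'm) module \<Rightarrow> ('m \<Rightarrow> 'm) \<Rightarrow> ('r, 'm) cplx" where
  "two_term M N h = \<lparr>cobj = (\<lambda>k. if k = 0 then M else if k = 1 then N else zero_lmod),
     cdiff = (\<lambda>k x. if k = 0 then h x else if k = - 1 then \<zero>\<^bsub>M\<^esub> else undefined)\<rparr>"


section \<open>The bounded derived category and tilting complexes\<close>

text \<open>Objects are the bounded complexes of finitely generated modules with carriers in
  \<open>nat \<Rightarrow> 'r\<close>.  Morphisms from \<open>X\<close> to \<open>Y\<close> are roofs \<open>X \<leftarrow> Z \<rightarrow> Y\<close> (with left leg a
  quasi-isomorphism) modulo \<open>roof_equiv\<close>.\<close>

definition Db_objects :: "'r ring \<Rightarrow> ('r, nat \<Rightarrow> 'r) cplx set" where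
  "Db_objects R = {X. is_cplx R X \<and> bounded_cplx X \<and> (\<forall>k. fg_module R (cobj X k))}"

type_synonym 'r roof = "('r, nat \<Rightarrow> 'r) cplx \<times>
  (int \<Rightarrow> (nat \<Rightarrow> 'r) \<Rightarrow> nat \<Rightarrow> 'r) \<times> (int \<Rightarrow> (nat \<Rightarrow> 'r) \<Rightarrow> nat \<Rightarrow> 'r)"

definition roofs :: "'r ring \<Rightarrow> ('r, nat \<Rightarrow> 'r) cplx \<Rightarrow> ('r, nat \<Rightarrow> 'r) cplx \<Rightarrow> 'r roof set" where
  "roofs R X Y = {(Z, s, g). Z \<in> Db_objects R \<and> s \<in> quasi_isos R Z X \<and> g \<in> chain_maps R Z Y}"

fun roof_equiv :: "'r ring \<Rightarrow> ('r, nat \<Rightarrow> 'r) cplx \<Rightarrow> ('r, nat \<Rightarrow> 'r) cplx \<Rightarrow>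
    'r roof \<Rightarrow> 'r roof \<Rightarrow> bool" where
  "roof_equiv R X Y (Z, s, g) (Z', s', g') \<longleftrightarrow>
     (\<exists>W\<in>Db_objects R. \<exists>u\<in>chain_maps R W Z. \<exists>u'\<in>chain_maps R W Z'.
        s \<circ>\<^sub>c u \<in> quasi_isos R W X \<and>
        homotopic R W X (s \<circ>\<^sub>c u) (s' \<circ>\<^sub>c u') \<and>
        homotopic R W Y (g \<circ>\<^sub>c u) (g' \<circ>\<^sub>c u'))"

definition Db_hom_zero :: "'r ring \<Rightarrow> ('r, nat \<Rightarrow> 'r) cplx \<Rightarrow> ('r, nat \<Rightarrow> 'r) cplx \<Rightarrow> bool" where
  "Db_hom_zero R X Y \<longleftrightarrow> (\<forall>\<rho>\<in>roofs R X Y. roof_equiv R X Y \<rho> (X, chain_id, chain_zero Y))"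

text \<open>A roof represents an isomorphism iff its right leg is a quasi-isomorphism, too.\<close>

definition Db_iso :: "'r ring \<Rightarrow> ('r, nat \<Rightarrow> 'r) cplx \<Rightarrow> ('r, nat \<Rightarrow> 'r) cplx \<Rightarrow> bool" where
  "Db_iso R X Y \<longleftrightarrow> (\<exists>Z\<in>Db_objects R. quasi_isos R Z X \<noteq> {} \<and> quasi_isos R Z Y \<noteq> {})"

definition Db_summands :: "'r ring \<Rightarrow> ('r, nat \<Rightarrow> 'r) cplx \<Rightarrow> ('r, nat \<Rightarrow> 'r) cplx set" where
  "Db_summands R T = {X \<in> Db_objects R. \<exists>Y\<in>Db_objects R. Db_iso R (dsum_cplx {0, 1} (two X Y)) T}"

text \<open>Full triangulated subcategories, closed under isomorphism, given by their objects.
  Every distinguished triangle is isomorphic to one on the cone of a chain map, so closure under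
  shifts, cones of chain maps and isomorphisms gives two-out-of-three for all triangles.\<close>

definition triangulated_subcat :: "'r ring \<Rightarrow> ('r, nat \<Rightarrow> 'r) cplx set \<Rightarrow> bool" where
  "triangulated_subcat R S \<longleftrightarrow> S \<subseteq> Db_objects R \<and> S \<noteq> {} \<and>
     (\<forall>X\<in>S. \<forall>Y\<in>Db_objects R. Db_iso R X Y \<longrightarrow> Y \<in> S) \<and>
     (\<forall>X\<in>S. \<forall>r. shift X r \<in> S) \<and>
     (\<forall>X\<in>S. \<forall>Y\<in>S. \<forall>\<phi>\<in>chain_maps R X Y. cone X Y \<phi> \<in> S)"

definition triangulated_hull :: "'r ring \<Rightarrow> ('r, nat \<Rightarrow> 'r) cplx set \<Rightarrow> ('r, nat \<Rightarrow> 'r) cplx set" where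
  "triangulated_hull R C = \<Inter>{S. triangulated_subcat R S \<and> C \<subseteq> S}"

definition tilting_complex :: "'r ring \<Rightarrow> ('r, nat \<Rightarrow> 'r) cplx \<Rightarrow> bool" where
  "tilting_complex R T \<longleftrightarrow>
     is_cplx R T \<and> bounded_cplx T \<and> (\<forall>k. fg_projective R (cobj T k)) \<and>
     (\<forall>r. r \<noteq> 0 \<longrightarrow> Db_hom_zero R T (shift T r)) \<and>
     (\<forall>P. fg_projective R P \<longrightarrow> stalk P \<in> triangulated_hull R (Db_summands R T))"


section \<open>Path algebras\<close>

text \<open>A path is a pair of its source and its list of arrows; arrows are composed from left to
  right.  The path algebra consists of the finitely supported functions on paths.\<close>

definition path_algebra :: "('v, 'a) pre_digraph \<Rightarrow> ('v \<times> 'a list \<Rightarrow> 'k::field) ring" where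
  "path_algebra Q = \<lparr>
     carrier = {x. finite {p. x p \<noteq> 0} \<and> (\<forall>v as. x (v, as) \<noteq> 0 \<longrightarrow> (\<exists>w. pre_digraph.awalk Q v as w))},
     monoid.mult = (\<lambda>x y (v, as). \<Sum>k\<le>length as.
        x (v, take k as) * y (pre_digraph.awlast Q v (take k as), drop k as)),
     one = (\<lambda>(v, as). if v \<in> verts Q \<and> as = [] then 1 else 0),
     zero = (\<lambda>_. 0),
     add = (\<lambda>x y p. x p + y p)\<rparr>"

definition trivial_path :: "'v \<Rightarrow> 'v \<times> 'a list \<Rightarrow> 'k::field" where
  "trivial_path v = (\<lambda>p. if p = (v, []) then 1 else 0)"

definition arrow_path :: "('v, 'a) pre_digraph \<Rightarrow> 'a list \<Rightarrow> 'v \<times> 'a list \<Rightarrow> 'k::field" where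
  "arrow_path Q as = (\<lambda>p. if p = (tail Q (hd as), as) then 1 else 0)"


section \<open>Symmetric special biserial algebras\<close>

text \<open>The standard presentation: \<open>\<rho>\<close> is the permutation of the arrows, and \<open>f\<close> assigns the
  multiplicity to an \<open>A\<close>-cycle, which is identified by its set of arrows (an orbit of \<open>\<rho>\<close>).\<close>

locale sb_presentation = fin_digraph Q
  for Q :: "(nat, 'a) pre_digraph" +
  fixes n :: nat and \<rho> :: "'a \<Rightarrow> 'a" and f :: "'a set \<Rightarrow> nat"
  assumes verts_eq: "verts Q = {1..n}"
    and connected_Q: "connected Q"
    and two_out: "v \<in> verts Q \<Longrightarrow> card (out_arcs Q v) = 2"
    and two_in: "v \<in> verts Q \<Longrightarrow> card (in_arcs Q v) = 2"
    and rho_permutes: "\<rho> permutes arcs Q"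
    and tail_rho: "\<alpha> \<in> arcs Q \<Longrightarrow> tail Q (\<rho> \<alpha>) = head Q \<alpha>"
    and mult_pos: "\<alpha> \<in> arcs Q \<Longrightarrow> 1 \<le> f (orbit \<rho> \<alpha>)"

definition sigma :: "('v, 'a) pre_digraph \<Rightarrow> ('a \<Rightarrow> 'a) \<Rightarrow> 'a \<Rightarrow> 'a" where
  "sigma Q \<rho> \<alpha> = (THE \<beta>. \<beta> \<in> arcs Q \<and> tail Q \<beta> = head Q \<alpha> \<and> \<beta> \<noteq> \<rho> \<alpha>)"

definition A_cycle :: "('a \<Rightarrow> 'a) \<Rightarrow> 'a \<Rightarrow> 'a list" where
  "A_cycle \<rho> \<alpha> = map (\<lambda>k. (\<rho> ^^ k) \<alpha>) [0..<card (orbit \<rho> \<alpha>)]"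

definition A_cycle_power :: "('a \<Rightarrow> 'a) \<Rightarrow> ('a set \<Rightarrow> nat) \<Rightarrow> 'a \<Rightarrow> 'a list" where
  "A_cycle_power \<rho> f \<alpha> = concat (replicate (f (orbit \<rho> \<alpha>)) (A_cycle \<rho> \<alpha>))"

definition sb_relations ::
    "('v, 'a) pre_digraph \<Rightarrow> ('a \<Rightarrow> 'a) \<Rightarrow> ('a set \<Rightarrow> nat) \<Rightarrow> ('v \<times> 'a list \<Rightarrow> 'k::field) set" where
  "sb_relations Q \<rho> f =
     {arrow_path Q [\<alpha>, sigma Q \<rho> \<alpha>] |\<alpha>. \<alpha> \<in> arcs Q} \<union>
     {arrow_path Q (A_cycle_power \<rho> f \<alpha>) \<ominus>\<^bsub>path_algebra Q\<^esub> arrow_path Q (A_cycle_power \<rho> f \<alpha>') |\<alpha> \<alpha>'.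
        \<alpha> \<in> arcs Q \<and> \<alpha>' \<in> arcs Q \<and> \<alpha> \<noteq> \<alpha>' \<and> tail Q \<alpha> = tail Q \<alpha>'}"

definition sb_ideal ::
    "('v, 'a) pre_digraph \<Rightarrow> ('a \<Rightarrow> 'a) \<Rightarrow> ('a set \<Rightarrow> nat) \<Rightarrow> ('v \<times> 'a list \<Rightarrow> 'k::field) set" where
  "sb_ideal Q \<rho> f = Idl\<^bsub>path_algebra Q\<^esub> (sb_relations Q \<rho> f)"

type_synonym ('a, 'k) sb_elt = "(nat \<times> 'a list \<Rightarrow> 'k) set"

definition sb_algebra ::
    "(nat, 'a) pre_digraph \<Rightarrow> ('a \<Rightarrow> 'a) \<Rightarrow> ('a set \<Rightarrow> nat) \<Rightarrow> ('a, 'k::field) sb_elt ring" where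
  "sb_algebra Q \<rho> f = path_algebra Q Quot sb_ideal Q \<rho> f"

definition sb_class :: "(nat, 'a) pre_digraph \<Rightarrow> ('a \<Rightarrow> 'a) \<Rightarrow> ('a set \<Rightarrow> nat) \<Rightarrow>
    (nat \<times> 'a list \<Rightarrow> 'k::field) \<Rightarrow> ('a, 'k) sb_elt" where
  "sb_class Q \<rho> f x = sb_ideal Q \<rho> f +>\<^bsub>path_algebra Q\<^esub> x"


section \<open>The complexes \<open>T\<^sub>i\<^sub>j\<close>\<close>

text \<open>The left ideal \<open>R e\<close> as a module with carrier in \<open>nat \<Rightarrow> 'r\<close>: its elements are represented
  by constant sequences.\<close>

definition left_ideal_module :: "'r ring \<Rightarrow> 'r \<Rightarrow> ('r, nat \<Rightarrow> 'r) module" where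
  "left_ideal_module R e = \<lparr>carrier = (\<lambda>a _. a \<otimes>\<^bsub>R\<^esub> e) ` carrier R,
     monoid.mult = undefined, one = undefined,
     zero = (\<lambda>_. \<zero>\<^bsub>R\<^esub>),
     add = (\<lambda>x y _. x 0 \<oplus>\<^bsub>R\<^esub> y 0),
     smult = (\<lambda>a x _. a \<otimes>\<^bsub>R\<^esub> x 0)\<rparr>"

definition right_mult :: "'r ring \<Rightarrow> 'r \<Rightarrow> (nat \<Rightarrow> 'r) \<Rightarrow> nat \<Rightarrow> 'r" where
  "right_mult R a = (\<lambda>x _. x 0 \<otimes>\<^bsub>R\<^esub> a)"

text \<open>The map \<open>(a, b)\<close> from a direct sum of two left ideals to a left ideal.\<close>

definition right_mult2 :: "'r ring \<Rightarrow> 'r \<Rightarrow> 'r \<Rightarrow> (nat \<Rightarrow> 'r) \<Rightarrow> nat \<Rightarrow> 'r" where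
  "right_mult2 R a b = (\<lambda>x _. (coord 0 x 0 \<otimes>\<^bsub>R\<^esub> a) \<oplus>\<^bsub>R\<^esub> (coord 1 x 0 \<otimes>\<^bsub>R\<^esub> b))"

definition sb_proj :: "(nat, 'a) pre_digraph \<Rightarrow> ('a \<Rightarrow> 'a) \<Rightarrow> ('a set \<Rightarrow> nat) \<Rightarrow> nat \<Rightarrow>
    (('a, 'k::field) sb_elt, nat \<Rightarrow> ('a, 'k) sb_elt) module" where
  "sb_proj Q \<rho> f j = left_ideal_module (sb_algebra Q \<rho> f) (sb_class Q \<rho> f (trivial_path j))"

definition loops_at :: "('v, 'a) pre_digraph \<Rightarrow> 'v \<Rightarrow> 'a set" where
  "loops_at Q i = {\<alpha> \<in> arcs Q. tail Q \<alpha> = i \<and> head Q \<alpha> = i}"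

text \<open>In the third case the numbering of the two arrows ending at \<open>i\<close> is chosen arbitrarily.\<close>

definition sb_T_diag :: "(nat, 'a) pre_digraph \<Rightarrow> ('a \<Rightarrow> 'a) \<Rightarrow> ('a set \<Rightarrow> nat) \<Rightarrow> nat \<Rightarrow>
    (('a, 'k::field) sb_elt, nat \<Rightarrow> ('a, 'k) sb_elt) cplx" where
  "sb_T_diag Q \<rho> f i =
    (let R = sb_algebra Q \<rho> f; P = sb_proj Q \<rho> f; path = (\<lambda>as. sb_class Q \<rho> f (arrow_path Q as)) in
     if \<exists>\<alpha>\<in>loops_at Q i. \<rho> \<alpha> = \<alpha> then
       let \<alpha> = (THE \<alpha>. \<alpha> \<in> loops_at Q i \<and> \<rho> \<alpha> = \<alpha>);
           \<beta> = (THE \<beta>. \<beta> \<in> in_arcs Q i \<and> \<beta> \<noteq> \<alpha> \<and> sigma Q \<rho> \<beta> = \<alpha>)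
       in two_term (P (tail Q \<beta>)) (P i) (right_mult R (path [\<beta>]))
     else if \<exists>\<alpha>\<in>loops_at Q i. sigma Q \<rho> \<alpha> = \<alpha> then
       let \<alpha> = (THE \<alpha>. \<alpha> \<in> loops_at Q i \<and> sigma Q \<rho> \<alpha> = \<alpha>);
           \<beta> = (THE \<beta>. \<beta> \<in> in_arcs Q i \<and> \<beta> \<noteq> \<alpha> \<and> \<rho> \<beta> = \<alpha>)
       in two_term (dsum2 (P (tail Q \<beta>)) (P (tail Q \<beta>))) (P i)
            (right_mult2 R (path [\<beta>]) (path [\<beta>, \<alpha>]))
     else
       let (\<beta>\<^sub>1, \<beta>\<^sub>2) = (SOME (\<beta>\<^sub>1, \<beta>\<^sub>2). \<beta>\<^sub>1 \<noteq> \<beta>\<^sub>2 \<and> \<beta>\<^sub>1 \<in> in_arcs Q i \<and> \<beta>\<^sub>2 \<in> in_arcs Q i)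
       in two_term (dsum2 (P (tail Q \<beta>\<^sub>1)) (P (tail Q \<beta>\<^sub>2))) (P i)
            (right_mult2 R (path [\<beta>\<^sub>1]) (path [\<beta>\<^sub>2])))"

definition sb_T :: "(nat, 'a) pre_digraph \<Rightarrow> ('a \<Rightarrow> 'a) \<Rightarrow> ('a set \<Rightarrow> nat) \<Rightarrow> nat \<Rightarrow> nat \<Rightarrow>
    (('a, 'k::field) sb_elt, nat \<Rightarrow> ('a, 'k) sb_elt) cplx" where
  "sb_T Q \<rho> f i j = (if j = i then sb_T_diag Q \<rho> f i else stalk (sb_proj Q \<rho> f j))"

definition sb_tilt :: "(nat, 'a) pre_digraph \<Rightarrow> nat \<Rightarrow> ('a \<Rightarrow> 'a) \<Rightarrow> ('a set \<Rightarrow> nat) \<Rightarrow> nat \<Rightarrow>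
    (('a, 'k::field) sb_elt, nat \<Rightarrow> ('a, 'k) sb_elt) cplx" where
  "sb_tilt Q n \<rho> f i = dsum_cplx {1..n} (sb_T Q \<rho> f i)"

end

theory Submission
  imports Defs
begin

text \<open>\<open>T\<close> is an Okuyama--Rickard complex: \<open>T\<^sub>i\<^sub>i\<close> is a right approximation \<open>d : P' \<rightarrow> P\<^sub>i\<close> by the
  projectives \<open>P\<^sub>l\<close> with \<open>l \<noteq> i\<close>, placed in degrees 0 and 1, because modulo the relations every path
  from \<open>l \<noteq> i\<close> to \<open>i\<close> factors through the arrows (or, for a loop, paths) into \<open>i\<close> that occur in \<open>d\<close>.
  Since the terms of \<open>T\<close> are projective, morphisms \<open>T \<rightarrow> T[r]\<close> in the derived category are classes of
  chain maps.  For \<open>r = 1\<close> such a chain map is a homomorphism \<open>T\<^sup>0 \<rightarrow> T\<^sup>1\<close>, which factors through \<open>d\<close>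
  and hence is null-homotopic.  For \<open>r = -1\<close> it is given by elements \<open>y\<close> of \<open>e\<^sub>i \<Lambda> e\<^sub>l\<close> with
  \<open>e\<^sub>l \<Lambda> e\<^sub>i y = 0\<close>, and these vanish because \<open>\<Lambda>\<close> is symmetric.  Generation: \<open>P\<^sub>i\<close> is the cone of
  \<open>T\<^sub>i\<^sub>i \<rightarrow> P'\<close>, and by Krull--Schmidt every projective is a direct sum of copies of the \<open>P\<^sub>j\<close>.\<close>

section \<open>Left modules and their homomorphisms\<close>

text \<open>Krull--Schmidt is needed because the triangulated subcategories considered here are
  closed under shifts, cones and isomorphisms, but are not assumed closed under direct summands.
  That a projective is a summand of a finite sum of the P_j is therefore too weak; it must be
  isomorphic to such a sum. The locality behind this comes from the filtration of the algebra by
  path length, which the relations make nilpotent.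

  Symmetry enters through one explicit linear form, the sum of the coefficients at the paths
  C_a^f(c). It vanishes on the ideal of relations, and it replaces a computation of a K-basis of the
  algebra: membership in the ideal is shown by exhibiting relations, non-membership is detected by
  the form alone.

  Projectives are handled by dual bases labelled with idempotents. The labels record which P_l
  occur, so that T^0 is known to involve only l \<noteq> i; the factorization through d and the
  vanishing for r = -1 both rest on this. For morphisms given by roofs, only a chain map u with s u
  a quasi-isomorphism has to be found.\<close>

context left_module
begin

lemmas [simp, intro] = smult_closed
lemmas [simp] = smult_one

lemma smult_r_null [simp]: "a \<in> carrier R \<Longrightarrow> a \<odot>\<^bsub>M\<^esub> \<zero>\<^bsub>M\<^esub> = \<zero>\<^bsub>M\<^esub>"
  by (metis M.add.l_cancel_one' M.zero_closed smult_closed smult_r_distr M.l_zero)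

lemma smult_l_null [simp]: "x \<in> carrier M \<Longrightarrow> \<zero>\<^bsub>R\<^esub> \<odot>\<^bsub>M\<^esub> x = \<zero>\<^bsub>M\<^esub>"
  by (metis M.add.l_cancel_one' R.zero_closed smult_closed smult_l_distr R.l_zero)

lemma smult_l_minus: "a \<in> carrier R \<Longrightarrow> x \<in> carrier M \<Longrightarrow> (\<ominus>\<^bsub>R\<^esub> a) \<odot>\<^bsub>M\<^esub> x = \<ominus>\<^bsub>M\<^esub> (a \<odot>\<^bsub>M\<^esub> x)"
  by (metis M.minus_equality R.a_inv_closed R.l_neg smult_closed smult_l_distr smult_l_null)

lemma smult_r_minus: "a \<in> carrier R \<Longrightarrow> x \<in> carrier M \<Longrightarrow> a \<odot>\<^bsub>M\<^esub> (\<ominus>\<^bsub>M\<^esub> x) = \<ominus>\<^bsub>M\<^esub> (a \<odot>\<^bsub>M\<^esub> x)"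
  by (metis M.minus_equality M.a_inv_closed M.l_neg smult_closed smult_r_distr smult_r_null)

lemma finsum_smult:
  assumes "finite A" "a \<in> carrier R" "g \<in> A \<rightarrow> carrier M"
  shows "a \<odot>\<^bsub>M\<^esub> finsum M g A = finsum M (\<lambda>k. a \<odot>\<^bsub>M\<^esub> g k) A"
  using assms
proof (induction A)
  case (insert k A)
  then have g: "g k \<in> carrier M" "g \<in> A \<rightarrow> carrier M" by auto
  then have "(\<lambda>k. a \<odot>\<^bsub>M\<^esub> g k) \<in> A \<rightarrow> carrier M" using insert by auto
  then show ?case using insert g by (simp add: smult_r_distr)
qed simp

lemma finsum_smult_l:
  assumes "finite A" "x \<in> carrier M" "g \<in> A \<rightarrow> carrier R"
  shows "finsum R g A \<odot>\<^bsub>M\<^esub> x = finsum M (\<lambda>k. g k \<odot>\<^bsub>M\<^esub> x) A"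
  using assms
proof (induction A)
  case (insert k A)
  then have g: "g k \<in> carrier R" "g \<in> A \<rightarrow> carrier R" by auto
  then have "(\<lambda>k. g k \<odot>\<^bsub>M\<^esub> x) \<in> A \<rightarrow> carrier M" using insert by auto
  then show ?case using insert g by (simp add: smult_l_distr)
qed simp

end

lemma lmod_homI:
  assumes "\<And>x. x \<in> carrier M \<Longrightarrow> h x \<in> carrier N"
    and "\<And>x y. x \<in> carrier M \<Longrightarrow> y \<in> carrier M \<Longrightarrow> h (x \<oplus>\<^bsub>M\<^esub> y) = h x \<oplus>\<^bsub>N\<^esub> h y"
    and "\<And>a x. a \<in> carrier R \<Longrightarrow> x \<in> carrier M \<Longrightarrow> h (a \<odot>\<^bsub>M\<^esub> x) = a \<odot>\<^bsub>N\<^esub> h x"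
  shows "h \<in> lmod_hom R M N"
  using assms by (auto simp: lmod_hom_def)

lemma lmod_hom_closed: "h \<in> lmod_hom R M N \<Longrightarrow> x \<in> carrier M \<Longrightarrow> h x \<in> carrier N"
  by (auto simp: lmod_hom_def)

lemma lmod_hom_add: "h \<in> lmod_hom R M N \<Longrightarrow> x \<in> carrier M \<Longrightarrow> y \<in> carrier M \<Longrightarrow>
    h (x \<oplus>\<^bsub>M\<^esub> y) = h x \<oplus>\<^bsub>N\<^esub> h y"
  by (auto simp: lmod_hom_def)

lemma lmod_hom_smult: "h \<in> lmod_hom R M N \<Longrightarrow> a \<in> carrier R \<Longrightarrow> x \<in> carrier M \<Longrightarrow>
    h (a \<odot>\<^bsub>M\<^esub> x) = a \<odot>\<^bsub>N\<^esub> h x"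
  by (auto simp: lmod_hom_def)

lemma lmod_hom_zero:
  assumes "h \<in> lmod_hom R M N" "left_module R M" "left_module R N"
  shows "h \<zero>\<^bsub>M\<^esub> = \<zero>\<^bsub>N\<^esub>"
proof -
  interpret M: left_module R M by fact
  interpret N: left_module R N by fact
  have "h (\<zero>\<^bsub>R\<^esub> \<odot>\<^bsub>M\<^esub> \<zero>\<^bsub>M\<^esub>) = \<zero>\<^bsub>R\<^esub> \<odot>\<^bsub>N\<^esub> h \<zero>\<^bsub>M\<^esub>"
    using assms by (intro lmod_hom_smult) auto
  then show ?thesis using lmod_hom_closed[OF assms(1), of "\<zero>\<^bsub>M\<^esub>"] by simp
qed

lemma lmod_hom_minus:
  assumes "h \<in> lmod_hom R M N" "left_module R M" "left_module R N" "x \<in> carrier M"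
  shows "h (\<ominus>\<^bsub>M\<^esub> x) = \<ominus>\<^bsub>N\<^esub> h x"
proof -
  interpret M: left_module R M by fact
  interpret N: left_module R N by fact
  have "h (\<ominus>\<^bsub>M\<^esub> x) \<oplus>\<^bsub>N\<^esub> h x = \<zero>\<^bsub>N\<^esub>"
    using assms lmod_hom_add[OF assms(1), of "\<ominus>\<^bsub>M\<^esub> x" x]
    by (simp add: M.M.l_neg lmod_hom_zero)
  then show ?thesis using assms lmod_hom_closed[OF assms(1)] by (simp add: N.M.minus_equality)
qed

lemma lmod_hom_finsum:
  assumes "h \<in> lmod_hom R M N" "left_module R M" "left_module R N" "finite A" "g \<in> A \<rightarrow> carrier M"
  shows "h (finsum M g A) = finsum N (\<lambda>k. h (g k)) A"
proof -
  interpret M: left_module R M by fact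
  interpret N: left_module R N by fact
  show ?thesis using assms(4,5)
  proof (induction A)
    case (insert k A)
    then have "(\<lambda>k. h (g k)) \<in> A \<rightarrow> carrier N" "h (g k) \<in> carrier N"
      using lmod_hom_closed[OF assms(1)] by auto
    then show ?case using insert assms(1) by (simp add: lmod_hom_add)
  qed (use assms in \<open>simp add: lmod_hom_zero\<close>)
qed

lemma lmod_hom_id: "(\<lambda>x. x) \<in> lmod_hom R M M"
  by (auto simp: lmod_hom_def)

lemma lmod_hom_compose:
  "h \<in> lmod_hom R M N \<Longrightarrow> g \<in> lmod_hom R N L \<Longrightarrow> (\<lambda>x. g (h x)) \<in> lmod_hom R M L"
  by (auto simp: lmod_hom_def Pi_iff)

lemma lmod_hom_null:
  assumes "left_module R N"
  shows "(\<lambda>_. \<zero>\<^bsub>N\<^esub>) \<in> lmod_hom R M N"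
proof -
  interpret N: left_module R N by fact
  show ?thesis by (auto simp: lmod_hom_def)
qed

lemma lmod_hom_addf:
  assumes "left_module R N" "h \<in> lmod_hom R M N" "g \<in> lmod_hom R M N"
  shows "(\<lambda>x. h x \<oplus>\<^bsub>N\<^esub> g x) \<in> lmod_hom R M N"
proof -
  interpret N: left_module R N by fact
  show ?thesis using assms(2,3)
    by (intro lmod_homI)
      (auto simp: lmod_hom_closed lmod_hom_add lmod_hom_smult N.smult_r_distr N.M.a_ac)
qed

lemma lmod_hom_minusf:
  assumes "left_module R N" "h \<in> lmod_hom R M N"
  shows "(\<lambda>x. \<ominus>\<^bsub>N\<^esub> h x) \<in> lmod_hom R M N"
proof -
  interpret N: left_module R N by fact
  show ?thesis using assms(2)
    by (intro lmod_homI)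
      (auto simp: lmod_hom_closed lmod_hom_add lmod_hom_smult N.smult_r_minus N.M.minus_add)
qed

text \<open>Negatives are multiples by -1, so closure under sums and scalars already yields a
  subgroup.\<close>

lemma submoduleI_left_module:
  assumes "left_module R M" "N \<subseteq> carrier M" "\<zero>\<^bsub>M\<^esub> \<in> N"
    and "\<And>x y. x \<in> N \<Longrightarrow> y \<in> N \<Longrightarrow> x \<oplus>\<^bsub>M\<^esub> y \<in> N"
    and "\<And>a x. a \<in> carrier R \<Longrightarrow> x \<in> N \<Longrightarrow> a \<odot>\<^bsub>M\<^esub> x \<in> N"
  shows "submodule N R M"
proof -
  interpret M: left_module R M by fact
  have "inv\<^bsub>add_monoid M\<^esub> x \<in> N" if "x \<in> N" for x
  proof -
    have "\<ominus>\<^bsub>M\<^esub> x = (\<ominus>\<^bsub>R\<^esub> \<one>\<^bsub>R\<^esub>) \<odot>\<^bsub>M\<^esub> x"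
      using that assms(2) by (subst M.smult_l_minus) auto
    then show ?thesis using assms(5)[of "\<ominus>\<^bsub>R\<^esub> \<one>\<^bsub>R\<^esub>" x] that by (simp add: a_inv_def)
  qed
  then show ?thesis
    using assms by (auto intro!: submodule.intro subgroup.intro simp: submodule_axioms_def)
qed

lemma left_module_zero_lmod: "ring R \<Longrightarrow> left_module R zero_lmod"
  by (intro left_module.intro abelian_groupI left_module_axioms.intro)
    (auto simp: zero_lmod_def)

lemma carrier_zero_lmod [simp]:
  "carrier (zero_lmod :: ('r, 'm) module) = {\<zero>\<^bsub>zero_lmod :: ('r, 'm) module\<^esub>}"
  by (simp add: zero_lmod_def)


section \<open>Finite direct sums\<close>

lemma coord_pack [simp]: "j \<in> A \<Longrightarrow> coord j (pack A y) = y j"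
  by (auto simp: coord_def pack_def)

lemma pack_cong: "(\<And>j. j \<in> A \<Longrightarrow> y j = z j) \<Longrightarrow> pack A y = pack A z"
  by (auto simp: pack_def fun_eq_iff split: prod.split)

text \<open>\<open>pack\<close> stores \<open>undefined\<close> at all positions outside
  \<open>A\<close>. The equation on the right is this normal form; without it two elements could
  agree in all coordinates and still differ.\<close>

lemma carrier_dsum: "x \<in> carrier (dsum A M) \<longleftrightarrow>
    (\<forall>j\<in>A. coord j x \<in> carrier (M j)) \<and> x = pack A (\<lambda>j. coord j x)"
  by (auto simp: dsum_def intro!: pack_cong rev_image_eqI[of "\<lambda>j. coord j x"])

lemma coord_closed: "x \<in> carrier (dsum A M) \<Longrightarrow> j \<in> A \<Longrightarrow> coord j x \<in> carrier (M j)"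
  by (simp add: carrier_dsum)

lemma pack_closed: "(\<And>j. j \<in> A \<Longrightarrow> y j \<in> carrier (M j)) \<Longrightarrow> pack A y \<in> carrier (dsum A M)"
  by (auto simp: dsum_def)

lemma dsum_eqI:
  assumes "x \<in> carrier (dsum A M)" "y \<in> carrier (dsum A M)" "\<And>j. j \<in> A \<Longrightarrow> coord j x = coord j y"
  shows "x = y"
  using assms by (metis carrier_dsum pack_cong)

lemma coord_zero [simp]: "j \<in> A \<Longrightarrow> coord j \<zero>\<^bsub>dsum A M\<^esub> = \<zero>\<^bsub>M j\<^esub>"
  and coord_add [simp]: "j \<in> A \<Longrightarrow> coord j (x \<oplus>\<^bsub>dsum A M\<^esub> y) = coord j x \<oplus>\<^bsub>M j\<^esub> coord j y"
  and coord_smult [simp]: "j \<in> A \<Longrightarrow> coord j (a \<odot>\<^bsub>dsum A M\<^esub> x) = a \<odot>\<^bsub>M j\<^esub> coord j x"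
  by (auto simp: dsum_def)

lemma left_module_dsum:
  assumes "ring R" and "\<And>j. j \<in> A \<Longrightarrow> left_module R (M j)"
  shows "left_module R (dsum A M)"
proof -
  interpret ring R by fact
  let ?D = "dsum A M"
  have ag: "abelian_group (M j)" if "j \<in> A" for j using assms(2)[OF that] by (simp add: left_module_def)
  have add: "x \<oplus>\<^bsub>?D\<^esub> y \<in> carrier ?D" if "x \<in> carrier ?D" "y \<in> carrier ?D" for x y
    using that ag unfolding dsum_def
    by (auto intro!: imageI simp: abelian_monoid.a_closed[OF abelian_group.axioms(1)])
  have smult: "a \<odot>\<^bsub>?D\<^esub> x \<in> carrier ?D" if "a \<in> carrier R" "x \<in> carrier ?D" for a x
    using that unfolding dsum_def by (auto intro!: imageI intro: left_module.smult_closed assms)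
  have zero: "\<zero>\<^bsub>?D\<^esub> \<in> carrier ?D"
    using ag unfolding dsum_def
    by (auto intro!: imageI simp: abelian_monoid.zero_closed[OF abelian_group.axioms(1)])
  note eqI = dsum_eqI[of _ A M] and mon = ag[THEN abelian_group.axioms(1)]
  show ?thesis
  proof (intro left_module.intro abelian_groupI left_module_axioms.intro)
    fix x assume x: "x \<in> carrier ?D"
    show "\<exists>y\<in>carrier ?D. y \<oplus>\<^bsub>?D\<^esub> x = \<zero>\<^bsub>?D\<^esub>"
    proof
      show y: "pack A (\<lambda>j. \<ominus>\<^bsub>M j\<^esub> coord j x) \<in> carrier ?D"
        using ag x by (intro pack_closed) (auto simp: coord_closed abelian_group.a_inv_closed)
      show "pack A (\<lambda>j. \<ominus>\<^bsub>M j\<^esub> coord j x) \<oplus>\<^bsub>?D\<^esub> x = \<zero>\<^bsub>?D\<^esub>"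
        by (rule eqI) (use x y zero ag in \<open>auto simp: add coord_closed abelian_group.l_neg\<close>)
    qed
    show "\<zero>\<^bsub>?D\<^esub> \<oplus>\<^bsub>?D\<^esub> x = x"
      by (rule eqI) (use x zero mon in \<open>auto simp: add coord_closed abelian_monoid.l_zero\<close>)
    show "\<one>\<^bsub>R\<^esub> \<odot>\<^bsub>?D\<^esub> x = x"
      by (rule eqI) (use x assms(2) in \<open>auto simp: smult coord_closed left_module.smult_one\<close>)
    fix y assume y: "y \<in> carrier ?D"
    show "x \<oplus>\<^bsub>?D\<^esub> y = y \<oplus>\<^bsub>?D\<^esub> x"
      by (rule eqI) (use x y mon in \<open>auto simp: add coord_closed intro: abelian_monoid.a_comm\<close>)
    show "x \<oplus>\<^bsub>?D\<^esub> y \<in> carrier ?D" using x y by (rule add)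
    fix z assume z: "z \<in> carrier ?D"
    show "x \<oplus>\<^bsub>?D\<^esub> y \<oplus>\<^bsub>?D\<^esub> z = x \<oplus>\<^bsub>?D\<^esub> (y \<oplus>\<^bsub>?D\<^esub> z)"
      by (rule eqI) (use x y z mon in \<open>auto simp: add coord_closed intro: abelian_monoid.a_assoc\<close>)
  next
    fix a x assume a: "a \<in> carrier R" and x: "x \<in> carrier ?D"
    show "a \<odot>\<^bsub>?D\<^esub> x \<in> carrier ?D" using a x by (rule smult)
    fix y assume y: "y \<in> carrier ?D"
    show "a \<odot>\<^bsub>?D\<^esub> (x \<oplus>\<^bsub>?D\<^esub> y) = a \<odot>\<^bsub>?D\<^esub> x \<oplus>\<^bsub>?D\<^esub> a \<odot>\<^bsub>?D\<^esub> y"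
      by (rule eqI) (use a x y in \<open>auto simp: add smult coord_closed
        intro: left_module.smult_r_distr[OF assms(2)]\<close>)
  next
    fix a b x assume a: "a \<in> carrier R" "b \<in> carrier R" and x: "x \<in> carrier ?D"
    show "(a \<oplus>\<^bsub>R\<^esub> b) \<odot>\<^bsub>?D\<^esub> x = a \<odot>\<^bsub>?D\<^esub> x \<oplus>\<^bsub>?D\<^esub> b \<odot>\<^bsub>?D\<^esub> x"
      by (rule eqI) (use a x in \<open>auto simp: add smult coord_closed
        intro: left_module.smult_l_distr[OF assms(2)]\<close>)
    show "(a \<otimes>\<^bsub>R\<^esub> b) \<odot>\<^bsub>?D\<^esub> x = a \<odot>\<^bsub>?D\<^esub> (b \<odot>\<^bsub>?D\<^esub> x)"
      by (rule eqI) (use a x in \<open>auto simp: smult coord_closed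
        intro: left_module.smult_assoc[OF assms(2)]\<close>)
  qed (fact | rule zero)+
qed

lemma coord_hom: "j \<in> A \<Longrightarrow> coord j \<in> lmod_hom R (dsum A M) (M j)"
  by (auto simp: lmod_hom_def coord_closed)

lemma pack_hom:
  assumes "\<And>j. j \<in> A \<Longrightarrow> h j \<in> lmod_hom R X (M j)"
  shows "(\<lambda>x. pack A (\<lambda>j. h j x)) \<in> lmod_hom R X (dsum A M)"
  using assms
  by (intro lmod_homI pack_closed)
    (auto intro!: pack_cong simp: dsum_def
      intro: lmod_hom_closed[OF assms] lmod_hom_add[OF assms] lmod_hom_smult[OF assms])

definition single :: "nat set \<Rightarrow> (nat \<Rightarrow> ('r, nat \<Rightarrow> 'r) module) \<Rightarrow> nat \<Rightarrow> (nat \<Rightarrow> 'r) \<Rightarrow> nat \<Rightarrow> 'r" where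
  "single A M j x = pack A (\<lambda>k. if k = j then x else \<zero>\<^bsub>M k\<^esub>)"

lemma coord_single: "k \<in> A \<Longrightarrow> coord k (single A M j x) = (if k = j then x else \<zero>\<^bsub>M k\<^esub>)"
  by (simp add: single_def)

lemma single_hom:
  assumes "\<And>k. k \<in> A \<Longrightarrow> left_module R (M k)"
  shows "single A M j \<in> lmod_hom R (M j) (dsum A M)"
  unfolding single_def[abs_def]
proof (rule pack_hom)
  fix k assume "k \<in> A"
  then show "(\<lambda>x. if k = j then x else \<zero>\<^bsub>M k\<^esub>) \<in> lmod_hom R (M j) (M k)"
    using assms by (cases "k = j") (simp_all add: lmod_hom_id lmod_hom_null)
qed


section \<open>Dual bases and projectivity\<close>

definition linear_forms :: "'r ring \<Rightarrow> ('r, 'm) module \<Rightarrow> ('m \<Rightarrow> 'r) set" where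
  "linear_forms R P = {\<psi> \<in> carrier P \<rightarrow> carrier R.
     (\<forall>x\<in>carrier P. \<forall>y\<in>carrier P. \<psi> (x \<oplus>\<^bsub>P\<^esub> y) = \<psi> x \<oplus>\<^bsub>R\<^esub> \<psi> y) \<and>
     (\<forall>a\<in>carrier R. \<forall>x\<in>carrier P. \<psi> (a \<odot>\<^bsub>P\<^esub> x) = a \<otimes>\<^bsub>R\<^esub> \<psi> x)}"

text \<open>The data of the dual basis lemma, refined by elements \<open>e k\<close> that are
  idempotent in all uses: y goes to the family of the \<psi>_k(y) in the sum of the R e_k, which
  maps back by sending e_k to x_k, and the composite is the identity. So P is a direct summand of
  the sum of the R e_k.\<close>

definition dual_basis :: "'r ring \<Rightarrow> ('r, 'm) module \<Rightarrow> nat set \<Rightarrow>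
    (nat \<Rightarrow> 'r) \<Rightarrow> (nat \<Rightarrow> 'm) \<Rightarrow> (nat \<Rightarrow> 'm \<Rightarrow> 'r) \<Rightarrow> bool" where
  "dual_basis R P I e x \<psi> \<longleftrightarrow> finite I \<and>
     (\<forall>k\<in>I. e k \<in> carrier R \<and> x k \<in> carrier P \<and> e k \<odot>\<^bsub>P\<^esub> x k = x k \<and> \<psi> k \<in> linear_forms R P \<and>
        (\<forall>y\<in>carrier P. \<psi> k y \<otimes>\<^bsub>R\<^esub> e k = \<psi> k y)) \<and>
     (\<forall>y\<in>carrier P. y = finsum P (\<lambda>k. \<psi> k y \<odot>\<^bsub>P\<^esub> x k) I)"

text \<open>\<open>E\<close> bounds the labels that may occur, with repetitions allowed. For
  idempotents it says that P is a summand of a finite sum of left ideals R e with e in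
  \<open>E\<close>.\<close>

definition has_basis :: "'r ring \<Rightarrow> 'r set \<Rightarrow> ('r, 'm) module \<Rightarrow> bool" where
  "has_basis R E P \<longleftrightarrow> left_module R P \<and> (\<exists>I e x \<psi>. dual_basis R P I e x \<psi> \<and> e ` I \<subseteq> E)"

lemma has_basis_mono: "has_basis R E P \<Longrightarrow> E \<subseteq> E' \<Longrightarrow> has_basis R E' P"
  unfolding has_basis_def by (meson subset_trans)

lemma has_basis_zero: "ring R \<Longrightarrow> left_module R P \<Longrightarrow> carrier P = {\<zero>\<^bsub>P\<^esub>} \<Longrightarrow> has_basis R E P"
  by (auto simp: has_basis_def dual_basis_def abelian_monoid.finsum_empty abelian_group_def
    left_module_def intro!: exI[of _ "{}"])

text \<open>The dual bases of the summands are placed side by side, the pair (summand, basis index)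
  being coded as one natural number.\<close>

lemma has_basis_dsum:
  assumes R: "ring R" and A: "finite A" and M: "\<And>j. j \<in> A \<Longrightarrow> has_basis R E (M j)"
  shows "has_basis R E (dsum A M)"
proof -
  have lm: "left_module R (M j)" if "j \<in> A" for j using M[OF that] by (simp add: has_basis_def)
  have D: "left_module R (dsum A M)" using R lm by (rule left_module_dsum)
  interpret D: left_module R "dsum A M" by fact
  have "\<forall>j\<in>A. \<exists>I e x \<psi>. dual_basis R (M j) I e x \<psi> \<and> e ` I \<subseteq> E"
    using M by (simp add: has_basis_def)
  then obtain I e x \<psi> where b: "\<And>j. j \<in> A \<Longrightarrow> dual_basis R (M j) (I j) (e j) (x j) (\<psi> j)"
    and eE: "\<And>j. j \<in> A \<Longrightarrow> e j ` I j \<subseteq> E" by metis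
  let ?S = "SIGMA j:A. I j"
  let ?I = "prod_encode ` ?S"
  define e' where "e' = (\<lambda>l. case prod_decode l of (j, k) \<Rightarrow> e j k)"
  define x' where "x' = (\<lambda>l. case prod_decode l of (j, k) \<Rightarrow> single A M j (x j k))"
  define \<psi>' where "\<psi>' = (\<lambda>l y. case prod_decode l of (j, k) \<Rightarrow> \<psi> j k (coord j y))"
  have fin: "finite ?I" using A b by (auto simp: dual_basis_def)
  have sh: "single A M j \<in> lmod_hom R (M j) (dsum A M)" for j using lm by (rule single_hom)
  have mem: "e j k \<in> carrier R" "x j k \<in> carrier (M j)" "e j k \<odot>\<^bsub>M j\<^esub> x j k = x j k"
      "\<psi> j k \<in> linear_forms R (M j)" "\<And>y. y \<in> carrier (M j) \<Longrightarrow> \<psi> j k y \<otimes>\<^bsub>R\<^esub> e j k = \<psi> j k y"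
      "\<And>y. y \<in> carrier (M j) \<Longrightarrow> \<psi> j k y \<in> carrier R"
    if "j \<in> A" "k \<in> I j" for j k
    using b[OF that(1)] that by (auto simp: dual_basis_def linear_forms_def)
  have "\<forall>l\<in>?I. e' l \<in> carrier R \<and> x' l \<in> carrier (dsum A M) \<and> e' l \<odot>\<^bsub>dsum A M\<^esub> x' l = x' l \<and>
      \<psi>' l \<in> linear_forms R (dsum A M) \<and> (\<forall>y\<in>carrier (dsum A M). \<psi>' l y \<otimes>\<^bsub>R\<^esub> e' l = \<psi>' l y)"
  proof
    fix l assume "l \<in> ?I"
    then obtain j k where l: "l = prod_encode (j, k)" "j \<in> A" "k \<in> I j" by auto
    have lf: "\<psi>' l \<in> linear_forms R (dsum A M)"
      using mem(4)[OF l(2,3)] l(1,2) unfolding linear_forms_def \<psi>'_def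
      by (auto simp: coord_closed)
    have "e j k \<odot>\<^bsub>dsum A M\<^esub> single A M j (x j k) = single A M j (x j k)"
      using lmod_hom_smult[OF sh mem(1,2)[OF l(2,3)]] mem(3)[OF l(2,3)] by simp
    with mem[OF l(2,3)] lf show "e' l \<in> carrier R \<and> x' l \<in> carrier (dsum A M) \<and> e' l \<odot>\<^bsub>dsum A M\<^esub> x' l = x' l \<and>
      \<psi>' l \<in> linear_forms R (dsum A M) \<and> (\<forall>y\<in>carrier (dsum A M). \<psi>' l y \<otimes>\<^bsub>R\<^esub> e' l = \<psi>' l y)"
      using l by (auto simp: e'_def x'_def \<psi>'_def lmod_hom_closed[OF sh] coord_closed)
  qed
  note gen = this
  have "y = finsum (dsum A M) (\<lambda>l. \<psi>' l y \<odot>\<^bsub>dsum A M\<^esub> x' l) ?I" (is "y = finsum _ ?g _")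
    if y: "y \<in> carrier (dsum A M)" for y
  proof (rule dsum_eqI[OF y])
    have g: "?g \<in> ?I \<rightarrow> carrier (dsum A M)"
      using gen y unfolding linear_forms_def by (intro Pi_I D.smult_closed) blast+
    then show "finsum (dsum A M) ?g ?I \<in> carrier (dsum A M)" by (rule D.M.finsum_closed)
    fix j assume j: "j \<in> A"
    interpret Mj: left_module R "M j" by (rule lm[OF j])
    have inj: "inj_on (\<lambda>k. prod_encode (j, k)) (I j)" by (auto simp: inj_on_def)
    have cl: "(\<lambda>l. coord j (?g l)) \<in> ?I \<rightarrow> carrier (M j)"
      using g j unfolding Pi_iff by (blast intro: coord_closed)
    have sub: "(\<lambda>k. prod_encode (j, k)) ` I j \<subseteq> ?I" using j by auto
    \<comment> \<open>Generators coming from another summand have j-th coordinate zero, so the big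
      sum reduces to the block of \<open>j\<close>, where it is the expansion of the j-th
      coordinate.\<close>
    have zero: "coord j (?g l) = \<zero>\<^bsub>M j\<^esub>" if "l \<in> ?I - (\<lambda>k. prod_encode (j, k)) ` I j" for l
    proof -
      obtain j' k where l: "l = prod_encode (j', k)" "j' \<in> A" "k \<in> I j'" "j' \<noteq> j"
        using \<open>l \<in> _\<close> by auto
      then show ?thesis using mem(6)[OF l(2,3) coord_closed[OF y l(2)]] j
        by (simp add: \<psi>'_def x'_def coord_single)
    qed
    have "coord j (finsum (dsum A M) ?g ?I) = finsum (M j) (\<lambda>l. coord j (?g l)) ?I"
      by (rule lmod_hom_finsum[OF coord_hom D lm]) (use j fin g in auto)
    also have "\<dots> = finsum (M j) (\<lambda>l. coord j (?g l)) ((\<lambda>k. prod_encode (j, k)) ` I j)"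
      by (rule Mj.M.add.finprod_mono_neutral_cong_right) (use fin sub zero cl in \<open>auto simp: Pi_iff\<close>)
    also have "\<dots> = finsum (M j) (\<lambda>k. coord j (?g (prod_encode (j, k)))) (I j)"
      by (rule Mj.M.add.finprod_reindex) (use inj cl sub in \<open>auto simp: Pi_iff\<close>)
    also have "\<dots> = finsum (M j) (\<lambda>k. \<psi> j k (coord j y) \<odot>\<^bsub>M j\<^esub> x j k) (I j)"
      by (rule Mj.M.finsum_cong')
        (use j mem(2,6)[OF j] coord_closed[OF y j] in \<open>auto simp: \<psi>'_def x'_def coord_single\<close>)
    also have "\<dots> = coord j y"
      using b[OF j] coord_closed[OF y j] unfolding dual_basis_def by metis
    finally show "coord j y = coord j (finsum (dsum A M) ?g ?I)" by simp
  qed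
  then have "dual_basis R (dsum A M) ?I e' x' \<psi>'" using gen fin unfolding dual_basis_def by blast
  moreover have "e' ` ?I \<subseteq> E" using eE by (fastforce simp: e'_def)
  ultimately show ?thesis using D unfolding has_basis_def by blast
qed

lemma left_module_left_ideal:
  assumes "ring R" "e \<in> carrier R"
  shows "left_module R (left_ideal_module R e)"
proof -
  interpret ring R by fact
  show ?thesis
  proof (intro left_module.intro abelian_groupI left_module_axioms.intro)
    show "ring R" by fact
    show "\<exists>y\<in>carrier (left_ideal_module R e). y \<oplus>\<^bsub>left_ideal_module R e\<^esub> x = \<zero>\<^bsub>left_ideal_module R e\<^esub>"
      if x: "x \<in> carrier (left_ideal_module R e)" for x
    proof -
      obtain a where a: "a \<in> carrier R" "x = (\<lambda>_. a \<otimes>\<^bsub>R\<^esub> e)" using x by (auto simp: left_ideal_module_def)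
      then show ?thesis using assms(2)
        by (intro bexI[of _ "\<lambda>_. (\<ominus>\<^bsub>R\<^esub> a) \<otimes>\<^bsub>R\<^esub> e"])
          (auto simp: left_ideal_module_def l_neg l_distr[symmetric] simp del: l_minus)
    qed
    fix x y assume "x \<in> carrier (left_ideal_module R e)" "y \<in> carrier (left_ideal_module R e)"
    then obtain a b where "a \<in> carrier R" "x = (\<lambda>_. a \<otimes>\<^bsub>R\<^esub> e)" "b \<in> carrier R" "y = (\<lambda>_. b \<otimes>\<^bsub>R\<^esub> e)"
      by (auto simp: left_ideal_module_def)
    then show "x \<oplus>\<^bsub>left_ideal_module R e\<^esub> y \<in> carrier (left_ideal_module R e)" using assms(2)
      by (auto simp: left_ideal_module_def l_distr[symmetric])
  next
    show "\<zero>\<^bsub>left_ideal_module R e\<^esub> \<in> carrier (left_ideal_module R e)" using assms(2)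
      by (auto simp: left_ideal_module_def intro!: image_eqI[of _ _ "\<zero>\<^bsub>R\<^esub>"])
  next
    fix a x assume "a \<in> carrier R" "x \<in> carrier (left_ideal_module R e)"
    then show "a \<odot>\<^bsub>left_ideal_module R e\<^esub> x \<in> carrier (left_ideal_module R e)" using assms(2)
      by (auto simp: left_ideal_module_def m_assoc[symmetric])
  qed (use assms(2) in \<open>auto simp: left_ideal_module_def a_ac m_assoc l_distr r_distr\<close>)
qed

text \<open>For an idempotent e, lying in R e is the fixed-point equation a e = a. The other
  conjunct is the encoding by constant sequences, which are read off at position 0.\<close>

lemma carrier_left_ideal:
  assumes "ring R" "e \<in> carrier R" "e \<otimes>\<^bsub>R\<^esub> e = e"
  shows "x \<in> carrier (left_ideal_module R e) \<longleftrightarrow> x = (\<lambda>_. x 0) \<and> x 0 \<in> carrier R \<and> x 0 \<otimes>\<^bsub>R\<^esub> e = x 0"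
proof -
  interpret ring R by fact
  show ?thesis using assms(2,3)
    by (auto simp: left_ideal_module_def m_assoc intro!: image_eqI[of _ _ "x 0"])
qed

text \<open>One generator is enough: e itself, with the inclusion of R e into R as its form, since y
  = y e.\<close>

lemma has_basis_left_ideal:
  assumes R: "ring R" and e: "e \<in> carrier R" "e \<otimes>\<^bsub>R\<^esub> e = e"
  shows "has_basis R {e} (left_ideal_module R e)"
proof -
  interpret M: left_module R "left_ideal_module R e" using R e(1) by (rule left_module_left_ideal)
  have "dual_basis R (left_ideal_module R e) {0} (\<lambda>_. e) (\<lambda>_ _. e) (\<lambda>_ x. x 0)"
    unfolding dual_basis_def linear_forms_def
  proof (intro conjI ballI)
    fix y assume y: "y \<in> carrier (left_ideal_module R e)"
    then have y': "y = (\<lambda>_. y 0)" "y 0 \<in> carrier R" "y 0 \<otimes>\<^bsub>R\<^esub> e = y 0"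
      using carrier_left_ideal[OF R e] by auto
    have "y 0 \<odot>\<^bsub>left_ideal_module R e\<^esub> (\<lambda>_. e) = y"
      using y' by (simp add: left_ideal_module_def)
    then show "y = finsum (left_ideal_module R e) (\<lambda>k. y 0 \<odot>\<^bsub>left_ideal_module R e\<^esub> (\<lambda>_. e)) {0}"
      using y by simp
  qed (use R e carrier_left_ideal[OF R e] in \<open>auto simp: left_ideal_module_def\<close>)
  then show ?thesis unfolding has_basis_def using M.left_module_axioms by fastforce
qed

lemma has_basis_fg:
  assumes "has_basis R E P" shows "fg_module R P"
proof -
  obtain I e x \<psi> where b: "dual_basis R P I e x \<psi>" and P: "left_module R P"
    using assms by (auto simp: has_basis_def)
  interpret P: left_module R P by fact
  have "N = carrier P" if N: "submodule N R P" and sub: "x ` I \<subseteq> N" for N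
  proof -
    interpret N: submodule N R P by fact
    have "y \<in> N" if y: "y \<in> carrier P" for y
    proof -
      have fin: "finite I" using b by (simp add: dual_basis_def)
      have cl: "\<psi> k y \<odot>\<^bsub>P\<^esub> x k \<in> N" if "k \<in> I" for k
        using b y sub that by (intro N.smult_closed) (auto simp: dual_basis_def linear_forms_def)
      have "finsum P (\<lambda>k. \<psi> k y \<odot>\<^bsub>P\<^esub> x k) J \<in> N" if "J \<subseteq> I" for J
      proof -
        have "finite J" using that fin by (rule finite_subset)
        then show ?thesis using that
        proof (induction J)
          case empty then show ?case using N.one_closed by simp
        next
          case (insert k J)
          then have "(\<lambda>k. \<psi> k y \<odot>\<^bsub>P\<^esub> x k) \<in> J \<rightarrow> carrier P" "\<psi> k y \<odot>\<^bsub>P\<^esub> x k \<in> carrier P"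
            using cl N.subset by auto
          then show ?case using insert cl[of k] N.m_closed by simp
        qed
      qed
      then show ?thesis using b y unfolding dual_basis_def by (metis order_refl)
    qed
    then show ?thesis using N.subset by auto
  qed
  moreover have "finite (x ` I)" "x ` I \<subseteq> carrier P" using b by (auto simp: dual_basis_def)
  ultimately show ?thesis unfolding fg_module_def using P by blast
qed

text \<open>Projectivity is phrased for linear relations, so that several maps subject to linear conditions
  can be chosen at once.\<close>

lemma has_basis_select:
  assumes P: "has_basis R E P" and M1: "left_module R M1" and M2: "left_module R M2"
    and tot: "\<And>x. x \<in> carrier P \<Longrightarrow> \<exists>m1\<in>carrier M1. \<exists>m2\<in>carrier M2. S x m1 m2"
    and add: "\<And>x m1 m2 x' m1' m2'. S x m1 m2 \<Longrightarrow> S x' m1' m2' \<Longrightarrow>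
        x \<in> carrier P \<Longrightarrow> m1 \<in> carrier M1 \<Longrightarrow> m2 \<in> carrier M2 \<Longrightarrow>
        x' \<in> carrier P \<Longrightarrow> m1' \<in> carrier M1 \<Longrightarrow> m2' \<in> carrier M2 \<Longrightarrow>
        S (x \<oplus>\<^bsub>P\<^esub> x') (m1 \<oplus>\<^bsub>M1\<^esub> m1') (m2 \<oplus>\<^bsub>M2\<^esub> m2')"
    and smult: "\<And>a x m1 m2. S x m1 m2 \<Longrightarrow> a \<in> carrier R \<Longrightarrow> x \<in> carrier P \<Longrightarrow> m1 \<in> carrier M1 \<Longrightarrow>
        m2 \<in> carrier M2 \<Longrightarrow> S (a \<odot>\<^bsub>P\<^esub> x) (a \<odot>\<^bsub>M1\<^esub> m1) (a \<odot>\<^bsub>M2\<^esub> m2)"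
  shows "\<exists>h1\<in>lmod_hom R P M1. \<exists>h2\<in>lmod_hom R P M2. \<forall>x\<in>carrier P. S x (h1 x) (h2 x)"
proof -
  obtain I e x \<psi> where b: "dual_basis R P I e x \<psi>" and P': "left_module R P"
    using P by (auto simp: has_basis_def)
  interpret P: left_module R P by fact
  interpret M1: left_module R M1 by fact
  interpret M2: left_module R M2 by fact
  have fin: "finite I" and x: "\<And>k. k \<in> I \<Longrightarrow> x k \<in> carrier P"
    and \<psi>: "\<And>k. k \<in> I \<Longrightarrow> \<psi> k \<in> linear_forms R P"
    and expand: "\<And>y. y \<in> carrier P \<Longrightarrow> finsum P (\<lambda>k. \<psi> k y \<odot>\<^bsub>P\<^esub> x k) I = y"
    using b by (auto simp: dual_basis_def)
  have \<psi>c: "\<psi> k y \<in> carrier R" if "k \<in> I" "y \<in> carrier P" for k y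
    using \<psi>[OF that(1)] that(2) by (auto simp: linear_forms_def)
  have "\<forall>k\<in>I. \<exists>m1 m2. m1 \<in> carrier M1 \<and> m2 \<in> carrier M2 \<and> S (x k) m1 m2"
    using tot x by blast
  then obtain m1 m2 where m: "\<And>k. k \<in> I \<Longrightarrow> m1 k \<in> carrier M1" "\<And>k. k \<in> I \<Longrightarrow> m2 k \<in> carrier M2"
    "\<And>k. k \<in> I \<Longrightarrow> S (x k) (m1 k) (m2 k)"
    by metis
  \<comment> \<open>Values prescribed on the x_k extend to the map that sends y to the sum of the
    \<psi>_k(y) m_k. It is linear because the forms are, whether or not the x_k are
    independent.\<close>
  have hom: "(\<lambda>y. finsum M (\<lambda>k. \<psi> k y \<odot>\<^bsub>M\<^esub> m k) I) \<in> lmod_hom R P M"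
    if M: "left_module R M" and m: "\<And>k. k \<in> I \<Longrightarrow> m k \<in> carrier M" for M m
  proof -
    interpret M: left_module R M by fact
    show ?thesis
    proof (rule lmod_homI)
      fix y assume y: "y \<in> carrier P"
      show "finsum M (\<lambda>k. \<psi> k y \<odot>\<^bsub>M\<^esub> m k) I \<in> carrier M"
        using m \<psi>c y by (intro M.M.finsum_closed) auto
      fix z assume z: "z \<in> carrier P"
      have "finsum M (\<lambda>k. \<psi> k (y \<oplus>\<^bsub>P\<^esub> z) \<odot>\<^bsub>M\<^esub> m k) I
          = finsum M (\<lambda>k. \<psi> k y \<odot>\<^bsub>M\<^esub> m k \<oplus>\<^bsub>M\<^esub> \<psi> k z \<odot>\<^bsub>M\<^esub> m k) I"
        using m \<psi>c y z \<psi> by (intro M.M.finsum_cong') (auto simp: linear_forms_def M.smult_l_distr)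
      then show "finsum M (\<lambda>k. \<psi> k (y \<oplus>\<^bsub>P\<^esub> z) \<odot>\<^bsub>M\<^esub> m k) I
          = finsum M (\<lambda>k. \<psi> k y \<odot>\<^bsub>M\<^esub> m k) I \<oplus>\<^bsub>M\<^esub> finsum M (\<lambda>k. \<psi> k z \<odot>\<^bsub>M\<^esub> m k) I"
        using m \<psi>c y z by (subst M.M.finsum_addf[symmetric]) auto
    next
      fix a y assume a: "a \<in> carrier R" and y: "y \<in> carrier P"
      have "finsum M (\<lambda>k. \<psi> k (a \<odot>\<^bsub>P\<^esub> y) \<odot>\<^bsub>M\<^esub> m k) I
          = finsum M (\<lambda>k. a \<odot>\<^bsub>M\<^esub> (\<psi> k y \<odot>\<^bsub>M\<^esub> m k)) I"
        using m \<psi>c y a \<psi> by (intro M.M.finsum_cong') (auto simp: linear_forms_def M.smult_assoc)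
      then show "finsum M (\<lambda>k. \<psi> k (a \<odot>\<^bsub>P\<^esub> y) \<odot>\<^bsub>M\<^esub> m k) I = a \<odot>\<^bsub>M\<^esub> finsum M (\<lambda>k. \<psi> k y \<odot>\<^bsub>M\<^esub> m k) I"
        using m \<psi>c y a fin by (subst M.finsum_smult) auto
    qed
  qed
  have "S y (finsum M1 (\<lambda>k. \<psi> k y \<odot>\<^bsub>M1\<^esub> m1 k) I) (finsum M2 (\<lambda>k. \<psi> k y \<odot>\<^bsub>M2\<^esub> m2 k) I)"
    if y: "y \<in> carrier P" for y
  proof -
    \<comment> \<open>Scaling a related triple by 0 puts the zero triple into the relation; this
      starts the induction over partial sums.\<close>
    have S0: "S \<zero>\<^bsub>P\<^esub> \<zero>\<^bsub>M1\<^esub> \<zero>\<^bsub>M2\<^esub>"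
    proof -
      obtain n1 n2 where "n1 \<in> carrier M1" "n2 \<in> carrier M2" "S y n1 n2" using tot[OF y] by blast
      then show ?thesis using smult[of y n1 n2 "\<zero>\<^bsub>R\<^esub>"] y by simp
    qed
    have "S (finsum P (\<lambda>k. \<psi> k y \<odot>\<^bsub>P\<^esub> x k) J)
        (finsum M1 (\<lambda>k. \<psi> k y \<odot>\<^bsub>M1\<^esub> m1 k) J) (finsum M2 (\<lambda>k. \<psi> k y \<odot>\<^bsub>M2\<^esub> m2 k) J)"
      if "J \<subseteq> I" for J
    proof -
      have "finite J" using that fin by (rule finite_subset)
      then show ?thesis using that
      proof (induction J)
        case (insert k J)
        have cl: "(\<lambda>k. \<psi> k y \<odot>\<^bsub>P\<^esub> x k) \<in> J \<rightarrow> carrier P" "\<psi> k y \<odot>\<^bsub>P\<^esub> x k \<in> carrier P"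
          "(\<lambda>k. \<psi> k y \<odot>\<^bsub>M1\<^esub> m1 k) \<in> J \<rightarrow> carrier M1" "\<psi> k y \<odot>\<^bsub>M1\<^esub> m1 k \<in> carrier M1"
          "(\<lambda>k. \<psi> k y \<odot>\<^bsub>M2\<^esub> m2 k) \<in> J \<rightarrow> carrier M2" "\<psi> k y \<odot>\<^bsub>M2\<^esub> m2 k \<in> carrier M2"
          using insert.prems \<psi>c y m x by auto
        have "S (\<psi> k y \<odot>\<^bsub>P\<^esub> x k) (\<psi> k y \<odot>\<^bsub>M1\<^esub> m1 k) (\<psi> k y \<odot>\<^bsub>M2\<^esub> m2 k)"
          using insert.prems \<psi>c y m x by (intro smult) auto
        then have "S (\<psi> k y \<odot>\<^bsub>P\<^esub> x k \<oplus>\<^bsub>P\<^esub> finsum P (\<lambda>k. \<psi> k y \<odot>\<^bsub>P\<^esub> x k) J)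
          (\<psi> k y \<odot>\<^bsub>M1\<^esub> m1 k \<oplus>\<^bsub>M1\<^esub> finsum M1 (\<lambda>k. \<psi> k y \<odot>\<^bsub>M1\<^esub> m1 k) J)
          (\<psi> k y \<odot>\<^bsub>M2\<^esub> m2 k \<oplus>\<^bsub>M2\<^esub> finsum M2 (\<lambda>k. \<psi> k y \<odot>\<^bsub>M2\<^esub> m2 k) J)"
          using insert cl by (intro add) auto
        then show ?case using insert cl by simp
      qed (use S0 in simp)
    qed
    then show ?thesis using expand[OF y] by (metis order_refl)
  qed
  then show ?thesis
    by (intro bexI[OF _ hom[OF M1 m(1)]] bexI[OF _ hom[OF M2 m(2)]] ballI)
qed

lemma has_basis_select1:
  assumes P: "has_basis R E P" and M: "left_module R M"
    and tot: "\<And>x. x \<in> carrier P \<Longrightarrow> \<exists>m\<in>carrier M. S x m"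
    and add: "\<And>x m x' m'. S x m \<Longrightarrow> S x' m' \<Longrightarrow>
        x \<in> carrier P \<Longrightarrow> m \<in> carrier M \<Longrightarrow> x' \<in> carrier P \<Longrightarrow> m' \<in> carrier M \<Longrightarrow>
        S (x \<oplus>\<^bsub>P\<^esub> x') (m \<oplus>\<^bsub>M\<^esub> m')"
    and smult: "\<And>a x m. S x m \<Longrightarrow> a \<in> carrier R \<Longrightarrow> x \<in> carrier P \<Longrightarrow> m \<in> carrier M \<Longrightarrow>
        S (a \<odot>\<^bsub>P\<^esub> x) (a \<odot>\<^bsub>M\<^esub> m)"
  shows "\<exists>h\<in>lmod_hom R P M. \<forall>x\<in>carrier P. S x (h x)"
proof -
  have "\<exists>h\<in>lmod_hom R P M. \<exists>h2\<in>lmod_hom R P M. \<forall>x\<in>carrier P. S x (h x)"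
    by (rule has_basis_select[OF P M M]) (use tot in blast, (rule add smult; assumption)+)
  then show ?thesis by blast
qed

text \<open>Lifting h along g is the selection problem for the relation g m = h x, which is total
  because g is onto and linear because both maps are.\<close>

lemma has_basis_fg_projective:
  assumes P: "has_basis R E P" shows "fg_projective R P"
  unfolding fg_projective_def
proof (intro conjI allI ballI impI)
  fix M N g h
  assume g: "g \<in> lmod_hom R M N" and h: "h \<in> lmod_hom R P N"
    and "fg_module R M \<and> fg_module R N \<and> g ` carrier M = carrier N"
  then have M: "left_module R M" and N: "left_module R N" and sur: "g ` carrier M = carrier N"
    by (auto simp: fg_module_def)
  have "\<exists>m\<in>carrier M. g m = h x" if "x \<in> carrier P" for x
    using lmod_hom_closed[OF h that] sur by (metis imageE)
  then show "\<exists>h'\<in>lmod_hom R P M. \<forall>x\<in>carrier P. g (h' x) = h x"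
    by (intro has_basis_select1[OF P M, of "\<lambda>x m. g m = h x"])
      (auto simp: lmod_hom_add[OF g] lmod_hom_add[OF h] lmod_hom_smult[OF g] lmod_hom_smult[OF h])
qed (rule has_basis_fg[OF P])


section \<open>Quasi-isomorphisms\<close>

lemma is_cplx_module: "is_cplx R X \<Longrightarrow> left_module R (cobj X k)"
  and is_cplx_diff: "is_cplx R X \<Longrightarrow> cdiff X k \<in> lmod_hom R (cobj X k) (cobj X (k + 1))"
  and is_cplx_dd: "is_cplx R X \<Longrightarrow> x \<in> carrier (cobj X k) \<Longrightarrow>
    cdiff X (k + 1) (cdiff X k x) = \<zero>\<^bsub>cobj X (k + 2)\<^esub>"
  by (auto simp: is_cplx_def)

lemma chain_maps_hom: "\<phi> \<in> chain_maps R X Y \<Longrightarrow> \<phi> k \<in> lmod_hom R (cobj X k) (cobj Y k)"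
  and chain_maps_diff: "\<phi> \<in> chain_maps R X Y \<Longrightarrow> x \<in> carrier (cobj X k) \<Longrightarrow>
    \<phi> (k + 1) (cdiff X k x) = cdiff Y k (\<phi> k x)"
  by (auto simp: chain_maps_def)

lemma Db_objectsD:
  assumes "X \<in> Db_objects R"
  shows "is_cplx R X" "bounded_cplx X" "fg_module R (cobj X k)"
  using assms by (auto simp: Db_objects_def)

lemma chain_id_chain_map: "chain_id \<in> chain_maps R X X"
  by (simp add: chain_maps_def chain_id_def lmod_hom_id)

lemma chain_comp_chain_map:
  assumes "\<phi> \<in> chain_maps R X Y" "\<psi> \<in> chain_maps R Y Z"
  shows "\<psi> \<circ>\<^sub>c \<phi> \<in> chain_maps R X Z"
proof -
  have "(\<psi> \<circ>\<^sub>c \<phi>) k \<in> lmod_hom R (cobj X k) (cobj Z k)" for k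
    using lmod_hom_compose[OF chain_maps_hom[OF assms(1)] chain_maps_hom[OF assms(2)]]
    by (simp add: chain_comp_def comp_def)
  moreover have "(\<psi> \<circ>\<^sub>c \<phi>) (k + 1) (cdiff X k x) = cdiff Z k ((\<psi> \<circ>\<^sub>c \<phi>) k x)"
    if "x \<in> carrier (cobj X k)" for k x
    using that chain_maps_diff[OF assms(1) that]
      chain_maps_diff[OF assms(2) lmod_hom_closed[OF chain_maps_hom[OF assms(1)] that]]
    by (simp add: chain_comp_def)
  ultimately show ?thesis by (simp add: chain_maps_def)
qed

lemma a_r_coset_eq_iff:
  assumes M: "left_module R M" and B: "B \<subseteq> carrier M" "\<zero>\<^bsub>M\<^esub> \<in> B"
    "\<And>x y. x \<in> B \<Longrightarrow> y \<in> B \<Longrightarrow> x \<oplus>\<^bsub>M\<^esub> y \<in> B" "\<And>x. x \<in> B \<Longrightarrow> \<ominus>\<^bsub>M\<^esub> x \<in> B"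
    and z: "z \<in> carrier M" and w: "w \<in> carrier M"
  shows "B +>\<^bsub>M\<^esub> z = B +>\<^bsub>M\<^esub> w \<longleftrightarrow> (\<exists>b\<in>B. z = b \<oplus>\<^bsub>M\<^esub> w)"
proof
  interpret left_module R M by fact
  assume eq: "B +>\<^bsub>M\<^esub> z = B +>\<^bsub>M\<^esub> w"
  have "z \<in> B +>\<^bsub>M\<^esub> z" using B z by (auto simp: a_r_coset_def' intro!: exI[of _ "\<zero>\<^bsub>M\<^esub>"] bexI[of _ "\<zero>\<^bsub>M\<^esub>"])
  then show "\<exists>b\<in>B. z = b \<oplus>\<^bsub>M\<^esub> w" unfolding eq by (auto simp: a_r_coset_def')
next
  interpret left_module R M by fact
  assume "\<exists>b\<in>B. z = b \<oplus>\<^bsub>M\<^esub> w"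
  then obtain b where b: "b \<in> B" "z = b \<oplus>\<^bsub>M\<^esub> w" by blast
  have bc: "b \<in> carrier M" using b B by auto
  have "c \<oplus>\<^bsub>M\<^esub> z = (c \<oplus>\<^bsub>M\<^esub> b) \<oplus>\<^bsub>M\<^esub> w \<and> c \<oplus>\<^bsub>M\<^esub> b \<in> B" if "c \<in> B" for c
    using that B b w bc by (auto simp: M.a_assoc)
  moreover have "c \<oplus>\<^bsub>M\<^esub> w = (c \<oplus>\<^bsub>M\<^esub> (\<ominus>\<^bsub>M\<^esub> b)) \<oplus>\<^bsub>M\<^esub> z \<and> c \<oplus>\<^bsub>M\<^esub> (\<ominus>\<^bsub>M\<^esub> b) \<in> B" if "c \<in> B" for c
  proof -
    have "c \<in> carrier M" using that B by auto
    then have "(c \<oplus>\<^bsub>M\<^esub> (\<ominus>\<^bsub>M\<^esub> b)) \<oplus>\<^bsub>M\<^esub> z = c \<oplus>\<^bsub>M\<^esub> ((\<ominus>\<^bsub>M\<^esub> b \<oplus>\<^bsub>M\<^esub> b) \<oplus>\<^bsub>M\<^esub> w)"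
      using bc w b(2) by (simp add: M.a_assoc)
    then show ?thesis using that B b bc w by (simp add: M.l_neg)
  qed
  ultimately show "B +>\<^bsub>M\<^esub> z = B +>\<^bsub>M\<^esub> w" unfolding a_r_coset_def' by blast
qed

context
  fixes R :: "'r ring" and X :: "('r, 'm) cplx"
  assumes X: "is_cplx R X"
begin

lemma cocycles_closed: "x \<in> cocycles X k \<Longrightarrow> x \<in> carrier (cobj X k)"
  by (simp add: cocycles_def)

lemma coboundaries_subset: "coboundaries X k \<subseteq> cocycles X k"
proof
  fix x assume "x \<in> coboundaries X k"
  then obtain w where w: "w \<in> carrier (cobj X (k - 1))" "x = cdiff X (k - 1) w"
    by (auto simp: coboundaries_def)
  then show "x \<in> cocycles X k"
    using is_cplx_dd[OF X w(1)] lmod_hom_closed[OF is_cplx_diff[OF X] w(1)]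
    by (simp add: cocycles_def add.commute)
qed

lemma cocycles_minus:
  assumes "x \<in> cocycles X k" "y \<in> cocycles X k"
  shows "x \<ominus>\<^bsub>cobj X k\<^esub> y \<in> cocycles X k"
proof -
  interpret M: left_module R "cobj X k" by (rule is_cplx_module[OF X])
  interpret N: left_module R "cobj X (k + 1)" by (rule is_cplx_module[OF X])
  have x: "x \<in> carrier (cobj X k)" "y \<in> carrier (cobj X k)" using assms by (auto simp: cocycles_def)
  have "cdiff X k (x \<ominus>\<^bsub>cobj X k\<^esub> y) = \<zero>\<^bsub>cobj X (k + 1)\<^esub>"
    using assms x lmod_hom_add[OF is_cplx_diff[OF X], of x k "\<ominus>\<^bsub>cobj X k\<^esub> y"]
      lmod_hom_minus[OF is_cplx_diff[OF X] M.left_module_axioms N.left_module_axioms x(2)]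
    by (simp add: a_minus_def cocycles_def)
  then show ?thesis using x by (simp add: cocycles_def)
qed

lemma coboundaries_zero: "\<zero>\<^bsub>cobj X k\<^esub> \<in> coboundaries X k"
proof -
  have "\<zero>\<^bsub>cobj X (k - 1)\<^esub> \<in> carrier (cobj X (k - 1))"
    using is_cplx_module[OF X] by (simp add: left_module_def abelian_group_def abelian_monoid.zero_closed)
  then show ?thesis
    unfolding coboundaries_def
    using lmod_hom_zero[OF is_cplx_diff[OF X] is_cplx_module[OF X] is_cplx_module[OF X], of "k - 1"]
    by (auto intro!: rev_image_eqI)
qed

lemma coboundaries_add:
  assumes "x \<in> coboundaries X k" "y \<in> coboundaries X k"
  shows "x \<oplus>\<^bsub>cobj X k\<^esub> y \<in> coboundaries X k"
proof -
  interpret M: left_module R "cobj X (k - 1)" by (rule is_cplx_module[OF X])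
  obtain v w where "v \<in> carrier (cobj X (k - 1))" "x = cdiff X (k - 1) v"
      "w \<in> carrier (cobj X (k - 1))" "y = cdiff X (k - 1) w"
    using assms by (auto simp: coboundaries_def)
  then show ?thesis unfolding coboundaries_def
    using lmod_hom_add[OF is_cplx_diff[OF X], of v "k - 1" w]
    by (intro image_eqI[of _ _ "v \<oplus>\<^bsub>cobj X (k - 1)\<^esub> w"]) auto
qed

lemma coboundaries_a_inv:
  assumes "x \<in> coboundaries X k"
  shows "\<ominus>\<^bsub>cobj X k\<^esub> x \<in> coboundaries X k"
proof -
  interpret M: left_module R "cobj X (k - 1)" by (rule is_cplx_module[OF X])
  obtain v where v: "v \<in> carrier (cobj X (k - 1))" "x = cdiff X (k - 1) v"
    using assms by (auto simp: coboundaries_def)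
  then show ?thesis unfolding coboundaries_def
    using lmod_hom_minus[OF is_cplx_diff[OF X] is_cplx_module[OF X] is_cplx_module[OF X] v(1)]
    by (intro image_eqI[of _ _ "\<ominus>\<^bsub>cobj X (k - 1)\<^esub> v"]) auto
qed

lemma cohomology_coset_eq_iff:
  assumes "z \<in> cocycles X k" "w \<in> cocycles X k"
  shows "coboundaries X k +>\<^bsub>cobj X k\<^esub> z = coboundaries X k +>\<^bsub>cobj X k\<^esub> w \<longleftrightarrow>
    (\<exists>b\<in>coboundaries X k. z = b \<oplus>\<^bsub>cobj X k\<^esub> w)"
  using assms coboundaries_subset cocycles_closed
  by (intro a_r_coset_eq_iff[OF is_cplx_module[OF X]] coboundaries_zero coboundaries_add
    coboundaries_a_inv) auto

end

text \<open>Removes the cosets: surjectivity on cohomology becomes hitting each cocycle up to a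
  coboundary, injectivity becomes reflecting coboundaries. All later checks use this form.\<close>

lemma quasi_isos_iff:
  assumes X: "is_cplx R X" and Y: "is_cplx R Y"
  shows "\<phi> \<in> quasi_isos R X Y \<longleftrightarrow> \<phi> \<in> chain_maps R X Y \<and>
    (\<forall>k. (\<forall>y\<in>cocycles Y k. \<exists>x\<in>cocycles X k. \<exists>b\<in>coboundaries Y k. y = b \<oplus>\<^bsub>cobj Y k\<^esub> \<phi> k x) \<and>
         (\<forall>x\<in>cocycles X k. \<phi> k x \<in> coboundaries Y k \<longrightarrow> x \<in> coboundaries X k))"
proof (cases "\<phi> \<in> chain_maps R X Y")
  case \<phi>: True
  have coc: "\<phi> k x \<in> cocycles Y k" if "x \<in> cocycles X k" for k x
    using that chain_maps_diff[OF \<phi>, of x k] lmod_hom_closed[OF chain_maps_hom[OF \<phi>], of x k]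
      lmod_hom_zero[OF chain_maps_hom[OF \<phi>] is_cplx_module[OF X] is_cplx_module[OF Y], of "k + 1"]
    by (simp add: cocycles_def)
  have cob: "\<phi> k x \<in> coboundaries Y k" if "x \<in> coboundaries X k" for k x
  proof -
    obtain v where "v \<in> carrier (cobj X (k - 1))" "x = cdiff X (k - 1) v"
      using \<open>x \<in> _\<close> by (auto simp: coboundaries_def)
    then show ?thesis
      using chain_maps_diff[OF \<phi>, of v "k - 1"] lmod_hom_closed[OF chain_maps_hom[OF \<phi>], of v "k - 1"]
      by (auto simp: coboundaries_def)
  qed
  \<comment> \<open>\<open>cohomology_map\<close> is a union over all representatives of a class.
    They all yield the same coset, so the union collapses to one coset.\<close>
  have map: "cohomology_map Y \<phi> k (coboundaries X k +>\<^bsub>cobj X k\<^esub> x) = coboundaries Y k +>\<^bsub>cobj Y k\<^esub> \<phi> k x"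
    if x: "x \<in> cocycles X k" for k x
  proof -
    interpret M: left_module R "cobj X k" by (rule is_cplx_module[OF X])
    have xc: "x \<in> carrier (cobj X k)" using x by (rule cocycles_closed[OF X])
    have "coboundaries Y k +>\<^bsub>cobj Y k\<^esub> \<phi> k z = coboundaries Y k +>\<^bsub>cobj Y k\<^esub> \<phi> k x"
      if "z \<in> coboundaries X k +>\<^bsub>cobj X k\<^esub> x" for z
    proof -
      obtain b where b: "b \<in> coboundaries X k" "z = b \<oplus>\<^bsub>cobj X k\<^esub> x"
        using \<open>z \<in> _\<close> by (auto simp: a_r_coset_def')
      then have bc: "b \<in> cocycles X k" "b \<in> carrier (cobj X k)"
        using coboundaries_subset[OF X] cocycles_closed[OF X] by auto
      have "z \<ominus>\<^bsub>cobj X k\<^esub> x = b" using b bc xc by (simp add: a_minus_def M.M.a_assoc M.M.r_neg)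
      have "\<ominus>\<^bsub>cobj X k\<^esub> x \<in> cocycles X k"
        using cocycles_minus[OF X _ x, of "\<zero>\<^bsub>cobj X k\<^esub>"] coboundaries_zero[OF X] coboundaries_subset[OF X] xc
        by (auto simp: a_minus_def)
      then have "z \<in> cocycles X k"
        using cocycles_minus[OF X bc(1), of "\<ominus>\<^bsub>cobj X k\<^esub> x"] b(2) xc by (simp add: a_minus_def)
      moreover have "\<phi> k z = \<phi> k b \<oplus>\<^bsub>cobj Y k\<^esub> \<phi> k x"
        using b bc xc by (simp add: lmod_hom_add[OF chain_maps_hom[OF \<phi>]])
      ultimately show ?thesis
        using cohomology_coset_eq_iff[OF Y coc coc[OF x], of z] cob[OF b(1)] by blast
    qed
    moreover have "x \<in> coboundaries X k +>\<^bsub>cobj X k\<^esub> x"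
      using coboundaries_zero[OF X, of k] xc unfolding a_r_coset_def'
      by (metis (mono_tags, lifting) M.M.l_zero UN_I singletonI)
    ultimately show ?thesis unfolding cohomology_map_def by blast
  qed
  \<comment> \<open>By additivity injectivity only has to be tested against the zero class: equal
    images of x and x' mean that x - x' is sent to a coboundary.\<close>
  have inj: "inj_on (cohomology_map Y \<phi> k) (cohomology X k) \<longleftrightarrow>
      (\<forall>x\<in>cocycles X k. \<phi> k x \<in> coboundaries Y k \<longrightarrow> x \<in> coboundaries X k)" for k
  proof -
    interpret M: left_module R "cobj X k" by (rule is_cplx_module[OF X])
    interpret N: left_module R "cobj Y k" by (rule is_cplx_module[OF Y])
    have z: "\<zero>\<^bsub>cobj X k\<^esub> \<in> cocycles X k" using coboundaries_zero[OF X] coboundaries_subset[OF X] by blast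
    have \<phi>0: "\<phi> k \<zero>\<^bsub>cobj X k\<^esub> = \<zero>\<^bsub>cobj Y k\<^esub>"
      by (rule lmod_hom_zero[OF chain_maps_hom[OF \<phi>] is_cplx_module[OF X] is_cplx_module[OF Y]])
    show ?thesis
    proof (intro iffI ballI impI)
      fix x assume i: "inj_on (cohomology_map Y \<phi> k) (cohomology X k)"
        and x: "x \<in> cocycles X k" and b: "\<phi> k x \<in> coboundaries Y k"
      have "\<phi> k x \<in> carrier (cobj Y k)" "x \<in> carrier (cobj X k)"
        using coc[OF x] x by (auto simp: cocycles_def)
      then have "coboundaries Y k +>\<^bsub>cobj Y k\<^esub> \<phi> k x = coboundaries Y k +>\<^bsub>cobj Y k\<^esub> \<phi> k \<zero>\<^bsub>cobj X k\<^esub>"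
        unfolding cohomology_coset_eq_iff[OF Y coc[OF x] coc[OF z]] unfolding \<phi>0 using b
        by (intro bexI[of _ "\<phi> k x"]) auto
      then have "coboundaries X k +>\<^bsub>cobj X k\<^esub> x = coboundaries X k +>\<^bsub>cobj X k\<^esub> \<zero>\<^bsub>cobj X k\<^esub>"
        using inj_onD[OF i] x z by (simp add: map cohomology_def)
      then obtain c where "c \<in> coboundaries X k" "x = c \<oplus>\<^bsub>cobj X k\<^esub> \<zero>\<^bsub>cobj X k\<^esub>"
        using cohomology_coset_eq_iff[OF X x z] by auto
      then show "x \<in> coboundaries X k"
        using coboundaries_subset[OF X] cocycles_closed[OF X] by fastforce
    next
      assume i: "\<forall>x\<in>cocycles X k. \<phi> k x \<in> coboundaries Y k \<longrightarrow> x \<in> coboundaries X k"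
      show "inj_on (cohomology_map Y \<phi> k) (cohomology X k)"
      proof (rule inj_onI)
        fix c c' assume "c \<in> cohomology X k" "c' \<in> cohomology X k"
          and eq: "cohomology_map Y \<phi> k c = cohomology_map Y \<phi> k c'"
        then obtain x x' where x: "x \<in> cocycles X k" "x' \<in> cocycles X k"
          and c: "c = coboundaries X k +>\<^bsub>cobj X k\<^esub> x" "c' = coboundaries X k +>\<^bsub>cobj X k\<^esub> x'"
          by (auto simp: cohomology_def)
        have xc: "x \<in> carrier (cobj X k)" "x' \<in> carrier (cobj X k)" using x by (auto simp: cocycles_def)
        obtain b where b: "b \<in> coboundaries Y k" "\<phi> k x = b \<oplus>\<^bsub>cobj Y k\<^esub> \<phi> k x'"
          using eq x cohomology_coset_eq_iff[OF Y coc[OF x(1)] coc[OF x(2)]] unfolding c by (auto simp: map)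
        then have bc: "b \<in> carrier (cobj Y k)"
          using coboundaries_subset[OF Y] cocycles_closed[OF Y] by blast
        have \<phi>c: "\<phi> k x' \<in> carrier (cobj Y k)" using coc[OF x(2)] by (rule cocycles_closed[OF Y])
        have "\<phi> k (x \<ominus>\<^bsub>cobj X k\<^esub> x') = \<phi> k x \<oplus>\<^bsub>cobj Y k\<^esub> (\<ominus>\<^bsub>cobj Y k\<^esub> \<phi> k x')"
          using xc lmod_hom_minus[OF chain_maps_hom[OF \<phi>] is_cplx_module[OF X] is_cplx_module[OF Y], of x']
          by (simp add: a_minus_def lmod_hom_add[OF chain_maps_hom[OF \<phi>]])
        also have "\<dots> = b" using b(2) bc \<phi>c by (simp add: N.M.a_assoc N.M.r_neg)
        finally have "x \<ominus>\<^bsub>cobj X k\<^esub> x' \<in> coboundaries X k"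
          using i cocycles_minus[OF X x] b(1) by simp
        moreover have "x = (x \<ominus>\<^bsub>cobj X k\<^esub> x') \<oplus>\<^bsub>cobj X k\<^esub> x'"
          using xc by (simp add: a_minus_def M.M.a_assoc M.M.l_neg)
        ultimately show "c = c'" unfolding c using cohomology_coset_eq_iff[OF X x] by blast
      qed
    qed
  qed
  have sur: "cohomology_map Y \<phi> k ` cohomology X k = cohomology Y k \<longleftrightarrow>
      (\<forall>y\<in>cocycles Y k. \<exists>x\<in>cocycles X k. \<exists>b\<in>coboundaries Y k. y = b \<oplus>\<^bsub>cobj Y k\<^esub> \<phi> k x)" for k
  proof -
    have "cohomology_map Y \<phi> k ` cohomology X k = (\<lambda>x. coboundaries Y k +>\<^bsub>cobj Y k\<^esub> \<phi> k x) ` cocycles X k"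
      unfolding cohomology_def image_image using map by (intro image_cong) auto
    moreover have "\<dots> \<subseteq> cohomology Y k" using coc by (auto simp: cohomology_def)
    moreover have "cohomology Y k \<subseteq> (\<lambda>x. coboundaries Y k +>\<^bsub>cobj Y k\<^esub> \<phi> k x) ` cocycles X k \<longleftrightarrow>
      (\<forall>y\<in>cocycles Y k. \<exists>x\<in>cocycles X k.
        coboundaries Y k +>\<^bsub>cobj Y k\<^esub> y = coboundaries Y k +>\<^bsub>cobj Y k\<^esub> \<phi> k x)"
      unfolding cohomology_def by (auto simp: image_subset_iff image_iff)
    moreover have "(\<forall>y\<in>cocycles Y k. \<exists>x\<in>cocycles X k.
        coboundaries Y k +>\<^bsub>cobj Y k\<^esub> y = coboundaries Y k +>\<^bsub>cobj Y k\<^esub> \<phi> k x) \<longleftrightarrow>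
        (\<forall>y\<in>cocycles Y k. \<exists>x\<in>cocycles X k. \<exists>b\<in>coboundaries Y k. y = b \<oplus>\<^bsub>cobj Y k\<^esub> \<phi> k x)"
      by (intro ball_cong bex_cong refl cohomology_coset_eq_iff[OF Y _ coc])
    ultimately show ?thesis by auto
  qed
  show ?thesis using \<phi> by (auto simp: quasi_isos_def bij_betw_def inj sur)
qed (simp add: quasi_isos_def)

text \<open>Injectivity one degree higher turns preimages of cocycles into cocycles; surjectivity
  one degree lower does the same for coboundaries.\<close>

lemma quasi_isos_bij:
  assumes X: "is_cplx R X" and Y: "is_cplx R Y" and \<phi>: "\<phi> \<in> chain_maps R X Y"
    and bij: "\<And>k. inj_on (\<phi> k) (carrier (cobj X k))" "\<And>k. carrier (cobj Y k) \<subseteq> \<phi> k ` carrier (cobj X k)"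
  shows "\<phi> \<in> quasi_isos R X Y"
  unfolding quasi_isos_iff[OF X Y]
proof (intro conjI allI ballI impI)
  fix k y assume y: "y \<in> cocycles Y k"
  interpret M: left_module R "cobj X (k + 1)" by (rule is_cplx_module[OF X])
  interpret N: left_module R "cobj Y k" by (rule is_cplx_module[OF Y])
  obtain x where x: "x \<in> carrier (cobj X k)" "y = \<phi> k x" using y bij(2) by (auto simp: cocycles_def)
  have "\<phi> (k + 1) (cdiff X k x) = \<phi> (k + 1) \<zero>\<^bsub>cobj X (k + 1)\<^esub>"
    using y x chain_maps_diff[OF \<phi> x(1)]
      lmod_hom_zero[OF chain_maps_hom[OF \<phi>] is_cplx_module[OF X] is_cplx_module[OF Y]]
    by (simp add: cocycles_def)
  then have "cdiff X k x = \<zero>\<^bsub>cobj X (k + 1)\<^esub>"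
    using inj_onD[OF bij(1)] lmod_hom_closed[OF is_cplx_diff[OF X] x(1)] by simp
  then have "x \<in> cocycles X k" using x by (simp add: cocycles_def)
  then show "\<exists>x\<in>cocycles X k. \<exists>b\<in>coboundaries Y k. y = b \<oplus>\<^bsub>cobj Y k\<^esub> \<phi> k x"
    using coboundaries_zero[OF Y, of k] x cocycles_closed[OF Y y]
    by (intro bexI[of _ x] bexI[of _ "\<zero>\<^bsub>cobj Y k\<^esub>"]) auto
next
  fix k x assume x: "x \<in> cocycles X k" and "\<phi> k x \<in> coboundaries Y k"
  then obtain w where "w \<in> carrier (cobj Y (k - 1))" "\<phi> k x = cdiff Y (k - 1) w"
    by (auto simp: coboundaries_def)
  moreover obtain v where v: "v \<in> carrier (cobj X (k - 1))" "w = \<phi> (k - 1) v"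
    using calculation(1) bij(2)[of "k - 1"] by auto
  ultimately have "\<phi> k x = \<phi> k (cdiff X (k - 1) v)"
    using chain_maps_diff[OF \<phi> v(1)] by simp
  then have "x = cdiff X (k - 1) v"
    using inj_onD[OF bij(1), of k] cocycles_closed[OF X x] lmod_hom_closed[OF is_cplx_diff[OF X] v(1)] by simp
  then show "x \<in> coboundaries X k" using v by (auto simp: coboundaries_def)
qed (rule \<phi>)

lemma quasi_isos_id: "is_cplx R X \<Longrightarrow> chain_id \<in> quasi_isos R X X"
  by (rule quasi_isos_bij) (use chain_id_chain_map in \<open>auto simp: chain_id_def\<close>)

lemma Db_isoI: "X \<in> Db_objects R \<Longrightarrow> \<phi> \<in> quasi_isos R X Y \<Longrightarrow> Db_iso R X Y"
  unfolding Db_iso_def using quasi_isos_id[of R X] Db_objectsD(1)[of X R] by blast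


section \<open>Vanishing of morphisms into shifts\<close>

text \<open>Since the terms of \<open>T\<close> are projective, the identity of \<open>T\<close> lifts through quasi-isomorphisms, so
  that roofs with source \<open>T\<close> reduce to chain maps.\<close>

locale two_term_cplx =
  fixes R :: "'r ring" and T :: "('r, nat \<Rightarrow> 'r) cplx" and E E' :: "'r set"
  assumes cplx: "is_cplx R T"
    and basis0: "has_basis R E (cobj T 0)" and basis1: "has_basis R E' (cobj T 1)"
    and trivial: "k \<noteq> 0 \<Longrightarrow> k \<noteq> 1 \<Longrightarrow> carrier (cobj T k) = {\<zero>\<^bsub>cobj T k\<^esub>}"
begin

lemma mod: "left_module R (cobj T k)" by (rule is_cplx_module[OF cplx])

lemma ab: "abelian_group (cobj T k)" using mod by (simp add: left_module_def)

text \<open>In every degree but 0 the source or the target is zero: the source for k = -1, the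
  target for k = 1.\<close>

lemma diff_zero: "k \<noteq> 0 \<Longrightarrow> x \<in> carrier (cobj T k) \<Longrightarrow> cdiff T k x = \<zero>\<^bsub>cobj T (k + 1)\<^esub>"
  using lmod_hom_closed[OF is_cplx_diff[OF cplx], of x k] trivial[of "k + 1"] trivial[of k]
    lmod_hom_zero[OF is_cplx_diff[OF cplx] mod mod, of k]
  by (cases "k = - 1") auto

lemma Db_object: "T \<in> Db_objects R"
proof -
  have "fg_module R (cobj T k)" for k
    using basis0 basis1 has_basis_zero[OF _ mod trivial, of k] has_basis_fg mod[of k]
    by (cases "k = 0"; cases "k = 1") (auto simp: left_module_def)
  moreover have "bounded_cplx T" unfolding bounded_cplx_def
    by (rule exI[of _ 1]) (use trivial in auto)
  ultimately show ?thesis using cplx by (simp add: Db_objects_def)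
qed

text \<open>The map u is built from degree 1 downwards together with a map h from T^1 to T^0 such
  that id = s u + d h in degree 1 and id = s u + h d in degree 0. So h is a homotopy from s u to the
  identity, and the conclusion keeps only its effect on cohomology.\<close>

lemma lift_quasi_iso:
  assumes Z: "is_cplx R Z" and s: "s \<in> quasi_isos R Z T"
  shows "\<exists>u\<in>chain_maps R T Z. s \<circ>\<^sub>c u \<in> quasi_isos R T T"
proof -
  have sc: "s \<in> chain_maps R Z T"
    and sur: "\<And>k y. y \<in> cocycles T k \<Longrightarrow> \<exists>x\<in>cocycles Z k. \<exists>b\<in>coboundaries T k. y = b \<oplus>\<^bsub>cobj T k\<^esub> s k x"
    and inj: "\<And>k x. x \<in> cocycles Z k \<Longrightarrow> s k x \<in> coboundaries T k \<Longrightarrow> x \<in> coboundaries Z k"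
    using s by (auto simp: quasi_isos_iff[OF Z cplx])
  note sh = chain_maps_hom[OF sc] and dT = is_cplx_diff[OF cplx] and dZ = is_cplx_diff[OF Z]
  note Zm = is_cplx_module[OF Z]
  have dT0: "cdiff T 0 \<in> lmod_hom R (cobj T 0) (cobj T 1)" using dT[of 0] by simp
  have dZ0: "cdiff Z 0 \<in> lmod_hom R (cobj Z 0) (cobj Z 1)" using dZ[of 0] by simp
  have dZ1: "cdiff Z 1 \<in> lmod_hom R (cobj Z 1) (cobj Z 2)" using dZ[of 1] by simp
  interpret T0: left_module R "cobj T 0" by (rule mod)
  interpret T1: left_module R "cobj T 1" by (rule mod)
  interpret Z0: left_module R "cobj Z 0" by (rule Zm)
  interpret Z1: left_module R "cobj Z 1" by (rule Zm)
  interpret Z2: left_module R "cobj Z 2" by (rule Zm)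
  \<comment> \<open>Since T^2 = 0, every y in T^1 is a cocycle and so equals s z + d w with z a
    cocycle of Z. The relation in (y, z, w) is linear, hence z and w can be chosen linearly at the
    same time.\<close>
  have "\<exists>u\<in>lmod_hom R (cobj T 1) (cobj Z 1). \<exists>h\<in>lmod_hom R (cobj T 1) (cobj T 0).
      \<forall>y\<in>carrier (cobj T 1). cdiff Z 1 (u y) = \<zero>\<^bsub>cobj Z 2\<^esub> \<and> y = s 1 (u y) \<oplus>\<^bsub>cobj T 1\<^esub> cdiff T 0 (h y)"
  proof (rule has_basis_select[OF basis1 Zm mod])
    fix y assume y: "y \<in> carrier (cobj T 1)"
    then have "y \<in> cocycles T 1" using diff_zero[of 1 y] by (simp add: cocycles_def)
    from sur[OF this] obtain z w where "z \<in> cocycles Z 1" "w \<in> carrier (cobj T 0)"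
        "y = cdiff T 0 w \<oplus>\<^bsub>cobj T 1\<^esub> s 1 z"
      by (auto simp: coboundaries_def)
    then show "\<exists>z\<in>carrier (cobj Z 1). \<exists>w\<in>carrier (cobj T 0).
        cdiff Z 1 z = \<zero>\<^bsub>cobj Z 2\<^esub> \<and> y = s 1 z \<oplus>\<^bsub>cobj T 1\<^esub> cdiff T 0 w"
      using lmod_hom_closed[OF sh] lmod_hom_closed[OF dT0]
      by (intro bexI[of _ z] bexI[of _ w]) (auto simp: cocycles_def intro: T1.M.a_comm)
  qed (auto simp: lmod_hom_add[OF sh] lmod_hom_add[OF dT0] lmod_hom_add[OF dZ1] lmod_hom_smult[OF sh]
      lmod_hom_smult[OF dT0] lmod_hom_smult[OF dZ1] lmod_hom_closed[OF sh] lmod_hom_closed[OF dT0]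
      T1.smult_r_distr T1.M.a_ac)
  then obtain u1 h where u1: "u1 \<in> lmod_hom R (cobj T 1) (cobj Z 1)"
    and h: "h \<in> lmod_hom R (cobj T 1) (cobj T 0)"
    and du1: "\<And>y. y \<in> carrier (cobj T 1) \<Longrightarrow> cdiff Z 1 (u1 y) = \<zero>\<^bsub>cobj Z 2\<^esub>"
    and su1: "\<And>y. y \<in> carrier (cobj T 1) \<Longrightarrow> y = s 1 (u1 y) \<oplus>\<^bsub>cobj T 1\<^esub> cdiff T 0 (h y)"
    by blast
  note cl = lmod_hom_closed[OF sh] lmod_hom_closed[OF dT0] lmod_hom_closed[OF dZ0] lmod_hom_closed[OF u1]
    lmod_hom_closed[OF h]
  \<comment> \<open>In degree 0 two conditions are met together: compatibility with the u already
    chosen in degree 1, and x = s(u x) + h(d x). With a = u(d x) and c = h(d x) the choice of h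
    gives s a = d(x - c), so a is a coboundary d z because s reflects coboundaries.\<close>
  have "\<exists>u\<in>lmod_hom R (cobj T 0) (cobj Z 0). \<forall>x\<in>carrier (cobj T 0).
      cdiff Z 0 (u x) = u1 (cdiff T 0 x) \<and> x = s 0 (u x) \<oplus>\<^bsub>cobj T 0\<^esub> h (cdiff T 0 x)"
  proof (rule has_basis_select1[OF basis0 Zm])
    fix x assume x: "x \<in> carrier (cobj T 0)"
    define a where "a = u1 (cdiff T 0 x)"
    define c where "c = h (cdiff T 0 x)"
    have c: "c \<in> carrier (cobj T 0)" and a: "a \<in> carrier (cobj Z 1)" using x cl by (auto simp: c_def a_def)
    have "cdiff T 0 x = s 1 a \<oplus>\<^bsub>cobj T 1\<^esub> cdiff T 0 c"
      unfolding a_def c_def by (rule su1) (use x cl in auto)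
    moreover have "cdiff T 0 (\<ominus>\<^bsub>cobj T 0\<^esub> c) = \<ominus>\<^bsub>cobj T 1\<^esub> cdiff T 0 c"
      by (rule lmod_hom_minus[OF dT0 mod mod c])
    ultimately have sa: "s 1 a = cdiff T 0 (x \<ominus>\<^bsub>cobj T 0\<^esub> c)"
      using x c a cl by (simp add: a_minus_def lmod_hom_add[OF dT0] T1.M.a_assoc T1.M.r_neg)
    have "a \<in> cocycles Z 1" using du1 x cl a by (simp add: cocycles_def a_def)
    moreover have "s 1 a \<in> coboundaries T 1" using sa x c by (auto simp: coboundaries_def)
    ultimately have "a \<in> coboundaries Z 1" by (rule inj)
    then obtain z where z: "z \<in> carrier (cobj Z 0)" "a = cdiff Z 0 z" by (auto simp: coboundaries_def)
    \<comment> \<open>The error of z as a preimage of x - c. It is a cocycle, and T^0 has only zero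
      as a coboundary because T^(-1) = 0, so it equals s x' for a cocycle x'. Then z - x' has the
      same differential as z and no error.\<close>
    define b where "b = s 0 z \<ominus>\<^bsub>cobj T 0\<^esub> (x \<ominus>\<^bsub>cobj T 0\<^esub> c)"
    have b: "b \<in> carrier (cobj T 0)" using z x c cl by (simp add: b_def)
    have "cdiff T 0 b = cdiff T 0 (s 0 z) \<ominus>\<^bsub>cobj T 1\<^esub> cdiff T 0 (x \<ominus>\<^bsub>cobj T 0\<^esub> c)"
      using z x c cl lmod_hom_minus[OF dT0 mod mod, of "x \<ominus>\<^bsub>cobj T 0\<^esub> c"]
      unfolding b_def a_minus_def[of _ "s 0 z"] a_minus_def[of _ "cdiff T 0 (s 0 z)"]
      by (simp add: lmod_hom_add[OF dT0])
    also have "\<dots> = \<zero>\<^bsub>cobj T 1\<^esub>"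
      using chain_maps_diff[OF sc z(1)] sa z cl x c by (simp add: a_minus_def T1.M.r_neg)
    finally have "b \<in> cocycles T 0" using b by (simp add: cocycles_def)
    from sur[OF this] obtain x' w where x': "x' \<in> cocycles Z 0" and w: "w \<in> carrier (cobj T (-1))"
        and bw: "b = cdiff T (-1) w \<oplus>\<^bsub>cobj T 0\<^esub> s 0 x'"
      by (auto simp: coboundaries_def)
    have x'c: "x' \<in> carrier (cobj Z 0)" "cdiff Z 0 x' = \<zero>\<^bsub>cobj Z 1\<^esub>" using x' by (auto simp: cocycles_def)
    have bs: "b = s 0 x'" using bw diff_zero[OF _ w] x'c cl by simp
    let ?z = "z \<ominus>\<^bsub>cobj Z 0\<^esub> x'"
    have dz: "cdiff Z 0 ?z = a"
      using z x'c lmod_hom_minus[OF dZ0 Zm Zm x'c(1)] a by (simp add: a_minus_def lmod_hom_add[OF dZ0])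
    have "s 0 ?z = s 0 z \<ominus>\<^bsub>cobj T 0\<^esub> b"
      using z x'c lmod_hom_minus[OF sh Zm mod x'c(1)] bs by (simp add: a_minus_def lmod_hom_add[OF sh])
    also have "\<dots> = x \<ominus>\<^bsub>cobj T 0\<^esub> c"
      using z x c cl unfolding b_def
      by (simp add: a_minus_def T0.M.minus_add T0.M.a_assoc[symmetric] T0.M.r_neg)
    finally have "x = s 0 ?z \<oplus>\<^bsub>cobj T 0\<^esub> c"
      using x c by (simp add: a_minus_def T0.M.a_assoc T0.M.l_neg)
    then show "\<exists>u\<in>carrier (cobj Z 0). cdiff Z 0 u = u1 (cdiff T 0 x) \<and> x = s 0 u \<oplus>\<^bsub>cobj T 0\<^esub> h (cdiff T 0 x)"
      using dz z x'c unfolding a_def c_def by (intro bexI[of _ ?z]) auto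
  next
    fix a x m
    assume "cdiff Z 0 m = u1 (cdiff T 0 x) \<and> x = s 0 m \<oplus>\<^bsub>cobj T 0\<^esub> h (cdiff T 0 x)"
      and a: "a \<in> carrier R" and xm: "x \<in> carrier (cobj T 0)" "m \<in> carrier (cobj Z 0)"
    then have "cdiff Z 0 m = u1 (cdiff T 0 x)"
      and "a \<odot>\<^bsub>cobj T 0\<^esub> (s 0 m \<oplus>\<^bsub>cobj T 0\<^esub> h (cdiff T 0 x)) = a \<odot>\<^bsub>cobj T 0\<^esub> x" by auto
    then show "cdiff Z 0 (a \<odot>\<^bsub>cobj Z 0\<^esub> m) = u1 (cdiff T 0 (a \<odot>\<^bsub>cobj T 0\<^esub> x)) \<and>
        a \<odot>\<^bsub>cobj T 0\<^esub> x = s 0 (a \<odot>\<^bsub>cobj Z 0\<^esub> m) \<oplus>\<^bsub>cobj T 0\<^esub> h (cdiff T 0 (a \<odot>\<^bsub>cobj T 0\<^esub> x))"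
      using a xm by (simp add: cl lmod_hom_smult[OF sh] lmod_hom_smult[OF dT0] lmod_hom_smult[OF dZ0]
        lmod_hom_smult[OF u1] lmod_hom_smult[OF h] T0.smult_r_distr)
  qed (auto simp: lmod_hom_add[OF sh] lmod_hom_add[OF dT0] lmod_hom_add[OF dZ0] cl T0.M.a_ac
      lmod_hom_add[OF u1] lmod_hom_add[OF h])
  then obtain u0 where u0: "u0 \<in> lmod_hom R (cobj T 0) (cobj Z 0)"
    and du0: "\<And>x. x \<in> carrier (cobj T 0) \<Longrightarrow> cdiff Z 0 (u0 x) = u1 (cdiff T 0 x)"
    and su0: "\<And>x. x \<in> carrier (cobj T 0) \<Longrightarrow> x = s 0 (u0 x) \<oplus>\<^bsub>cobj T 0\<^esub> h (cdiff T 0 x)"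
    by blast
  define u where "u = (\<lambda>k. if k = 0 then u0 else if k = 1 then u1 else (\<lambda>_. \<zero>\<^bsub>cobj Z k\<^esub>))"
  have uh: "u k \<in> lmod_hom R (cobj T k) (cobj Z k)" for k
    using u0 u1 lmod_hom_null[OF Zm] by (auto simp: u_def)
  have u: "u \<in> chain_maps R T Z" unfolding chain_maps_def
  proof (intro CollectI allI conjI ballI uh)
    fix k x assume x: "x \<in> carrier (cobj T k)"
    show "u (k + 1) (cdiff T k x) = cdiff Z k (u k x)"
    proof (cases "k = 0")
      case True then show ?thesis using du0 x by (simp add: u_def)
    next
      case False
      have "u (k + 1) (cdiff T k x) = \<zero>\<^bsub>cobj Z (k + 1)\<^esub>"
        using lmod_hom_zero[OF uh mod Zm] diff_zero[OF False x] by simp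
      moreover have "cdiff Z k (u k x) = \<zero>\<^bsub>cobj Z (k + 1)\<^esub>"
      proof (cases "k = 1")
        case True then show ?thesis using du1 x by (simp add: u_def)
      next
        case False
        then have "x = \<zero>\<^bsub>cobj T k\<^esub>" using trivial \<open>k \<noteq> 0\<close> x by blast
        then show ?thesis using lmod_hom_zero[OF uh mod Zm] lmod_hom_zero[OF dZ Zm Zm] by simp
      qed
      ultimately show ?thesis by simp
    qed
  qed
  have su: "s \<circ>\<^sub>c u \<in> chain_maps R T T" by (rule chain_comp_chain_map[OF u sc])
  note suh = chain_maps_hom[OF su]
  \<comment> \<open>The correction h(d x) vanishes on cocycles of degree 0, d(h y) is a coboundary
    in degree 1, and the other terms are zero. Hence s u induces the identity on cohomology.\<close>
  have su0': "(s \<circ>\<^sub>c u) 0 x = x" if "x \<in> cocycles T 0" for x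
  proof -
    have "x \<in> carrier (cobj T 0)" "cdiff T 0 x = \<zero>\<^bsub>cobj T 1\<^esub>" using that by (auto simp: cocycles_def)
    then show ?thesis using su0[of x] lmod_hom_zero[OF h mod mod] cl lmod_hom_closed[OF u0]
      by (simp add: chain_comp_def u_def)
  qed
  have triv': "(s \<circ>\<^sub>c u) k x = x" if "x \<in> carrier (cobj T k)" "k \<noteq> 0" "k \<noteq> 1" for k x
    using lmod_hom_closed[OF suh that(1)] trivial[OF that(2,3)] that(1) by simp
  have "s \<circ>\<^sub>c u \<in> quasi_isos R T T" unfolding quasi_isos_iff[OF cplx cplx]
  proof (intro conjI allI ballI impI su)
    fix k y assume y: "y \<in> cocycles T k"
    then have yc: "y \<in> carrier (cobj T k)" by (simp add: cocycles_def)
    interpret Tk: left_module R "cobj T k" by (rule mod)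
    have "\<exists>b\<in>coboundaries T k. y = b \<oplus>\<^bsub>cobj T k\<^esub> (s \<circ>\<^sub>c u) k y"
    proof (cases "k = 1")
      case True
      have yc: "y \<in> carrier (cobj T 1)" using yc True by simp
      then have "y = cdiff T 0 (h y) \<oplus>\<^bsub>cobj T 1\<^esub> (s \<circ>\<^sub>c u) 1 y"
        using su1[OF yc] cl T1.M.a_comm by (simp add: chain_comp_def u_def)
      moreover have "cdiff T 0 (h y) \<in> coboundaries T 1" using yc cl by (simp add: coboundaries_def)
      ultimately show ?thesis using True by blast
    next
      case False
      then have "(s \<circ>\<^sub>c u) k y = y" using su0' triv' y yc by (cases "k = 0") auto
      then show ?thesis using coboundaries_zero[OF cplx, of k] yc by (intro bexI[of _ "\<zero>\<^bsub>cobj T k\<^esub>"]) auto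
    qed
    then show "\<exists>x\<in>cocycles T k. \<exists>b\<in>coboundaries T k. y = b \<oplus>\<^bsub>cobj T k\<^esub> (s \<circ>\<^sub>c u) k x" using y by blast
  next
    fix k y assume y: "y \<in> cocycles T k" and b: "(s \<circ>\<^sub>c u) k y \<in> coboundaries T k"
    then have yc: "y \<in> carrier (cobj T k)" by (simp add: cocycles_def)
    show "y \<in> coboundaries T k"
    proof (cases "k = 1")
      case True
      have yc: "y \<in> carrier (cobj T 1)" using yc True by simp
      then have "y = (s \<circ>\<^sub>c u) 1 y \<oplus>\<^bsub>cobj T 1\<^esub> cdiff T 0 (h y)"
        using su1[OF yc] by (simp add: chain_comp_def u_def)
      moreover have "cdiff T 0 (h y) \<in> coboundaries T 1" using yc cl by (simp add: coboundaries_def)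
      ultimately show ?thesis using True b coboundaries_add[OF cplx] by metis
    next
      case False
      then have "(s \<circ>\<^sub>c u) k y = y" using su0' triv' y yc by (cases "k = 0") auto
      then show ?thesis using b by simp
    qed
  qed
  then show ?thesis using u by blast
qed

text \<open>By degrees, a chain map into T[1] is one homomorphism from T^0 to T^1, a chain map into
  T[-1] one from T^1 to T^0, and for |r| \<ge> 2 everything vanishes. \<open>H1\<close> settles r =
  1 and \<open>H2\<close> r = -1. The zero map appears composed with \<open>u'\<close> because roof
  equivalence asks for it in this shape.\<close>

lemma null_homotopic:
  assumes H1: "\<And>\<phi> x. \<phi> \<in> lmod_hom R (cobj T 0) (cobj T 1) \<Longrightarrow> x \<in> carrier (cobj T 0) \<Longrightarrow>
      \<phi> x \<in> cdiff T 0 ` carrier (cobj T 0)"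
    and H2: "\<And>\<phi> y. \<phi> \<in> lmod_hom R (cobj T 1) (cobj T 0) \<Longrightarrow>
      (\<And>x. x \<in> carrier (cobj T 0) \<Longrightarrow> \<phi> (cdiff T 0 x) = \<zero>\<^bsub>cobj T 0\<^esub>) \<Longrightarrow>
      y \<in> carrier (cobj T 1) \<Longrightarrow> \<phi> y = \<zero>\<^bsub>cobj T 0\<^esub>"
    and r: "r \<noteq> 0" and \<phi>: "\<phi> \<in> chain_maps R T (shift T r)"
  shows "homotopic R T (shift T r) \<phi> (chain_zero (shift T r) \<circ>\<^sub>c u')"
proof -
  have sh: "cobj (shift T r) k = cobj T (k + r)" for k by (simp add: shift_def)
  have \<phi>h: "\<phi> k \<in> lmod_hom R (cobj T k) (cobj T (k + r))" for k using chain_maps_hom[OF \<phi>, of k] sh by simp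
  note \<phi>cl = lmod_hom_closed[OF \<phi>h]
  have dsh: "cdiff (shift T r) k \<in> lmod_hom R (cobj T (k + r)) (cobj T (k + r + 1))" for k
    using is_cplx_diff[OF cplx, of "k + r"] lmod_hom_minusf[OF mod is_cplx_diff[OF cplx, of "k + r"]]
    by (cases "even r") (simp_all add: shift_def)
  have zc: "\<zero>\<^bsub>cobj T k\<^esub> \<in> carrier (cobj T k)" for k
    using ab by (simp add: abelian_group_def abelian_monoid.zero_closed)
  have l0: "\<zero>\<^bsub>cobj T k\<^esub> \<oplus>\<^bsub>cobj T k\<^esub> x = x" "x \<oplus>\<^bsub>cobj T k\<^esub> \<zero>\<^bsub>cobj T k\<^esub> = x" if "x \<in> carrier (cobj T k)" for k x
    using that ab by (auto simp: abelian_group_def abelian_monoid.l_zero abelian_monoid.r_zero)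
  have triv_dom: "\<phi> k x = \<zero>\<^bsub>cobj T (k + r)\<^esub>" if "x \<in> carrier (cobj T k)" "k \<noteq> 0" "k \<noteq> 1" for k x
    using lmod_hom_zero[OF \<phi>h mod mod] trivial[OF that(2,3)] that(1) by simp
  have triv_cod: "\<phi> k x = \<zero>\<^bsub>cobj T (k + r)\<^esub>" if "x \<in> carrier (cobj T k)" "k + r \<noteq> 0" "k + r \<noteq> 1" for k x
    using \<phi>cl[OF that(1)] trivial[OF that(2,3)] by simp
  show ?thesis
  proof (cases "r = 1")
    case True
    interpret T1: left_module R "cobj T 1" by (rule mod)
    have dT0: "cdiff T 0 \<in> lmod_hom R (cobj T 0) (cobj T 1)" using is_cplx_diff[OF cplx, of 0] by simp
    have \<phi>0: "\<phi> 0 \<in> lmod_hom R (cobj T 0) (cobj T 1)" using \<phi>h[of 0] True by simp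
    \<comment> \<open>A shift by an odd number negates the differential, hence the minus sign.
      \<open>H1\<close> factors each single value through d; projectivity of T^0 makes the choice
      linear.\<close>
    have "\<exists>h\<in>lmod_hom R (cobj T 0) (cobj T 0). \<forall>x\<in>carrier (cobj T 0). \<phi> 0 x = \<ominus>\<^bsub>cobj T 1\<^esub> cdiff T 0 (h x)"
    proof (rule has_basis_select1[OF basis0 mod])
      fix x assume x: "x \<in> carrier (cobj T 0)"
      obtain t where t: "t \<in> carrier (cobj T 0)" "\<phi> 0 x = cdiff T 0 t" using H1[OF \<phi>0 x] by blast
      interpret T0: left_module R "cobj T 0" by (rule mod)
      show "\<exists>m\<in>carrier (cobj T 0). \<phi> 0 x = \<ominus>\<^bsub>cobj T 1\<^esub> cdiff T 0 m"
        using t lmod_hom_minus[OF dT0 mod mod t(1)] lmod_hom_closed[OF dT0 t(1)]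
        by (intro bexI[of _ "\<ominus>\<^bsub>cobj T 0\<^esub> t"]) auto
    qed (auto simp: lmod_hom_add[OF \<phi>0] lmod_hom_smult[OF \<phi>0] lmod_hom_add[OF dT0] lmod_hom_smult[OF dT0]
        lmod_hom_closed[OF dT0] T1.smult_r_minus T1.M.minus_add)
    then obtain h0 where h0: "h0 \<in> lmod_hom R (cobj T 0) (cobj T 0)"
      and \<phi>0h: "\<And>x. x \<in> carrier (cobj T 0) \<Longrightarrow> \<phi> 0 x = \<ominus>\<^bsub>cobj T 1\<^esub> cdiff T 0 (h0 x)" by blast
    define h where "h = (\<lambda>k. if k = 0 then h0 else (\<lambda>_. \<zero>\<^bsub>cobj T k\<^esub>))"
    have hh: "h k \<in> lmod_hom R (cobj T k) (cobj T k)" for k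
      using h0 lmod_hom_null[OF mod] by (auto simp: h_def)
    have "\<phi> k x = \<zero>\<^bsub>cobj T (k + 1)\<^esub> \<oplus>\<^bsub>cobj T (k + 1)\<^esub>
        (cdiff (shift T 1) (k - 1) (h k x) \<oplus>\<^bsub>cobj T (k + 1)\<^esub> h (k + 1) (cdiff T k x))"
      if x: "x \<in> carrier (cobj T k)" for k x
    proof -
      have "h (k + 1) (cdiff T k x) = \<zero>\<^bsub>cobj T (k + 1)\<^esub>"
        using diff_zero[OF _ x] lmod_hom_zero[OF hh mod mod, of "k + 1"] by (cases "k = 0") (auto simp: h_def)
      moreover have "cdiff (shift T 1) (k - 1) (h k x) = \<phi> k x"
      proof (cases "k = 0")
        case True then show ?thesis using \<phi>0h x by (simp add: shift_def h_def)
      next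
        case False
        have "h k x = \<zero>\<^bsub>cobj T k\<^esub>" using False by (simp add: h_def)
        then have "cdiff (shift T 1) (k - 1) (h k x) = \<zero>\<^bsub>cobj T (k + 1)\<^esub>"
          using lmod_hom_zero[OF dsh mod mod, of "k - 1"] \<open>r = 1\<close> by simp
        moreover have "\<phi> k x = \<zero>\<^bsub>cobj T (k + 1)\<^esub>"
          using triv_dom[OF x False] triv_cod[OF x] False \<open>r = 1\<close> by (cases "k = 1") auto
        ultimately show ?thesis by simp
      qed
      moreover have "\<phi> k x \<in> carrier (cobj T (k + 1))" using \<phi>cl[OF x] True by simp
      ultimately show ?thesis by (simp add: l0)
    qed
    moreover have "h k \<in> lmod_hom R (cobj T k) (cobj (shift T r) (k - 1))" for k
      using hh by (simp add: shift_def True)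
    ultimately show ?thesis unfolding homotopic_def
      by (intro exI[of _ h]) (simp add: sh[unfolded True] True chain_zero_def chain_comp_def)
  next
    case False
    have zero: "\<phi> k x = \<zero>\<^bsub>cobj T (k + r)\<^esub>" if x: "x \<in> carrier (cobj T k)" for k x
    proof (cases "k = 0 \<or> k = 1 \<and> r \<noteq> - 1 \<or> k \<noteq> 0 \<and> k \<noteq> 1")
      case True then show ?thesis using triv_dom[OF x] triv_cod[OF x] r False by auto
    next
      case kr: False
      then have kr: "k = 1" "r = - 1" by auto
      have \<phi>1: "\<phi> 1 \<in> lmod_hom R (cobj T 1) (cobj T 0)" using \<phi>h[of 1] kr by simp
      \<comment> \<open>The component in degree 0 lands in T^(-1) = 0, so commuting with the
        differentials forces the component in degree 1 to kill the image of d, as \<open>H2\<close>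
        requires.\<close>
      have "\<phi> 1 (cdiff T 0 y) = \<zero>\<^bsub>cobj T 0\<^esub>" if y: "y \<in> carrier (cobj T 0)" for y
      proof -
        have "\<phi> 1 (cdiff T 0 y) = cdiff (shift T r) 0 (\<phi> 0 y)" using chain_maps_diff[OF \<phi> y] by simp
        moreover have "\<phi> 0 y = \<zero>\<^bsub>cobj T (0 + r)\<^esub>" by (rule triv_cod[OF y]) (use r False in auto)
        ultimately show ?thesis using lmod_hom_zero[OF dsh mod mod, of 0] kr by simp
      qed
      then have "\<phi> 1 x = \<zero>\<^bsub>cobj T 0\<^esub>" using H2[OF \<phi>1] x kr by simp
      then show ?thesis using kr by simp
    qed
    have "cdiff (shift T r) k \<zero>\<^bsub>cobj T (k + r)\<^esub> = \<zero>\<^bsub>cobj T (k + r + 1)\<^esub>" for k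
      by (rule lmod_hom_zero[OF dsh mod mod])
    from this[of "k - 1" for k] show ?thesis unfolding homotopic_def
      by (intro exI[of _ "\<lambda>k _. \<zero>\<^bsub>cobj T (k - 1 + r)\<^esub>"])
        (auto simp: sh chain_zero_def chain_comp_def zero l0 zc intro: lmod_hom_null[OF mod])
  qed
qed

text \<open>Both roofs are compared over T itself, by the lift u into Z and by s u into T. The left
  legs then agree on the nose, and the right leg g u is a chain map from T to T[r], hence
  null-homotopic.\<close>

lemma Db_hom_zero_shift:
  assumes "\<And>\<phi> x. \<phi> \<in> lmod_hom R (cobj T 0) (cobj T 1) \<Longrightarrow> x \<in> carrier (cobj T 0) \<Longrightarrow>
      \<phi> x \<in> cdiff T 0 ` carrier (cobj T 0)"
    and "\<And>\<phi> y. \<phi> \<in> lmod_hom R (cobj T 1) (cobj T 0) \<Longrightarrow>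
      (\<And>x. x \<in> carrier (cobj T 0) \<Longrightarrow> \<phi> (cdiff T 0 x) = \<zero>\<^bsub>cobj T 0\<^esub>) \<Longrightarrow>
      y \<in> carrier (cobj T 1) \<Longrightarrow> \<phi> y = \<zero>\<^bsub>cobj T 0\<^esub>"
    and "r \<noteq> 0"
  shows "Db_hom_zero R T (shift T r)"
  unfolding Db_hom_zero_def
proof
  fix \<rho> assume "\<rho> \<in> roofs R T (shift T r)"
  then obtain Z s g where \<rho>: "\<rho> = (Z, s, g)" and Z: "Z \<in> Db_objects R" and s: "s \<in> quasi_isos R Z T"
    and g: "g \<in> chain_maps R Z (shift T r)" by (auto simp: roofs_def)
  have Z': "is_cplx R Z" using Z by (rule Db_objectsD)
  have sc: "s \<in> chain_maps R Z T" using s by (simp add: quasi_isos_def)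
  obtain u where u: "u \<in> chain_maps R T Z" "s \<circ>\<^sub>c u \<in> quasi_isos R T T" using lift_quasi_iso[OF Z' s] by blast
  have su: "s \<circ>\<^sub>c u \<in> chain_maps R T T" by (rule chain_comp_chain_map[OF u(1) sc])
  have "homotopic R T T (s \<circ>\<^sub>c u) (chain_id \<circ>\<^sub>c (s \<circ>\<^sub>c u))"
    unfolding homotopic_def
  proof (intro exI[of _ "\<lambda>k _. \<zero>\<^bsub>cobj T (k - 1)\<^esub>"] allI conjI ballI lmod_hom_null[OF mod])
    fix k x assume x: "x \<in> carrier (cobj T k)"
    interpret Tk: left_module R "cobj T k" by (rule mod)
    have "cdiff T (k - 1) \<zero>\<^bsub>cobj T (k - 1)\<^esub> = \<zero>\<^bsub>cobj T k\<^esub>"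
      using lmod_hom_zero[OF is_cplx_diff[OF cplx] mod mod, of "k - 1"] by simp
    then show "(s \<circ>\<^sub>c u) k x = (chain_id \<circ>\<^sub>c (s \<circ>\<^sub>c u)) k x \<oplus>\<^bsub>cobj T k\<^esub>
        (cdiff T (k - 1) \<zero>\<^bsub>cobj T (k - 1)\<^esub> \<oplus>\<^bsub>cobj T k\<^esub> \<zero>\<^bsub>cobj T (k + 1 - 1)\<^esub>)"
      using lmod_hom_closed[OF chain_maps_hom[OF su] x]
      by (simp add: chain_id_def) (simp add: chain_comp_def)
  qed
  moreover have "homotopic R T (shift T r) (g \<circ>\<^sub>c u) (chain_zero (shift T r) \<circ>\<^sub>c (s \<circ>\<^sub>c u))"
    by (rule null_homotopic) (use assms chain_comp_chain_map[OF u(1) g] in auto)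
  ultimately show "roof_equiv R T (shift T r) \<rho> (T, chain_id, chain_zero (shift T r))"
    using Db_object u su unfolding \<rho> roof_equiv.simps by blast
qed

end


section \<open>Direct sums of complexes\<close>

lemma two_simps [simp]: "two x y 0 = x" "two x y (Suc 0) = y"
  by (auto simp: two_def)

lemma carrier_dsum_trivial:
  assumes "\<And>j. j \<in> A \<Longrightarrow> carrier (M j) = {\<zero>\<^bsub>M j\<^esub>}"
  shows "carrier (dsum A M) = {\<zero>\<^bsub>dsum A M\<^esub>}"
proof -
  have "x = pack A (\<lambda>j. \<zero>\<^bsub>M j\<^esub>)" if "x \<in> carrier (dsum A M)" for x
  proof -
    have "coord j x = \<zero>\<^bsub>M j\<^esub>" if "j \<in> A" for j
      using coord_closed[OF \<open>x \<in> _\<close> that] assms[OF that] by auto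
    then show ?thesis using \<open>x \<in> _\<close> unfolding carrier_dsum by (metis pack_cong)
  qed
  moreover have "pack A (\<lambda>j. \<zero>\<^bsub>M j\<^esub>) \<in> carrier (dsum A M)" using assms by (intro pack_closed) auto
  ultimately have "carrier (dsum A M) = {pack A (\<lambda>j. \<zero>\<^bsub>M j\<^esub>)}" by blast
  then show ?thesis by (simp add: dsum_def)
qed

lemma is_cplx_dsum:
  assumes R: "ring R" and X: "\<And>j. j \<in> A \<Longrightarrow> is_cplx R (X j)"
  shows "is_cplx R (dsum_cplx A X)"
  unfolding is_cplx_def
proof (intro allI conjI ballI)
  fix k
  have lm: "left_module R (cobj (X j) k)" if "j \<in> A" for j k using is_cplx_module[OF X[OF that]] .
  show "left_module R (cobj (dsum_cplx A X) k)"
    using left_module_dsum[OF R lm] by (simp add: dsum_cplx_def)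
  have "(\<lambda>x. cdiff (X j) k (coord j x)) \<in> lmod_hom R (dsum A (\<lambda>j. cobj (X j) k)) (cobj (X j) (k + 1))"
    if "j \<in> A" for j
    using lmod_hom_compose[OF coord_hom[OF that, of R "\<lambda>j. cobj (X j) k"] is_cplx_diff[OF X[OF that]]] .
  then show "cdiff (dsum_cplx A X) k \<in> lmod_hom R (cobj (dsum_cplx A X) k) (cobj (dsum_cplx A X) (k + 1))"
    using pack_hom[of A "\<lambda>j x. cdiff (X j) k (coord j x)" R _ "\<lambda>j. cobj (X j) (k + 1)"]
    by (simp add: dsum_cplx_def)
  fix x assume "x \<in> carrier (cobj (dsum_cplx A X) k)"
  then have "coord j x \<in> carrier (cobj (X j) k)" if "j \<in> A" for j
    using coord_closed[of x A _ j] that by (simp add: dsum_cplx_def)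
  then show "cdiff (dsum_cplx A X) (k + 1) (cdiff (dsum_cplx A X) k x) = \<zero>\<^bsub>cobj (dsum_cplx A X) (k + 2)\<^esub>"
    using is_cplx_dd[OF X] by (auto simp: dsum_cplx_def dsum_def intro!: pack_cong)
qed

text \<open>Zero terms satisfy the basis condition with the empty basis, so stalks, two-term
  complexes and their sums are treated alike.\<close>

definition basis_cplx :: "'r ring \<Rightarrow> 'r set \<Rightarrow> ('r, 'm) cplx \<Rightarrow> bool" where
  "basis_cplx R E X \<longleftrightarrow> is_cplx R X \<and> (\<forall>k. has_basis R E (cobj X k)) \<and>
     (\<forall>k. k \<noteq> 0 \<longrightarrow> k \<noteq> 1 \<longrightarrow> carrier (cobj X k) = {\<zero>\<^bsub>cobj X k\<^esub>})"

lemma basis_cplx_Db_object: "basis_cplx R E X \<Longrightarrow> X \<in> Db_objects R"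
  unfolding basis_cplx_def Db_objects_def bounded_cplx_def
  by (auto intro: has_basis_fg intro!: exI[of _ 1])

lemma basis_cplx_dsum:
  assumes "ring R" "finite A" "\<And>j. j \<in> A \<Longrightarrow> basis_cplx R E (X j)"
  shows "basis_cplx R E (dsum_cplx A X)"
  unfolding basis_cplx_def
proof (intro conjI allI impI)
  show "is_cplx R (dsum_cplx A X)" using assms by (intro is_cplx_dsum) (auto simp: basis_cplx_def)
  show "has_basis R E (cobj (dsum_cplx A X) k)" for k
    using has_basis_dsum[OF assms(1,2), of E "\<lambda>j. cobj (X j) k"] assms(3) by
      (simp add: dsum_cplx_def basis_cplx_def)
  show "carrier (cobj (dsum_cplx A X) k) = {\<zero>\<^bsub>cobj (dsum_cplx A X) k\<^esub>}" if "k \<noteq> 0" "k \<noteq> 1" for k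
    using carrier_dsum_trivial[of A "\<lambda>j. cobj (X j) k"] assms(3) that by
      (simp add: dsum_cplx_def basis_cplx_def)
qed

lemma is_cplx_two_term:
  assumes R: "ring R" and M: "left_module R M" and N: "left_module R N" and h: "h \<in> lmod_hom R M N"
  shows "is_cplx R (two_term M N h)"
proof -
  note Z = left_module_zero_lmod[OF R]
  \<comment> \<open>The only element of \<open>zero_lmod\<close> is \<open>undefined\<close>, so the
    constant function \<open>undefined\<close> is the zero map into it.\<close>
  have Nul: "(\<lambda>x. undefined) \<in> lmod_hom R L zero_lmod" for L :: "('a, 'b) module"
    using lmod_hom_null[OF Z, of L] by (simp add: zero_lmod_def)
  have "\<zero>\<^bsub>M\<^esub> \<in> carrier M" using M by (simp add: left_module_def abelian_group_def abelian_monoid.zero_closed)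
  then show ?thesis
    using M N h Z Nul lmod_hom_null[OF M, of zero_lmod] lmod_hom_zero[OF h M N]
    by (auto simp: is_cplx_def two_term_def zero_lmod_def)
qed

lemma stalk_eq_two_term: "stalk M = two_term M zero_lmod (\<lambda>x. undefined)"
  by (auto simp: stalk_def two_term_def fun_eq_iff)

lemma is_cplx_stalk:
  assumes R: "ring R" and M: "left_module R M"
  shows "is_cplx R (stalk M)"
  unfolding stalk_eq_two_term
  using lmod_hom_null[OF left_module_zero_lmod[OF R], of M]
  by (intro is_cplx_two_term R M left_module_zero_lmod) (simp add: zero_lmod_def)

lemma basis_cplx_two_term:
  assumes R: "ring R" and "has_basis R E M" "has_basis R E N" "h \<in> lmod_hom R M N"
  shows "basis_cplx R E (two_term M N h)"
  using assms is_cplx_two_term[OF R _ _ assms(4)] has_basis_zero[OF R left_module_zero_lmod[OF R]]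
  by (auto simp: basis_cplx_def two_term_def has_basis_def)

lemma basis_cplx_stalk: "ring R \<Longrightarrow> has_basis R E M \<Longrightarrow> basis_cplx R E (stalk M)"
  using is_cplx_stalk[of R M] has_basis_zero[of R zero_lmod E] left_module_zero_lmod[of R]
  by (auto simp: basis_cplx_def stalk_def has_basis_def)

text \<open>Splits off one summand. This serves both to exhibit a complement of \<open>X j\<close>
  and to build finite sums by induction.\<close>

lemma dsum_split_hom:
  assumes "j \<in> A"
  shows "(\<lambda>z. pack A (\<lambda>l. if l = j then coord 0 z else coord l (coord 1 z)))
    \<in> lmod_hom R (dsum2 (M j) (dsum (A - {j}) M)) (dsum A M)"
    (is "?g \<in> lmod_hom R ?D _")
    and "inj_on (\<lambda>z. pack A (\<lambda>l. if l = j then coord 0 z else coord l (coord 1 z)))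
      (carrier (dsum2 (M j) (dsum (A - {j}) M)))"
    and "carrier (dsum A M) \<subseteq> (\<lambda>z. pack A (\<lambda>l. if l = j then coord 0 z else coord l (coord 1 z))) `
      carrier (dsum2 (M j) (dsum (A - {j}) M))"
proof -
  let ?B = "A - {j}"
  have c0: "coord 0 \<in> lmod_hom R ?D (M j)" and c1: "coord 1 \<in> lmod_hom R ?D (dsum ?B M)"
    using coord_hom[of 0 "{0,1}" R "two (M j) (dsum ?B M)"] coord_hom[of 1 "{0,1}" R "two (M j) (dsum ?B M)"]
    by simp_all
  show "?g \<in> lmod_hom R ?D (dsum A M)"
  proof (rule pack_hom)
    fix l assume "l \<in> A"
    then show "(\<lambda>z. if l = j then coord 0 z else coord l (coord 1 z)) \<in> lmod_hom R ?D (M l)"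
      using c0 lmod_hom_compose[OF c1 coord_hom[of l ?B]] by (cases "l = j") auto
  qed
  show "inj_on ?g (carrier ?D)"
  proof (rule inj_onI)
    fix z w assume z: "z \<in> carrier ?D" and w: "w \<in> carrier ?D" and eq: "?g z = ?g w"
    have l: "(if l = j then coord 0 z else coord l (coord 1 z)) = (if l = j then coord 0 w else
      coord l (coord 1 w))"
      if "l \<in> A" for l
      using arg_cong[OF eq, of "coord l"] that by simp
    have "coord 1 z = coord 1 w"
      by (rule dsum_eqI[OF lmod_hom_closed[OF c1 z] lmod_hom_closed[OF c1 w]]) (use l in force)
    moreover have "coord 0 z = coord 0 w" using l[OF assms] by simp
    ultimately show "z = w" using z w by (intro dsum_eqI[of z "{0,1}"]) auto
  qed
  show "carrier (dsum A M) \<subseteq> ?g ` carrier ?D"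
  proof
    fix x assume x: "x \<in> carrier (dsum A M)"
    let ?z = "pack {0, 1} (two (coord j x) (pack ?B (\<lambda>l. coord l x)))"
    have z: "?z \<in> carrier ?D"
      by (rule pack_closed) (use x assms in \<open>auto intro!: pack_closed coord_closed\<close>)
    have "x = ?g ?z"
      by (rule dsum_eqI[OF x lmod_hom_closed[OF \<open>?g \<in> _\<close> z]]) auto
    then show "x \<in> ?g ` carrier ?D" using z by blast
  qed
qed

text \<open>The complement is the sum over the remaining indices; the splitting isomorphisms of the
  terms commute with the componentwise differentials.\<close>

lemma dsum_cplx_summand:
  fixes R :: "'r ring"
  assumes R: "ring R" and A: "finite A" and X: "\<And>j. j \<in> A \<Longrightarrow> basis_cplx R E (X j)" and j: "j \<in> A"
  shows "X j \<in> Db_summands R (dsum_cplx A X)"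
proof -
  let ?Y = "dsum_cplx (A - {j}) X"
  let ?Z = "dsum_cplx {0, 1} (two (X j) ?Y)"
  have Y: "basis_cplx R E ?Y" using A X by (intro basis_cplx_dsum[OF R]) auto
  have Z: "basis_cplx R E ?Z" using Y X[OF j] by (intro basis_cplx_dsum[OF R]) auto
  have T: "basis_cplx R E (dsum_cplx A X)" using A X by (intro basis_cplx_dsum[OF R])
  define \<phi> where "\<phi> = (\<lambda>(k::int) (z :: nat \<Rightarrow> 'r). pack A (\<lambda>l. if l = j then coord 0 z else coord l
    (coord 1 z)))"
  have two: "two (X j) ?Y l = (if l = 0 then X j else ?Y)" for l by (simp add: two_def)
  have Zk: "cobj ?Z k = dsum2 (cobj (X j) k) (dsum (A - {j}) (\<lambda>l. cobj (X l) k))" for k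
  proof -
    have "(\<lambda>l. cobj (two (X j) ?Y l) k) = two (cobj (X j) k) (cobj ?Y k)" by (auto simp: two_def)
    then show ?thesis by (simp add: dsum_cplx_def)
  qed
  have Tk: "cobj (dsum_cplx A X) k = dsum A (\<lambda>l. cobj (X l) k)" for k by (simp add: dsum_cplx_def)
  note split = dsum_split_hom(1)[OF j, of R "\<lambda>l. cobj (X l) k" for k, folded Zk Tk]
    dsum_split_hom(2,3)[OF j, of "\<lambda>l. cobj (X l) k" for k, folded Zk Tk]
  have "\<phi> (k + 1) (cdiff ?Z k z) = cdiff (dsum_cplx A X) k (\<phi> k z)" for k z
    by (auto simp: \<phi>_def dsum_cplx_def two intro!: pack_cong)
  then have "\<phi> \<in> chain_maps R ?Z (dsum_cplx A X)"
    using split(1) by (simp add: chain_maps_def \<phi>_def)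
  then have "\<phi> \<in> quasi_isos R ?Z (dsum_cplx A X)"
    using Z T split(2,3) by (intro quasi_isos_bij) (simp_all add: basis_cplx_def \<phi>_def)
  then have "Db_iso R ?Z (dsum_cplx A X)" by (rule Db_isoI[OF basis_cplx_Db_object[OF Z]])
  then show ?thesis
    using basis_cplx_Db_object[OF X[OF j]] basis_cplx_Db_object[OF Y] unfolding Db_summands_def by blast
qed


section \<open>Stalk complexes in triangulated subcategories\<close>

lemma stalk_simps:
  "cobj (stalk M) 0 = M" "k \<noteq> 0 \<Longrightarrow> cobj (stalk M) k = zero_lmod"
  "cdiff (stalk M) (- 1) x = \<zero>\<^bsub>M\<^esub>" "k \<noteq> - 1 \<Longrightarrow> cdiff (stalk M) k x = undefined"
  by (auto simp: stalk_def)

lemma stalk_Db_object: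
  assumes "ring R" "fg_module R M"
  shows "stalk M \<in> Db_objects R"
proof -
  have "fg_module R (zero_lmod :: ('a, nat \<Rightarrow> 'a) module)"
    using assms(1) by (intro has_basis_fg has_basis_zero left_module_zero_lmod) auto
  then have "fg_module R (cobj (stalk M) k)" for k
    using assms by (cases "k = 0") (simp_all add: stalk_simps)
  then show ?thesis
    using assms is_cplx_stalk[OF assms(1), of M]
    by (auto simp: Db_objects_def bounded_cplx_def fg_module_def stalk_simps intro!: exI[of _ 0])
qed

text \<open>Cones below come with zero modules of various encodings in the outer degrees; this
  identifies them with honest stalk complexes.\<close>

lemma Db_iso_stalk:
  assumes R: "ring R" and Z: "Z \<in> Db_objects R"
    and triv: "\<And>k. k \<noteq> 0 \<Longrightarrow> carrier (cobj Z k) = {\<zero>\<^bsub>cobj Z k\<^esub>}"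
    and C: "fg_module R C" and g: "g \<in> lmod_hom R (cobj Z 0) C"
    and bij: "inj_on g (carrier (cobj Z 0))" "carrier C \<subseteq> g ` carrier (cobj Z 0)"
  shows "Db_iso R Z (stalk C)"
proof -
  have Zc: "is_cplx R Z" by (rule Db_objectsD[OF Z])
  have Cm: "left_module R C" using C by (simp add: fg_module_def)
  have Cc: "is_cplx R (stalk C)" by (rule is_cplx_stalk[OF R Cm])
  define \<phi> where "\<phi> = (\<lambda>k. if k = (0::int) then g else (\<lambda>_. \<zero>\<^bsub>cobj (stalk C) k\<^esub>))"
  have hom: "\<phi> k \<in> lmod_hom R (cobj Z k) (cobj (stalk C) k)" for k
    using g by (cases "k = 0") (simp_all add: \<phi>_def stalk_simps(1) lmod_hom_null[OF is_cplx_module[OF Cc]])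
  have "\<phi> (k + 1) (cdiff Z k x) = cdiff (stalk C) k (\<phi> k x)" if x: "x \<in> carrier (cobj Z k)" for k x
  proof (cases "k = 0")
    \<comment> \<open>Both sides are the unique element \<open>undefined\<close> of the zero module
      in degree 1.\<close>
    case True
    then show ?thesis by (simp add: \<phi>_def stalk_simps zero_lmod_def)
  next
    case False
    then have "x = \<zero>\<^bsub>cobj Z k\<^esub>" using triv x by auto
    then show ?thesis
      using lmod_hom_zero[OF hom is_cplx_module[OF Zc] is_cplx_module[OF Cc]]
        lmod_hom_zero[OF is_cplx_diff[OF Zc] is_cplx_module[OF Zc] is_cplx_module[OF Zc]]
        lmod_hom_zero[OF is_cplx_diff[OF Cc] is_cplx_module[OF Cc] is_cplx_module[OF Cc]] by simp
  qed
  then have "\<phi> \<in> chain_maps R Z (stalk C)" using hom by (simp add: chain_maps_def)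
  moreover have "inj_on (\<phi> k) (carrier (cobj Z k))" for k
    using bij(1) triv by (cases "k = 0") (auto simp: \<phi>_def)
  moreover have "carrier (cobj (stalk C) k) \<subseteq> \<phi> k ` carrier (cobj Z k)" for k
    using bij(2) triv by (cases "k = 0") (auto simp: \<phi>_def stalk_simps)
  ultimately show ?thesis using quasi_isos_bij[OF Zc Cc] Db_isoI[OF Z] by blast
qed

context
  fixes R :: "'r ring" and S :: "('r, nat \<Rightarrow> 'r) cplx set"
  assumes R: "ring R" and S: "triangulated_subcat R S"
begin

lemma triangulated_Db: "X \<in> S \<Longrightarrow> X \<in> Db_objects R"
  and triangulated_iso: "X \<in> S \<Longrightarrow> Y \<in> Db_objects R \<Longrightarrow> Db_iso R X Y \<Longrightarrow> Y \<in> S"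
  and triangulated_shift: "X \<in> S \<Longrightarrow> shift X r \<in> S"
  and triangulated_cone: "X \<in> S \<Longrightarrow> Y \<in> S \<Longrightarrow> \<phi> \<in> chain_maps R X Y \<Longrightarrow> cone X Y \<phi> \<in> S"
  using S unfolding triangulated_subcat_def by blast+

lemma stalk_iso_in_triangulated:
  assumes "stalk A \<in> S" "fg_module R C" "g \<in> lmod_hom R A C"
    "inj_on g (carrier A)" "carrier C \<subseteq> g ` carrier A"
  shows "stalk C \<in> S"
  by (rule triangulated_iso[OF assms(1) stalk_Db_object[OF R assms(2)] Db_iso_stalk[OF R
    triangulated_Db[OF assms(1)]]])
    (use assms in \<open>simp_all add: stalk_simps\<close>)

text \<open>A direct sum is the cone of the zero map from A[-1] to B; in this way closure under
  cones gives closure under finite sums.\<close>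

lemma stalk_extension_in_triangulated:
  assumes A: "stalk A \<in> S" and B: "stalk B \<in> S" and C: "fg_module R C"
    and g: "g \<in> lmod_hom R (dsum2 A B) C" "inj_on g (carrier (dsum2 A B))" "carrier C \<subseteq> g ` carrier
      (dsum2 A B)"
  shows "stalk C \<in> S"
proof -
  let ?X = "shift (stalk A) (- 1)"
  let ?Z = "cone ?X (stalk B) (chain_zero (stalk B))"
  have X: "?X \<in> S" by (rule triangulated_shift[OF A])
  have Bc: "is_cplx R (stalk B)" by (rule Db_objectsD[OF triangulated_Db[OF B]])
  have "chain_zero (stalk B) \<in> chain_maps R ?X (stalk B)"
    using lmod_hom_null[OF is_cplx_module[OF Bc]]
      lmod_hom_zero[OF is_cplx_diff[OF Bc] is_cplx_module[OF Bc] is_cplx_module[OF Bc]]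
    by (simp add: chain_maps_def chain_zero_def)
  then have Z: "?Z \<in> S" by (rule triangulated_cone[OF X B])
  have Zk: "cobj ?Z k = dsum2 (cobj (stalk A) k) (cobj (stalk B) k)" for k
    by (simp add: cone_def shift_def)
  have "Db_iso R ?Z (stalk C)"
  proof (rule Db_iso_stalk[OF R triangulated_Db[OF Z] _ C])
    show "carrier (cobj ?Z k) = {\<zero>\<^bsub>cobj ?Z k\<^esub>}" if "k \<noteq> 0" for k
      unfolding Zk using that by (intro carrier_dsum_trivial) (auto simp: stalk_simps)
  qed (use g in \<open>simp_all add: Zk stalk_simps\<close>)
  then show ?thesis by (rule triangulated_iso[OF Z stalk_Db_object[OF R C]])
qed

text \<open>The zero object arises as the cone of the identity of any member of S, which exists
  since S is nonempty; this cone is acyclic.\<close>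

lemma trivial_stalk_in_triangulated:
  assumes P: "fg_module R P" and triv: "carrier P = {\<zero>\<^bsub>P\<^esub>}"
  shows "stalk P \<in> S"
proof -
  obtain X where X: "X \<in> S" using S unfolding triangulated_subcat_def by blast
  have Xc: "is_cplx R X" by (rule Db_objectsD[OF triangulated_Db[OF X]])
  let ?Z = "cone X X chain_id"
  have Z: "?Z \<in> S" by (rule triangulated_cone[OF X X chain_id_chain_map])
  have Zc: "is_cplx R ?Z" by (rule Db_objectsD[OF triangulated_Db[OF Z]])
  have Pm: "left_module R P" using P by (simp add: fg_module_def)
  have Pc: "is_cplx R (stalk P)" by (rule is_cplx_stalk[OF R Pm])
  have Pk: "carrier (cobj (stalk P) k) = {\<zero>\<^bsub>cobj (stalk P) k\<^esub>}" for k
    using triv by (cases "k = 0") (simp_all add: stalk_simps)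
  have "chain_zero (stalk P) \<in> chain_maps R ?Z (stalk P)"
    using lmod_hom_null[OF is_cplx_module[OF Pc]]
      lmod_hom_zero[OF is_cplx_diff[OF Pc] is_cplx_module[OF Pc] is_cplx_module[OF Pc]]
    by (simp add: chain_maps_def chain_zero_def)
  then have "chain_zero (stalk P) \<in> quasi_isos R ?Z (stalk P)"
    unfolding quasi_isos_iff[OF Zc Pc]
  proof (intro conjI allI ballI impI)
    fix k y assume "y \<in> cocycles (stalk P) k"
    then have "y = \<zero>\<^bsub>cobj (stalk P) k\<^esub>" using Pk by (auto simp: cocycles_def)
    moreover interpret Pk: left_module R "cobj (stalk P) k" by (rule is_cplx_module[OF Pc])
    have "\<zero>\<^bsub>cobj ?Z k\<^esub> \<in> cocycles ?Z k" using coboundaries_zero[OF Zc] coboundaries_subset[OF Zc] by blast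
    ultimately show "\<exists>x\<in>cocycles ?Z k. \<exists>b\<in>coboundaries (stalk P) k. y = b \<oplus>\<^bsub>cobj (stalk P) k\<^esub>
      chain_zero (stalk P) k x"
      using coboundaries_zero[OF Pc, of k] by (intro bexI) (auto simp: chain_zero_def)
  next
    fix k z assume z: "z \<in> cocycles ?Z k"
    interpret X0: left_module R "cobj X k" by (rule is_cplx_module[OF Xc])
    interpret X1: left_module R "cobj X (k + 1)" by (rule is_cplx_module[OF Xc])
    have zc: "z \<in> carrier (dsum2 (cobj X (k + 1)) (cobj X k))"
      and dz: "cdiff ?Z k z = \<zero>\<^bsub>cobj ?Z (k + 1)\<^esub>" using z by (auto simp: cocycles_def cone_def)
    define x y where xy: "x = coord 0 z" "y = coord 1 z"
    have x: "x \<in> carrier (cobj X (k + 1))" and y: "y \<in> carrier (cobj X k)"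
      using coord_closed[OF zc, of 0] coord_closed[OF zc, of 1] by (auto simp: xy)
    have "x \<oplus>\<^bsub>cobj X (k + 1)\<^esub> cdiff X k y = \<zero>\<^bsub>cobj X (k + 1)\<^esub>"
      using arg_cong[OF dz, of "coord 1"] unfolding xy by (simp add: cone_def chain_id_def)
    then have x': "x = \<ominus>\<^bsub>cobj X (k + 1)\<^esub> cdiff X k y"
      using x lmod_hom_closed[OF is_cplx_diff[OF Xc] y] by (simp add: X1.M.minus_equality)
    \<comment> \<open>The cone differential sends (x, y) to (-d x, x + d y), so a cocycle has x = -d
      y and is the differential of (y, 0).\<close>
    let ?w = "pack {0, 1} (two y \<zero>\<^bsub>cobj X (k - 1)\<^esub>)"
    have zc': "\<zero>\<^bsub>cobj X (k - 1)\<^esub> \<in> carrier (cobj X (k - 1))"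
      using is_cplx_module[OF Xc] by (simp add: left_module_def abelian_group_def abelian_monoid.zero_closed)
    have w: "?w \<in> carrier (cobj ?Z (k - 1))"
      using y zc' unfolding cone_def by (auto intro!: pack_closed)
    have cw: "cdiff ?Z (k - 1) ?w \<in> carrier (dsum2 (cobj X (k + 1)) (cobj X k))"
      using lmod_hom_closed[OF is_cplx_diff[OF Zc] w] by (simp add: cone_def)
    have "z = cdiff ?Z (k - 1) ?w"
    proof (rule dsum_eqI[OF zc cw])
      have "cdiff X (k - 1) \<zero>\<^bsub>cobj X (k - 1)\<^esub> = \<zero>\<^bsub>cobj X k\<^esub>"
        using lmod_hom_zero[OF is_cplx_diff[OF Xc] is_cplx_module[OF Xc] is_cplx_module[OF Xc], of
          "k - 1"] by simp
      then show "coord j z = coord j (cdiff ?Z (k - 1) ?w)" if "j \<in> {0, 1}" for j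
        using that x' y by (auto simp: cone_def chain_id_def xy(1)[symmetric] xy(2)[simplified,
          symmetric] add.commute[of 1])
    qed
    then show "z \<in> coboundaries ?Z k" using w by (auto simp: coboundaries_def)
  qed
  then show ?thesis
    by (intro triangulated_iso[OF Z stalk_Db_object[OF R P]] Db_isoI triangulated_Db[OF Z])
qed

text \<open>Induction on the index set; the empty sum is the zero object obtained from an acyclic
  cone.\<close>

lemma dsum_stalk_in_triangulated:
  assumes "finite A" "\<And>k. k \<in> A \<Longrightarrow> stalk (P k) \<in> S" "\<And>k. k \<in> A \<Longrightarrow> has_basis R E (P k)"
  shows "stalk (dsum A P) \<in> S"
  using assms
proof (induction A)
  case empty
  have "fg_module R (dsum {} P)" by (rule has_basis_fg[OF has_basis_dsum[OF R]]) auto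
  then show ?case using trivial_stalk_in_triangulated carrier_dsum_trivial[of "{}" P] by simp
next
  case (insert a A)
  have eq: "insert a A - {a} = A" using insert.hyps by auto
  have fg: "fg_module R (dsum (insert a A) P)"
    by (rule has_basis_fg[OF has_basis_dsum[OF R, of _ E]]) (use insert in simp_all)
  have IH: "stalk (dsum A P) \<in> S" by (rule insert.IH) (simp_all add: insert.prems)
  have a: "a \<in> insert a A" by simp
  show ?case
    by (rule stalk_extension_in_triangulated[OF insert.prems(1)[OF a] IH fg
      dsum_split_hom(1)[OF a, of R P, unfolded eq] dsum_split_hom(2,3)[OF a, of P, unfolded eq]])
qed

text \<open>The map from the two-term complex to P' is the identity in degree 0. Its cone has P' in
  degree -1 and the sum of P and P' in degree 0, with differential x to (-d x, x). This is injective
  with cokernel P.\<close>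

lemma cone_stalk_in_triangulated:
  assumes T: "two_term P' P d \<in> S" and P': "stalk P' \<in> S" and P: "fg_module R P" and d: "d \<in> lmod_hom R P' P"
  shows "stalk P \<in> S"
proof -
  let ?T = "two_term P' P d"
  have Tc: "is_cplx R ?T" by (rule Db_objectsD[OF triangulated_Db[OF T]])
  have P'c: "is_cplx R (stalk P')" by (rule Db_objectsD[OF triangulated_Db[OF P']])
  have Pm: "left_module R P" using P by (simp add: fg_module_def)
  have P'm: "left_module R P'" using is_cplx_module[OF P'c, of 0] by (simp add: stalk_simps)
  have Pc: "is_cplx R (stalk P)" by (rule is_cplx_stalk[OF R Pm])
  interpret P: left_module R P by (rule Pm)
  interpret P': left_module R P' by (rule P'm)
  have Tk: "cobj ?T 0 = P'" "cobj ?T 1 = P" "k \<noteq> 0 \<Longrightarrow> k \<noteq> 1 \<Longrightarrow> cobj ?T k = zero_lmod"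
    "cdiff ?T 0 = d" for k by (auto simp: two_term_def)
  define \<phi> where "\<phi> = (\<lambda>k. if k = (0::int) then (\<lambda>x. x) else (\<lambda>_. \<zero>\<^bsub>cobj (stalk P') k\<^esub>))"
  have \<phi>h: "\<phi> k \<in> lmod_hom R (cobj ?T k) (cobj (stalk P') k)" for k
    using lmod_hom_id[of R P'] Tk(1)
    by (cases "k = 0") (simp_all add: \<phi>_def stalk_simps(1) lmod_hom_null[OF is_cplx_module[OF P'c]])
  have "\<phi> (k + 1) (cdiff ?T k x) = cdiff (stalk P') k (\<phi> k x)" for k x
    by (auto simp: \<phi>_def stalk_def two_term_def zero_lmod_def)
  then have \<phi>: "\<phi> \<in> chain_maps R ?T (stalk P')" using \<phi>h by (simp add: chain_maps_def)
  let ?Z = "cone ?T (stalk P') \<phi>"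
  have Z: "?Z \<in> S" by (rule triangulated_cone[OF T P' \<phi>])
  have Zc: "is_cplx R ?Z" by (rule Db_objectsD[OF triangulated_Db[OF Z]])
  have Zk: "cobj ?Z k = dsum2 (cobj ?T (k + 1)) (cobj (stalk P') k)" for k by (simp add: cone_def)
  have Z0: "cobj ?Z 0 = dsum2 P P'" and Zm1: "cobj ?Z (- 1) = dsum2 P' zero_lmod"
    by (simp_all add: Zk Tk stalk_simps)
  have Ztriv: "carrier (cobj ?Z k) = {\<zero>\<^bsub>cobj ?Z k\<^esub>}" if "k \<noteq> 0" "k \<noteq> - 1" for k
    unfolding Zk using that by (intro carrier_dsum_trivial) (auto simp: stalk_simps Tk)
  have Zdiff: "cdiff ?Z (- 1) z = pack {0, 1} (two (\<ominus>\<^bsub>P\<^esub> d (coord 0 z)) (coord 0 z))"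
    if "z \<in> carrier (cobj ?Z (- 1))" for z
  proof -
    have "coord 0 z \<in> carrier P'" using coord_closed[of z "{0, 1}" "two P' zero_lmod" 0] that Zm1 by simp
    then show ?thesis by (simp add: cone_def Tk \<phi>_def stalk_simps)
  qed
  have c0: "coord 0 \<in> lmod_hom R (dsum2 P P') P" and c1: "coord 1 \<in> lmod_hom R (dsum2 P P') P'"
    using coord_hom[of 0 "{0,1}" R "two P P'"] coord_hom[of 1 "{0,1}" R "two P P'"] by simp_all
  note cl = lmod_hom_closed[OF c0] lmod_hom_closed[OF c1] lmod_hom_closed[OF d]
  \<comment> \<open>The cokernel map (p, x) to p + d x; it vanishes on the pairs (-d x, x) and (p,
    0) is a preimage of p.\<close>
  define \<psi> where "\<psi> = (\<lambda>k. if k = (0::int) then (\<lambda>z. coord 0 z \<oplus>\<^bsub>P\<^esub> d (coord 1 z)) else (\<lambda>_. \<zero>\<^bsub>cobj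
    (stalk P) k\<^esub>))"
  have \<psi>h: "\<psi> k \<in> lmod_hom R (cobj ?Z k) (cobj (stalk P) k)" for k
    using lmod_hom_addf[OF Pm c0 lmod_hom_compose[OF c1 d]] Z0
    by (cases "k = 0") (simp_all add: \<psi>_def stalk_simps(1) lmod_hom_null[OF is_cplx_module[OF Pc]])
  have dz: "\<psi> 0 (cdiff ?Z (- 1) z) = \<zero>\<^bsub>P\<^esub>" if z: "z \<in> carrier (cobj ?Z (- 1))" for z
  proof -
    have "coord 0 z \<in> carrier P'" using coord_closed[of z "{0, 1}" "two P' zero_lmod" 0] z Zm1 by simp
    then show ?thesis using cl by (simp add: Zdiff[OF z] \<psi>_def P.M.l_neg)
  qed
  have "\<psi> (k + 1) (cdiff ?Z k z) = cdiff (stalk P) k (\<psi> k z)" if z: "z \<in> carrier (cobj ?Z k)" for k z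
  proof (cases "k = - 1")
    case True then show ?thesis using dz z by (simp add: stalk_simps)
  next
    case False then show ?thesis by (simp add: \<psi>_def stalk_simps zero_lmod_def)
  qed
  then have \<psi>: "\<psi> \<in> chain_maps R ?Z (stalk P)" using \<psi>h by (simp add: chain_maps_def)
  have "\<psi> \<in> quasi_isos R ?Z (stalk P)" unfolding quasi_isos_iff[OF Zc Pc]
  proof (intro conjI allI ballI impI \<psi>)
    fix k y assume y: "y \<in> cocycles (stalk P) k"
    interpret Pk: left_module R "cobj (stalk P) k" by (rule is_cplx_module[OF Pc])
    have yc: "y \<in> carrier (cobj (stalk P) k)" using y by (simp add: cocycles_def)
    have "\<exists>x\<in>cocycles ?Z k. \<psi> k x = y"
    proof (cases "k = 0")
      case True
      let ?x = "pack {0, 1} (two y \<zero>\<^bsub>P'\<^esub>)"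
      have x: "?x \<in> carrier (cobj ?Z 0)" unfolding Z0
        by (rule pack_closed) (use yc True in \<open>auto simp: stalk_simps\<close>)
      have "cdiff ?Z 0 ?x = \<zero>\<^bsub>cobj ?Z 1\<^esub>"
        using lmod_hom_closed[OF is_cplx_diff[OF Zc] x] Ztriv[of 1] by simp
      moreover have "\<psi> 0 ?x = y"
        using yc True lmod_hom_zero[OF d P'm Pm] by (simp add: \<psi>_def stalk_simps)
      ultimately show ?thesis using x True by (auto simp: cocycles_def)
    next
      case False
      have "\<zero>\<^bsub>cobj ?Z k\<^esub> \<in> cocycles ?Z k" using coboundaries_zero[OF Zc] coboundaries_subset[OF Zc] by blast
      then show ?thesis using yc False by (auto simp: \<psi>_def stalk_simps)
    qed
    then show "\<exists>x\<in>cocycles ?Z k. \<exists>b\<in>coboundaries (stalk P) k. y = b \<oplus>\<^bsub>cobj (stalk P) k\<^esub> \<psi> k x"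
      using coboundaries_zero[OF Pc, of k] yc by (metis Pk.M.l_zero)
  next
    fix k z assume z: "z \<in> cocycles ?Z k" and b: "\<psi> k z \<in> coboundaries (stalk P) k"
    have zc: "z \<in> carrier (cobj ?Z k)" using z by (simp add: cocycles_def)
    consider "k = 0" | "k = - 1" | "k \<noteq> 0" "k \<noteq> - 1" by blast
    then show "z \<in> coboundaries ?Z k"
    proof cases
      case 1
      have zc: "z \<in> carrier (dsum2 P P')" using zc 1 by (simp add: Z0)
      have "coord 0 z \<oplus>\<^bsub>P\<^esub> d (coord 1 z) = \<zero>\<^bsub>P\<^esub>"
        using b 1 by (auto simp: coboundaries_def \<psi>_def stalk_simps)
      then have z0: "coord 0 z = \<ominus>\<^bsub>P\<^esub> d (coord 1 z)" using cl zc by (simp add: P.M.minus_equality)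
      let ?w = "pack {0, 1} (two (coord 1 z) \<zero>\<^bsub>zero_lmod :: ('r, nat \<Rightarrow> 'r) module\<^esub>)"
      have w: "?w \<in> carrier (cobj ?Z (- 1))" unfolding Zm1
        by (rule pack_closed) (use zc cl in \<open>auto\<close>)
      have "z = pack {0, 1} (two (\<ominus>\<^bsub>P\<^esub> d (coord 1 z)) (coord 1 z))"
        by (rule dsum_eqI[OF zc]) (use zc z0 cl in \<open>auto intro!: pack_closed\<close>)
      then have "z = cdiff ?Z (- 1) ?w" by (subst Zdiff[OF w]) simp
      then show ?thesis using w 1 by (auto simp: coboundaries_def)
    next
      case 2
      have zc: "z \<in> carrier (dsum2 P' zero_lmod)" and zc': "z \<in> carrier (cobj ?Z (- 1))" using zc 2 by
        (simp_all add: Zm1)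
      have "cdiff ?Z (- 1) z = \<zero>\<^bsub>dsum2 P P'\<^esub>" using z 2 by (simp add: cocycles_def Z0)
      \<comment> \<open>The second component of the differential is x itself, so a cocycle of degree
        -1 is zero.\<close>
      from arg_cong[OF this, of "coord 1"] have "coord 0 z = \<zero>\<^bsub>P'\<^esub>" by (simp add: Zdiff[OF zc'])
      moreover have "coord 1 z = \<zero>\<^bsub>zero_lmod :: ('r, nat \<Rightarrow> 'r) module\<^esub>" using coord_closed[OF zc, of 1] by simp
      moreover have "\<zero>\<^bsub>dsum2 P' zero_lmod\<^esub> \<in> carrier (dsum2 P' zero_lmod)"
        using coboundaries_zero[OF Zc, of "-1"] coboundaries_subset[OF Zc, of "-1"]
          unfolding Zm1 cocycles_def by auto
      ultimately have "z = \<zero>\<^bsub>dsum2 P' zero_lmod\<^esub>" by (intro dsum_eqI[OF zc]) auto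
      then show ?thesis using coboundaries_zero[OF Zc, of "- 1"] 2 by (simp add: Zm1)
    next
      case 3
      then show ?thesis using Ztriv zc coboundaries_zero[OF Zc, of k] by auto
    qed
  qed
  then show ?thesis
    by (intro triangulated_iso[OF Z stalk_Db_object[OF R P]] Db_isoI triangulated_Db[OF Z])
qed

end


section \<open>Projective modules over a ring with a complete set of local idempotents\<close>

lemma linear_form_finsum:
  assumes R: "ring R" and M: "left_module R M" and \<psi>: "\<psi> \<in> linear_forms R M"
    and "finite A" "g \<in> A \<rightarrow> carrier M"
  shows "\<psi> (finsum M g A) = finsum R (\<lambda>k. \<psi> (g k)) A"
proof -
  interpret R: ring R by fact
  interpret M: left_module R M by fact
  have cl: "\<psi> y \<in> carrier R" if "y \<in> carrier M" for y using \<psi> that by (auto simp: linear_forms_def)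
  have zero: "\<psi> \<zero>\<^bsub>M\<^esub> = \<zero>\<^bsub>R\<^esub>"
  proof -
    have "\<psi> (\<zero>\<^bsub>R\<^esub> \<odot>\<^bsub>M\<^esub> \<zero>\<^bsub>M\<^esub>) = \<zero>\<^bsub>R\<^esub> \<otimes>\<^bsub>R\<^esub> \<psi> \<zero>\<^bsub>M\<^esub>"
      using \<psi> M.M.zero_closed R.zero_closed unfolding linear_forms_def by blast
    then show ?thesis using cl[OF M.M.zero_closed] by simp
  qed
  show ?thesis using assms(4,5)
  proof (induction A)
    case (insert k A)
    then have "g k \<in> carrier M" "g \<in> A \<rightarrow> carrier M" by auto
    moreover from this have "(\<lambda>k. \<psi> (g k)) \<in> A \<rightarrow> carrier R" "\<psi> (g k) \<in> carrier R"
      using cl by auto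
    moreover have "\<psi> (g k \<oplus>\<^bsub>M\<^esub> finsum M g A) = \<psi> (g k) \<oplus>\<^bsub>R\<^esub> \<psi> (finsum M g A)"
      using \<psi> calculation M.M.finsum_closed[of g A] unfolding linear_forms_def by blast
    ultimately show ?case using insert by simp
  qed (use zero in simp)
qed

lemma submodule_finsum:
  assumes P: "left_module R P" and N: "submodule N R P" and "finite I" "g \<in> I \<rightarrow> N"
  shows "finsum P g I \<in> N"
proof -
  interpret P: left_module R P by fact
  interpret N: submodule N R P by fact
  show ?thesis using assms(3,4)
  proof (induction I)
    case empty then show ?case using N.one_closed by simp
  next
    case (insert k I)
    then have "g \<in> I \<rightarrow> carrier P" "g k \<in> carrier P" using N.subset by auto
    then show ?case using insert N.m_closed[of "g k" "finsum P g I"] by simp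
  qed
qed

lemma fg_projective_lift:
  assumes "fg_projective R P" and g: "g \<in> lmod_hom R M N" and h: "h \<in> lmod_hom R P N"
    and "fg_module R M" "fg_module R N" "g ` carrier M = carrier N"
  shows "\<exists>h'\<in>lmod_hom R P M. \<forall>x\<in>carrier P. g (h' x) = h x"
  using assms(1)[unfolded fg_projective_def, THEN conjunct2, THEN spec, of M, THEN spec, of N,
      THEN bspec, OF g, THEN bspec, OF h] assms(4-6) by simp

text \<open>\<open>J m\<close> abstracts the m-th power of the radical; nilpotency is
  \<open>J_nilpotent\<close>. The assumption \<open>local\<close> says that an element of e_v R e_w
  outside \<open>J 1\<close> forces v = w and is left invertible there, which combines local
  endomorphism rings with pairwise non-isomorphic R e_v.\<close>

locale local_idempotents = R?: ring R for R :: "'r ring" (structure) +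
  fixes V :: "nat set" and e :: "nat \<Rightarrow> 'r" and J :: "nat \<Rightarrow> 'r set" and N :: nat
  assumes V: "finite V"
    and e_closed: "v \<in> V \<Longrightarrow> e v \<in> carrier R"
    and e_idem: "v \<in> V \<Longrightarrow> e v \<otimes> e v = e v"
    and e_sum: "finsum R e V = \<one>"
    and J_0: "J 0 = carrier R"
    and J_zero: "\<zero> \<in> J m"
    and J_add: "a \<in> J m \<Longrightarrow> b \<in> J m \<Longrightarrow> a \<oplus> b \<in> J m"
    and J_mult: "a \<in> J p \<Longrightarrow> b \<in> J q \<Longrightarrow> a \<otimes> b \<in> J (p + q)"
    and J_nilpotent: "J N \<subseteq> {\<zero>}"
    and local: "v \<in> V \<Longrightarrow> w \<in> V \<Longrightarrow> a \<in> carrier R \<Longrightarrow> e v \<otimes> a = a \<Longrightarrow> a \<otimes> e w = a \<Longrightarrow>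
      a \<notin> J 1 \<Longrightarrow> v = w \<and> (\<exists>b\<in>carrier R. b \<otimes> a = e w)"
begin

abbreviation proj :: "nat \<Rightarrow> ('r, nat \<Rightarrow> 'r) module" where
  "proj v \<equiv> left_ideal_module R (e v)"

lemma proj_module: "v \<in> V \<Longrightarrow> left_module R (proj v)"
  by (rule left_module_left_ideal[OF R.ring_axioms e_closed])

lemma carrier_proj: "v \<in> V \<Longrightarrow> x \<in> carrier (proj v) \<longleftrightarrow> x = (\<lambda>_. x 0) \<and> x 0 \<in> carrier R \<and> x 0 \<otimes> e v = x 0"
  by (rule carrier_left_ideal[OF R.ring_axioms e_closed e_idem])

lemma proj_basis: "v \<in> V \<Longrightarrow> has_basis R {e v} (proj v)"
  by (rule has_basis_left_ideal[OF R.ring_axioms e_closed e_idem])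

definition span :: "('r, 'm) module \<Rightarrow> (nat \<Rightarrow> 'm) \<Rightarrow> nat set \<Rightarrow> 'm set" where
  "span P x I = {finsum P (\<lambda>k. c k \<odot>\<^bsub>P\<^esub> x k) I | c. c \<in> I \<rightarrow> carrier R}"

lemma span_submodule:
  assumes P: "left_module R P" and fin: "finite I" and x: "x \<in> I \<rightarrow> carrier P"
  shows "submodule (span P x I) R P"
proof -
  interpret P: left_module R P by fact
  have cl: "(\<lambda>k. c k \<odot>\<^bsub>P\<^esub> x k) \<in> I \<rightarrow> carrier P" if "c \<in> I \<rightarrow> carrier R" for c using that x by auto
  show ?thesis
  proof (rule submoduleI_left_module[OF P])
    show "span P x I \<subseteq> carrier P" using cl by (auto simp: span_def intro!: P.M.finsum_closed)
    have "finsum P (\<lambda>k. \<zero> \<odot>\<^bsub>P\<^esub> x k) I = \<zero>\<^bsub>P\<^esub>"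
      using x by (intro P.M.add.finprod_one_eqI) (simp add: Pi_iff)
    then show "\<zero>\<^bsub>P\<^esub> \<in> span P x I" unfolding span_def
      by (intro CollectI exI[of _ "\<lambda>_. \<zero>"]) auto
  next
    fix y z assume "y \<in> span P x I" "z \<in> span P x I"
    then obtain c d where c: "c \<in> I \<rightarrow> carrier R" "y = finsum P (\<lambda>k. c k \<odot>\<^bsub>P\<^esub> x k) I"
      and d: "d \<in> I \<rightarrow> carrier R" "z = finsum P (\<lambda>k. d k \<odot>\<^bsub>P\<^esub> x k) I" by (auto simp: span_def)
    have "y \<oplus>\<^bsub>P\<^esub> z = finsum P (\<lambda>k. c k \<odot>\<^bsub>P\<^esub> x k \<oplus>\<^bsub>P\<^esub> d k \<odot>\<^bsub>P\<^esub> x k) I"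
      unfolding c d using cl[OF c(1)] cl[OF d(1)] by (simp add: P.M.finsum_addf)
    also have "\<dots> = finsum P (\<lambda>k. (c k \<oplus> d k) \<odot>\<^bsub>P\<^esub> x k) I"
      using c d x by (intro P.M.finsum_cong') (auto simp: P.smult_l_distr Pi_iff)
    finally show "y \<oplus>\<^bsub>P\<^esub> z \<in> span P x I"
      unfolding span_def using c(1) d(1) by (intro CollectI exI[of _ "\<lambda>k. c k \<oplus> d k"]) auto
  next
    fix a y assume a: "a \<in> carrier R" and "y \<in> span P x I"
    then obtain c where c: "c \<in> I \<rightarrow> carrier R" "y = finsum P (\<lambda>k. c k \<odot>\<^bsub>P\<^esub> x k) I" by (auto simp: span_def)
    have "a \<odot>\<^bsub>P\<^esub> y = finsum P (\<lambda>k. a \<odot>\<^bsub>P\<^esub> (c k \<odot>\<^bsub>P\<^esub> x k)) I"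
      unfolding c using cl[OF c(1)] a fin by (simp add: P.finsum_smult)
    also have "\<dots> = finsum P (\<lambda>k. (a \<otimes> c k) \<odot>\<^bsub>P\<^esub> x k) I"
      using c x a by (intro P.M.finsum_cong') (auto simp: P.smult_assoc Pi_iff)
    finally show "a \<odot>\<^bsub>P\<^esub> y \<in> span P x I"
      unfolding span_def using c(1) a by (intro CollectI exI[of _ "\<lambda>k. a \<otimes> c k"]) auto
  qed
qed

lemma span_generator:
  assumes P: "left_module R P" and fin: "finite I" and x: "x \<in> I \<rightarrow> carrier P" and k: "k \<in> I"
  shows "x k \<in> span P x I"
proof -
  interpret P: left_module R P by fact
  have "finsum P (\<lambda>l. (if l = k then \<one> else \<zero>) \<odot>\<^bsub>P\<^esub> x l) I = finsum P (\<lambda>l. if k = l then x l else \<zero>\<^bsub>P\<^esub>) I"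
    using x k by (intro P.M.finsum_cong') (auto simp: Pi_iff)
  also have "\<dots> = x k" using x k fin by (intro P.M.add.finprod_singleton) auto
  finally have "x k = finsum P (\<lambda>l. (if l = k then \<one> else \<zero>) \<odot>\<^bsub>P\<^esub> x l) I" ..
  then show ?thesis
    unfolding span_def by (intro CollectI exI[of _ "\<lambda>l. if l = k then \<one> else \<zero>"]) auto
qed

text \<open>Each generator is fixed by one of the idempotents, so that sending e_(j k) to x_k
  defines a map from R e_(j k) to P.\<close>

definition generates :: "('r, 'm) module \<Rightarrow> nat set \<Rightarrow> (nat \<Rightarrow> nat) \<Rightarrow> (nat \<Rightarrow> 'm) \<Rightarrow> bool" where
  "generates P I j x \<longleftrightarrow> finite I \<and> j \<in> I \<rightarrow> V \<and> x \<in> I \<rightarrow> carrier P \<and>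
     (\<forall>k\<in>I. e (j k) \<odot>\<^bsub>P\<^esub> x k = x k) \<and> span P x I = carrier P"

text \<open>The idempotents sum to 1, so each ordinary generator a is the sum of the elements e_v a,
  and these are homogeneous.\<close>

lemma generates_exists:
  assumes "fg_module R P" shows "\<exists>I j x. generates P I j x"
proof -
  obtain A where A: "finite A" "A \<subseteq> carrier P" and gen: "\<And>N. submodule N R P \<Longrightarrow> A \<subseteq> N \<Longrightarrow> N = carrier P"
    and P: "left_module R P" using assms by (auto simp: fg_module_def)
  interpret P: left_module R P by fact
  obtain h where h: "bij_betw h {0..<card (V \<times> A)} (V \<times> A)"
    using ex_bij_betw_nat_finite[of "V \<times> A"] V A by auto
  let ?I = "{0..<card (V \<times> A)}"
  define x where "x = (\<lambda>k. e (fst (h k)) \<odot>\<^bsub>P\<^esub> snd (h k))"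
  have hk: "fst (h k) \<in> V" "snd (h k) \<in> carrier P" if "k \<in> ?I" for k
    using bij_betwE[OF h] that A(2) by (fastforce simp: mem_Times_iff)+
  have x: "x \<in> ?I \<rightarrow> carrier P" using hk e_closed by (auto simp: x_def)
  have ex: "e (fst (h k)) \<odot>\<^bsub>P\<^esub> x k = x k" if "k \<in> ?I" for k
    using hk[OF that] e_closed e_idem by (simp add: x_def P.smult_assoc[symmetric])
  have sub: "submodule (span P x ?I) R P" using P x by (intro span_submodule) auto
  have "a \<in> span P x ?I" if a: "a \<in> A" for a
  proof -
    have mem: "e v \<odot>\<^bsub>P\<^esub> a \<in> span P x ?I" if "v \<in> V" for v
    proof -
      have "(v, a) \<in> h ` ?I" using h a that by (simp add: bij_betw_def)
      then obtain k where "k \<in> ?I" "h k = (v, a)" by auto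
      then show ?thesis using span_generator[OF P _ x, of k] by (simp add: x_def)
    qed
    have "a = finsum R e V \<odot>\<^bsub>P\<^esub> a" using a A(2) by (auto simp: e_sum)
    also have "\<dots> = finsum P (\<lambda>v. e v \<odot>\<^bsub>P\<^esub> a) V" using V a A(2) e_closed by (intro P.finsum_smult_l) auto
    also have "\<dots> \<in> span P x ?I" using mem by (intro submodule_finsum[OF P sub V]) auto
    finally show ?thesis .
  qed
  then have "span P x ?I = carrier P" by (intro gen[OF sub]) auto
  then have "generates P ?I (\<lambda>k. fst (h k)) x"
    using hk x ex by (simp add: generates_def)
  then show ?thesis by blast
qed

text \<open>Krull--Schmidt: for a generating family of minimal length the covering of \<open>P\<close> by the
  corresponding sum of projectives splits, and the complementary idempotent has all its entries
  in the nilpotent radical, since a unit entry would make a generator superfluous.\<close>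

lemma fg_projective_decomposition:
  assumes P: "fg_projective R P"
  shows "\<exists>I j \<pi>. finite I \<and> j \<in> I \<rightarrow> V \<and> \<pi> \<in> lmod_hom R (dsum I (\<lambda>k. proj (j k))) P \<and>
    inj_on \<pi> (carrier (dsum I (\<lambda>k. proj (j k)))) \<and> carrier P \<subseteq> \<pi> ` carrier (dsum I (\<lambda>k. proj (j k)))"
proof -
  have fg: "fg_module R P" and Pm: "left_module R P" using P by (auto simp: fg_projective_def fg_module_def)
  interpret P: left_module R P by (rule Pm)
  define m where "m = (LEAST m. \<exists>I j x. generates P I j x \<and> card I = m)"
  have "\<exists>m I j x. generates P I j x \<and> card I = m" using generates_exists[OF fg] by blast
  from LeastI_ex[OF this] obtain I j x where gen: "generates P I j x" and card: "card I = m"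
    unfolding m_def by blast
  have min: "m \<le> card I'" if "generates P I' j' x'" for I' j' x'
    unfolding m_def using that by (intro Least_le) blast
  have fin: "finite I" and j: "\<And>k. k \<in> I \<Longrightarrow> j k \<in> V" and x: "\<And>k. k \<in> I \<Longrightarrow> x k \<in> carrier P"
    and ex: "\<And>k. k \<in> I \<Longrightarrow> e (j k) \<odot>\<^bsub>P\<^esub> x k = x k" and span: "span P x I = carrier P"
    using gen by (auto simp: generates_def)
  note ej = e_closed[OF j]
  let ?F = "dsum I (\<lambda>k. proj (j k))"
  have Fb: "has_basis R (e ` V) ?F"
    using has_basis_mono[OF proj_basis[OF j]] j by (intro has_basis_dsum R.ring_axioms fin) auto
  have Fm: "left_module R ?F" using Fb by (simp add: has_basis_def)
  have Ffg: "fg_module R ?F" by (rule has_basis_fg[OF Fb])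
  interpret F: left_module R ?F by (rule Fm)
  define \<psi> where "\<psi> = (\<lambda>k (v :: nat \<Rightarrow> 'r). coord k v 0)"
  have \<psi>c: "\<psi> k v \<in> carrier R" "\<psi> k v \<otimes> e (j k) = \<psi> k v" if "k \<in> I" "v \<in> carrier ?F" for k v
    using coord_closed[OF that(2,1)] carrier_proj[OF j[OF that(1)]] by (auto simp: \<psi>_def)
  have \<psi>add: "\<psi> k (v \<oplus>\<^bsub>?F\<^esub> w) = \<psi> k v \<oplus> \<psi> k w" if "k \<in> I" for k v w
    using that by (simp add: \<psi>_def) (simp add: left_ideal_module_def)
  have \<psi>smult: "\<psi> k (a \<odot>\<^bsub>?F\<^esub> v) = a \<otimes> \<psi> k v" if "k \<in> I" for k a v
    using that by (simp add: \<psi>_def) (simp add: left_ideal_module_def)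
  have \<psi>lf: "\<psi> k \<in> linear_forms R ?F" if "k \<in> I" for k
    using \<psi>c \<psi>add \<psi>smult that by (auto simp: linear_forms_def)
  define \<pi> where "\<pi> = (\<lambda>v. finsum P (\<lambda>k. \<psi> k v \<odot>\<^bsub>P\<^esub> x k) I)"
  have \<pi>: "\<pi> \<in> lmod_hom R ?F P"
  proof (rule lmod_homI)
    fix v assume v: "v \<in> carrier ?F"
    show "\<pi> v \<in> carrier P" unfolding \<pi>_def using \<psi>c v x by (intro P.M.finsum_closed) auto
    fix w assume w: "w \<in> carrier ?F"
    have "\<pi> (v \<oplus>\<^bsub>?F\<^esub> w) = finsum P (\<lambda>k. \<psi> k v \<odot>\<^bsub>P\<^esub> x k \<oplus>\<^bsub>P\<^esub> \<psi> k w \<odot>\<^bsub>P\<^esub> x k) I"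
      unfolding \<pi>_def using \<psi>c v w x \<psi>add by (intro P.M.finsum_cong') (auto simp: P.smult_l_distr)
    then show "\<pi> (v \<oplus>\<^bsub>?F\<^esub> w) = \<pi> v \<oplus>\<^bsub>P\<^esub> \<pi> w"
      unfolding \<pi>_def using \<psi>c v w x by (subst P.M.finsum_addf[symmetric]) auto
  next
    fix a v assume a: "a \<in> carrier R" and v: "v \<in> carrier ?F"
    have "\<pi> (a \<odot>\<^bsub>?F\<^esub> v) = finsum P (\<lambda>k. a \<odot>\<^bsub>P\<^esub> (\<psi> k v \<odot>\<^bsub>P\<^esub> x k)) I"
      unfolding \<pi>_def using \<psi>c v x a \<psi>smult by (intro P.M.finsum_cong') (auto simp: P.smult_assoc)
    then show "\<pi> (a \<odot>\<^bsub>?F\<^esub> v) = a \<odot>\<^bsub>P\<^esub> \<pi> v"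
      unfolding \<pi>_def using \<psi>c v x a fin by (subst P.finsum_smult) auto
  qed
  have sur: "carrier P \<subseteq> \<pi> ` carrier ?F"
  proof
    fix y assume "y \<in> carrier P"
    then obtain c where c: "\<And>k. k \<in> I \<Longrightarrow> c k \<in> carrier R" and y: "y = finsum P (\<lambda>k. c k \<odot>\<^bsub>P\<^esub> x k) I"
      unfolding span[symmetric] span_def by auto
    let ?v = "pack I (\<lambda>k _. c k \<otimes> e (j k))"
    have v: "?v \<in> carrier ?F"
      by (rule pack_closed) (use c ej e_idem[OF j] in \<open>simp add: carrier_proj[OF j] R.m_assoc\<close>)
    have "\<pi> ?v = finsum P (\<lambda>k. c k \<odot>\<^bsub>P\<^esub> x k) I"
      unfolding \<pi>_def using c ej ex x by (intro P.M.finsum_cong') (auto simp: \<psi>_def P.smult_assoc)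
    then show "y \<in> \<pi> ` carrier ?F" using v y by (intro image_eqI[of y \<pi> ?v]) simp_all
  qed
  have "\<pi> ` carrier ?F = carrier P" using sur lmod_hom_closed[OF \<pi>] by blast
  then have "\<exists>s\<in>lmod_hom R P ?F. \<forall>y\<in>carrier P. \<pi> (s y) = y"
    by (rule fg_projective_lift[OF P \<pi> lmod_hom_id Ffg fg])
  then obtain s where s: "s \<in> lmod_hom R P ?F" and \<pi>s: "\<And>y. y \<in> carrier P \<Longrightarrow> \<pi> (s y) = y" by blast
  note sc = lmod_hom_closed[OF s x]
  \<comment> \<open>With s a section of \<pi>, the matrix \<open>a\<close> describes the idempotent
    s \<pi> on the sum of projectives and \<open>b\<close> the complementary idempotent, acting on
    coordinate rows from the right.\<close>
  define a where "a = (\<lambda>k l. \<psi> l (s (x k)))"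
  define b where "b = (\<lambda>k l. (if k = l then e (j k) else \<zero>) \<ominus> a k l)"
  have ac: "a k l \<in> carrier R" "a k l \<otimes> e (j l) = a k l" "e (j k) \<otimes> a k l = a k l"
    if "k \<in> I" "l \<in> I" for k l
  proof -
    show "a k l \<in> carrier R" "a k l \<otimes> e (j l) = a k l" using \<psi>c[OF that(2) sc[OF that(1)]] by
      (auto simp: a_def)
    have "e (j k) \<odot>\<^bsub>?F\<^esub> s (x k) = s (x k)"
      using lmod_hom_smult[OF s ej[OF that(1)] x[OF that(1)]] ex[OF that(1)] by simp
    then show "e (j k) \<otimes> a k l = a k l" using \<psi>smult[OF that(2), of "e (j k)" "s (x k)"] by (simp add: a_def)
  qed
  have bc: "b k l \<in> carrier R" "b k l \<otimes> e (j l) = b k l" "e (j k) \<otimes> b k l = b k l"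
    if kl: "k \<in> I" "l \<in> I" for k l
    using ac[OF kl] ej[OF kl(1)] ej[OF kl(2)] e_idem[OF j[OF kl(1)]]
    by (auto simp: b_def a_minus_def R.l_distr R.r_distr R.l_minus R.r_minus)
  \<comment> \<open>Applying \<pi> to s(x_k) returns x_k, so every row of \<open>b\<close> is a
    linear relation between the generators.\<close>
  have rel: "finsum P (\<lambda>l. b k l \<odot>\<^bsub>P\<^esub> x l) I = \<zero>\<^bsub>P\<^esub>" if k: "k \<in> I" for k
  proof -
    have "finsum P (\<lambda>l. b k l \<odot>\<^bsub>P\<^esub> x l) I =
        finsum P (\<lambda>l. (if k = l then x l else \<zero>\<^bsub>P\<^esub>) \<oplus>\<^bsub>P\<^esub> (\<ominus> \<one>) \<odot>\<^bsub>P\<^esub> (a k l \<odot>\<^bsub>P\<^esub> x l)) I"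
    proof (rule P.M.finsum_cong')
      fix l assume l: "l \<in> I"
      have "(\<ominus> a k l) \<odot>\<^bsub>P\<^esub> x l = (\<ominus> \<one>) \<odot>\<^bsub>P\<^esub> (a k l \<odot>\<^bsub>P\<^esub> x l)"
        using ac[OF k l] x[OF l] by (simp add: P.smult_l_minus)
      then show "b k l \<odot>\<^bsub>P\<^esub> x l = (if k = l then x l else \<zero>\<^bsub>P\<^esub>) \<oplus>\<^bsub>P\<^esub> (\<ominus> \<one>) \<odot>\<^bsub>P\<^esub> (a k l \<odot>\<^bsub>P\<^esub> x l)"
        using ac[OF k l] x[OF l] ej[OF l] ex[OF l] by (auto simp: b_def a_minus_def P.smult_l_distr)
    qed (use k x ac in auto)
    also have "\<dots> = x k \<oplus>\<^bsub>P\<^esub> (\<ominus> \<one>) \<odot>\<^bsub>P\<^esub> finsum P (\<lambda>l. a k l \<odot>\<^bsub>P\<^esub> x l) I"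
      using k x ac fin
      by (subst P.M.finsum_addf) (auto simp: P.M.add.finprod_singleton P.finsum_smult)
    also have "finsum P (\<lambda>l. a k l \<odot>\<^bsub>P\<^esub> x l) I = x k"
      using \<pi>s[OF x[OF k]] by (simp add: \<pi>_def a_def)
    finally show ?thesis using x[OF k] by (simp add: P.smult_l_minus P.M.r_neg)
  qed
  \<comment> \<open>Multiplying the k-th relation by a left inverse of b_kl expresses x_l through
    the other generators, against the minimal choice of \<open>m\<close>.\<close>
  have bJ: "b k l \<in> J 1" if k: "k \<in> I" and l: "l \<in> I" for k l
  proof (rule ccontr)
    assume "b k l \<notin> J 1"
    then obtain b' where b': "b' \<in> carrier R" "b' \<otimes> b k l = e (j l)"
      using local[OF j[OF k] j[OF l] bc(1,3,2)[OF k l]] by blast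
    let ?I = "I - {l}"
    have fin': "finite ?I" and x': "x \<in> ?I \<rightarrow> carrier P" using fin x by auto
    have sub: "submodule (span P x ?I) R P" by (rule span_submodule[OF Pm fin' x'])
    interpret Sp: submodule "span P x ?I" R P by (rule sub)
    define r where "r = finsum P (\<lambda>l'. b k l' \<odot>\<^bsub>P\<^esub> x l') ?I"
    have r: "r \<in> span P x ?I" unfolding r_def using span_generator[OF Pm fin' x'] bc k
      by (intro submodule_finsum[OF Pm sub fin']) (auto intro!: Sp.smult_closed)
    have rc: "r \<in> carrier P" using r Sp.subset by auto
    have "finsum P (\<lambda>l. b k l \<odot>\<^bsub>P\<^esub> x l) (insert l ?I) = b k l \<odot>\<^bsub>P\<^esub> x l \<oplus>\<^bsub>P\<^esub> r"
      unfolding r_def by (rule P.M.finsum_insert) (use fin' x bc[OF k] l in simp_all)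
    moreover have "insert l ?I = I" using l by auto
    ultimately have "b k l \<odot>\<^bsub>P\<^esub> x l = \<ominus>\<^bsub>P\<^esub> r"
      using rel[OF k] rc bc[OF k l] x[OF l] by (simp add: P.M.minus_equality)
    then have "b' \<odot>\<^bsub>P\<^esub> (b k l \<odot>\<^bsub>P\<^esub> x l) = (\<ominus> b') \<odot>\<^bsub>P\<^esub> r"
      using rc b'(1) by (simp add: P.smult_r_minus P.smult_l_minus)
    moreover have "b' \<odot>\<^bsub>P\<^esub> (b k l \<odot>\<^bsub>P\<^esub> x l) = x l"
      using b' bc[OF k l] x[OF l] ex[OF l] by (simp add: P.smult_assoc[symmetric])
    ultimately have xl: "x l \<in> span P x ?I" using r b'(1) by simp
    have "carrier P \<subseteq> span P x ?I"
    proof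
      fix y assume "y \<in> carrier P"
      then obtain c where c: "\<And>k. k \<in> I \<Longrightarrow> c k \<in> carrier R" and y: "y = finsum P (\<lambda>k. c k \<odot>\<^bsub>P\<^esub> x k) I"
        unfolding span[symmetric] span_def by auto
      have "x k \<in> span P x ?I" if "k \<in> I" for k
        using xl span_generator[OF Pm fin' x', of k] that by (cases "k = l") auto
      then show "y \<in> span P x ?I" unfolding y using c
        by (intro submodule_finsum[OF Pm sub fin]) (auto intro!: Sp.smult_closed)
    qed
    then have "span P x ?I = carrier P" using Sp.subset by auto
    then have "generates P ?I j x" using gen by (auto simp: generates_def)
    then have "m \<le> card ?I" by (rule min)
    moreover have "card ?I < card I" using fin l by (intro psubset_card_mono) auto
    ultimately show False using card by simp
  qed
  have "v = \<zero>\<^bsub>?F\<^esub>" if v: "v \<in> carrier ?F" and zero: "\<pi> v = \<zero>\<^bsub>P\<^esub>" for v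
  proof -
    \<comment> \<open>On the kernel of \<pi> the idempotent s \<pi> is zero, so the coordinate row
      of v satisfies v = v b.\<close>
    have rec: "\<psi> l v = finsum R (\<lambda>k. \<psi> k v \<otimes> b k l) I" if l: "l \<in> I" for l
    proof -
      have "s (\<pi> v) = \<zero>\<^bsub>?F\<^esub>" using zero lmod_hom_zero[OF s Pm Fm] by simp
      moreover have "s (\<pi> v) = finsum ?F (\<lambda>k. s (\<psi> k v \<odot>\<^bsub>P\<^esub> x k)) I"
        unfolding \<pi>_def by (rule lmod_hom_finsum[OF s Pm Fm fin]) (use \<psi>c v x in auto)
      moreover have "\<dots> = finsum ?F (\<lambda>k. \<psi> k v \<odot>\<^bsub>?F\<^esub> s (x k)) I"
        using \<psi>c v x sc by (intro F.M.finsum_cong') (auto simp: lmod_hom_smult[OF s])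
      ultimately have "\<psi> l \<zero>\<^bsub>?F\<^esub> = finsum R (\<lambda>k. \<psi> l (\<psi> k v \<odot>\<^bsub>?F\<^esub> s (x k))) I"
        using linear_form_finsum[OF R.ring_axioms Fm \<psi>lf[OF l] fin, of "\<lambda>k. \<psi> k v \<odot>\<^bsub>?F\<^esub> s (x k)"] \<psi>c v
          sc by auto
      moreover have "\<psi> l \<zero>\<^bsub>?F\<^esub> = \<zero>" using l by (simp add: \<psi>_def) (simp add: left_ideal_module_def)
      ultimately have za: "finsum R (\<lambda>k. \<psi> k v \<otimes> a k l) I = \<zero>"
        using l by (simp add: \<psi>smult a_def)
      have "\<psi> l v = finsum R (\<lambda>k. if l = k then \<psi> k v else \<zero>) I"
        using \<psi>c v l fin by (subst R.add.finprod_singleton) auto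
      also have "\<dots> = finsum R (\<lambda>k. \<psi> k v \<otimes> a k l \<oplus> \<psi> k v \<otimes> b k l) I"
      proof (rule R.finsum_cong')
        fix k assume k: "k \<in> I"
        have "a k l \<oplus> b k l = (if k = l then e (j k) else \<zero>)"
          unfolding b_def a_minus_def using ac[OF k l] ej[OF k]
          by (subst R.a_lcomm) (auto simp: R.r_neg)
        then have "\<psi> k v \<otimes> a k l \<oplus> \<psi> k v \<otimes> b k l = \<psi> k v \<otimes> (if k = l then e (j k) else \<zero>)"
          using ac[OF k l] bc[OF k l] \<psi>c[OF k v] by (simp add: R.r_distr[symmetric])
        then show "(if l = k then \<psi> k v else \<zero>) = \<psi> k v \<otimes> a k l \<oplus> \<psi> k v \<otimes> b k l"
          using \<psi>c[OF k v] by auto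
      qed (use ac bc l \<psi>c v in auto)
      also have "\<dots> = finsum R (\<lambda>k. \<psi> k v \<otimes> b k l) I"
        using ac bc l \<psi>c v za by (subst R.finsum_addf) (auto intro!: R.finsum_closed)
      finally show ?thesis .
    qed
    \<comment> \<open>Each use of v = v b raises the filtration degree by one, because the entries
      of \<open>b\<close> lie in \<open>J 1\<close>; at degree \<open>N\<close> the row is
      zero.\<close>
    have "\<forall>l\<in>I. \<psi> l v \<in> J q" for q
    proof (induction q)
      case 0 then show ?case using \<psi>c v by (simp add: J_0)
    next
      case (Suc q)
      show ?case
      proof
        fix l assume l: "l \<in> I"
        have t: "\<psi> k v \<otimes> b k l \<in> J (Suc q)" if "k \<in> I" for k
          using J_mult[of "\<psi> k v" q "b k l" 1] Suc bJ[OF that l] that by simp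
        have "finsum R (\<lambda>k. \<psi> k v \<otimes> b k l) K \<in> J (Suc q)" if "K \<subseteq> I" for K
        proof -
          have "finite K" using that fin by (rule finite_subset)
          then show ?thesis using that
          proof (induction K)
            case (insert k K)
            then have "(\<lambda>k. \<psi> k v \<otimes> b k l) \<in> K \<rightarrow> carrier R" "\<psi> k v \<otimes> b k l \<in> carrier R"
              using \<psi>c v bc l by auto
            then show ?case using insert t by (auto intro!: J_add)
          qed (simp add: J_zero)
        qed
        then show "\<psi> l v \<in> J (Suc q)" using rec[OF l] by (metis order_refl)
      qed
    qed
    then have "\<psi> l v = \<zero>" if "l \<in> I" for l using J_nilpotent that by blast
    then have "coord l v = coord l \<zero>\<^bsub>?F\<^esub>" if "l \<in> I" for l
    proof -
      have "coord l v = (\<lambda>_. \<psi> l v)"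
        using coord_closed[OF v that] carrier_proj[OF j[OF that]] by (simp add: \<psi>_def)
      then show ?thesis using \<open>\<And>l. l \<in> I \<Longrightarrow> \<psi> l v = \<zero>\<close> that by (simp add: left_ideal_module_def)
    qed
    then show ?thesis by (intro dsum_eqI[OF v]) auto
  qed
  then have "inj_on \<pi> (carrier ?F)"
  proof (intro inj_onI)
    fix v w assume v: "v \<in> carrier ?F" and w: "w \<in> carrier ?F" and eq: "\<pi> v = \<pi> w"
    have "\<pi> (v \<oplus>\<^bsub>?F\<^esub> (\<ominus>\<^bsub>?F\<^esub> w)) = \<zero>\<^bsub>P\<^esub>"
      using v w eq lmod_hom_minus[OF \<pi> Fm Pm w] lmod_hom_closed[OF \<pi> w]
      by (simp add: lmod_hom_add[OF \<pi>] P.M.r_neg)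
    then have "v \<oplus>\<^bsub>?F\<^esub> (\<ominus>\<^bsub>?F\<^esub> w) = \<zero>\<^bsub>?F\<^esub>"
      using \<open>\<And>v. v \<in> carrier ?F \<Longrightarrow> \<pi> v = \<zero>\<^bsub>P\<^esub> \<Longrightarrow> v = \<zero>\<^bsub>?F\<^esub>\<close> v w by simp
    then show "v = w" using F.M.minus_equality[of v "\<ominus>\<^bsub>?F\<^esub> w"] v w by simp
  qed
  then show ?thesis using fin j \<pi> sur by (intro exI[of _ I] exI[of _ j] exI[of _ \<pi>]) simp
qed

text \<open>The decomposition is an isomorphism, not just a splitting, so closure under finite sums
  and isomorphisms suffices.\<close>

lemma projective_stalks_in_triangulated:
  assumes S: "triangulated_subcat R S" and stalks: "\<And>v. v \<in> V \<Longrightarrow> stalk (proj v) \<in> S"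
    and P: "fg_projective R P"
  shows "stalk P \<in> S"
proof -
  obtain I j \<pi> where I: "finite I" and j: "j \<in> I \<rightarrow> V" and \<pi>: "\<pi> \<in> lmod_hom R (dsum I (\<lambda>k. proj (j k))) P"
    "inj_on \<pi> (carrier (dsum I (\<lambda>k. proj (j k))))" "carrier P \<subseteq> \<pi> ` carrier (dsum I (\<lambda>k. proj (j k)))"
    using fg_projective_decomposition[OF P] by blast
  have "has_basis R (e ` V) (proj v)" if "v \<in> V" for v
    using has_basis_mono[OF proj_basis[OF that]] that by auto
  then have F: "stalk (dsum I (\<lambda>k. proj (j k))) \<in> S"
    using j stalks by (intro dsum_stalk_in_triangulated[OF R.ring_axioms S I, of _ "e ` V"])
      (simp_all add: Pi_iff)
  have "fg_module R P" using P by (simp add: fg_projective_def)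
  then show ?thesis by (rule stalk_iso_in_triangulated[OF R.ring_axioms S F _ \<pi>])
qed

end


section \<open>The tilting complex of an approximation\<close>

text \<open>Homomorphisms from R e_l to R e_i are right multiplications by elements of e_l R e_i;
  \<open>approx\<close> says that each of them factors through d, and \<open>nondeg\<close> that no
  nonzero y in e_i R e_l is killed from the left by all of e_l R e_i. \<open>P'_stalk\<close> lets
  P' be one projective or a sum of two.\<close>

locale approximation = local_idempotents R V e J N
  for R :: "'r ring" (structure) and V e J N +
  fixes i :: nat and P' :: "('r, nat \<Rightarrow> 'r) module" and d :: "(nat \<Rightarrow> 'r) \<Rightarrow> nat \<Rightarrow> 'r"
  assumes i: "i \<in> V"
    and P'_basis: "has_basis R (e ` (V - {i})) P'"
    and P'_stalk: "triangulated_subcat R S \<Longrightarrow> (\<And>l. l \<in> V - {i} \<Longrightarrow> stalk (proj l) \<in> S) \<Longrightarrow> stalk P' \<in> S"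
    and d: "d \<in> lmod_hom R P' (proj i)"
    and approx: "l \<in> V - {i} \<Longrightarrow> a \<in> carrier R \<Longrightarrow> e l \<otimes> a = a \<Longrightarrow> a \<otimes> e i = a \<Longrightarrow> (\<lambda>_. a) \<in> d ` carrier P'"
    and nondeg: "l \<in> V - {i} \<Longrightarrow> y \<in> carrier R \<Longrightarrow> e i \<otimes> y = y \<Longrightarrow> y \<otimes> e l = y \<Longrightarrow>
      (\<And>a. a \<in> carrier R \<Longrightarrow> e l \<otimes> a = a \<Longrightarrow> a \<otimes> e i = a \<Longrightarrow> a \<otimes> y = \<zero>) \<Longrightarrow> y = \<zero>"
begin

definition summand :: "nat \<Rightarrow> ('r, nat \<Rightarrow> 'r) cplx" where
  "summand j = (if j = i then two_term P' (proj i) d else stalk (proj j))"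

abbreviation T :: "('r, nat \<Rightarrow> 'r) cplx" where
  "T \<equiv> dsum_cplx V summand"

lemma proj_basis_V: "v \<in> V \<Longrightarrow> has_basis R (e ` V) (proj v)"
  using has_basis_mono[OF proj_basis, of v "e ` V"] by auto

lemma summand_basis: "j \<in> V \<Longrightarrow> basis_cplx R (e ` V) (summand j)"
  unfolding summand_def using i d proj_basis_V has_basis_mono[OF P'_basis, of "e ` V"]
  by (auto intro!: basis_cplx_two_term basis_cplx_stalk R.ring_axioms)

lemma T_basis: "basis_cplx R (e ` V) T"
  by (rule basis_cplx_dsum[OF R.ring_axioms V summand_basis])

lemma T_obj:
  "cobj T 0 = dsum V (\<lambda>j. if j = i then P' else proj j)"
  "cobj T 1 = dsum V (\<lambda>j. if j = i then proj i else zero_lmod)"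
  by (auto simp: dsum_cplx_def summand_def two_term_def stalk_def intro!: arg_cong[of _ _ "dsum V"])

text \<open>Degree 0 gets a basis whose labels avoid e_i. The next arguments work with basis
  elements fixed by some e_l with l \<noteq> i.\<close>

lemma T_basis_0: "has_basis R (e ` (V - {i})) (cobj T 0)"
  unfolding T_obj
proof (rule has_basis_dsum[OF R.ring_axioms V])
  fix j assume "j \<in> V"
  then show "has_basis R (e ` (V - {i})) (if j = i then P' else proj j)"
    using P'_basis has_basis_mono[OF proj_basis[of j], of "e ` (V - {i})"] by auto
qed

sublocale T: two_term_cplx R T "e ` (V - {i})" "e ` V"
  using T_basis T_basis_0 by unfold_locales (auto simp: basis_cplx_def)

lemma T_modules: "left_module R (cobj T k)"
  by (rule T.mod)

lemma T_diff_hom: "cdiff T 0 \<in> lmod_hom R (cobj T 0) (cobj T 1)"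
  using is_cplx_diff[OF T.cplx, of 0] by simp

lemma proj_modules: "j \<in> V \<Longrightarrow> left_module R (if j = i then proj i else zero_lmod)"
  using proj_module left_module_zero_lmod[OF R.ring_axioms] by auto

text \<open>Up to zero modules T^1 is R e_i, so an element fixed by e_l is an element of e_l R e_i,
  and \<open>approx\<close> puts it into the image of d.\<close>

lemma T1_coboundary:
  assumes l: "l \<in> V - {i}" and z: "z \<in> carrier (cobj T 1)" and el: "e l \<odot>\<^bsub>cobj T 1\<^esub> z = z"
  shows "z \<in> cdiff T 0 ` carrier (cobj T 0)"
proof -
  have zi: "coord i z \<in> carrier (proj i)" using coord_closed[OF z[unfolded T_obj] i] by simp
  define a where "a = coord i z 0"
  have a: "coord i z = (\<lambda>_. a)" "a \<in> carrier R" "a \<otimes> e i = a"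
    using zi carrier_proj[OF i] by (auto simp: a_def)
  have "e l \<odot>\<^bsub>proj i\<^esub> coord i z = coord i z" using arg_cong[OF el, of "coord i"] i unfolding T_obj by simp
  then have "e l \<otimes> a = a" unfolding a(1) by (simp add: left_ideal_module_def fun_eq_iff)
  then obtain p where p: "p \<in> carrier P'" "coord i z = d p" using approx[OF l a(2) _ a(3)] a(1) by auto
  let ?t = "single V (\<lambda>j. if j = i then P' else proj j) i p"
  have lm: "left_module R (if j = i then P' else proj j)" if "j \<in> V" for j
    using that P'_basis proj_module by (auto simp: has_basis_def)
  have t: "?t \<in> carrier (cobj T 0)" unfolding T_obj
    by (rule lmod_hom_closed[OF single_hom[of V R _ i]]) (use lm p in auto)
  have "z = cdiff T 0 ?t"
  proof (rule dsum_eqI[OF z[unfolded T_obj] lmod_hom_closed[OF T_diff_hom t, unfolded T_obj]])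
    fix j assume j: "j \<in> V"
    show "coord j z = coord j (cdiff T 0 ?t)"
    proof (cases "j = i")
      case True
      have "coord i (cdiff T 0 ?t) = d p"
        using i by (simp add: dsum_cplx_def summand_def two_term_def coord_single)
      then show ?thesis using True p by simp
    next
      case False
      have "coord j z \<in> carrier (zero_lmod :: ('r, nat \<Rightarrow> 'r) module)"
        "coord j (cdiff T 0 ?t) \<in> carrier (zero_lmod :: ('r, nat \<Rightarrow> 'r) module)"
        using coord_closed[OF z[unfolded T_obj] j] False
          coord_closed[OF lmod_hom_closed[OF T_diff_hom t, unfolded T_obj] j] by simp_all
      then show ?thesis unfolding carrier_zero_lmod by auto
    qed
  qed
  then show ?thesis using t by blast
qed

text \<open>Basis elements of T^0 are fixed by some e_l with l \<noteq> i, hence so are their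
  images, which are coboundaries by \<open>T1_coboundary\<close>. The coboundaries form a submodule,
  so all values follow.\<close>

lemma T_hom_0_1:
  assumes \<phi>: "\<phi> \<in> lmod_hom R (cobj T 0) (cobj T 1)" and x: "x \<in> carrier (cobj T 0)"
  shows "\<phi> x \<in> cdiff T 0 ` carrier (cobj T 0)"
proof -
  interpret T0: left_module R "cobj T 0" by (rule T_modules)
  interpret T1: left_module R "cobj T 1" by (rule T_modules)
  obtain I f g \<psi> where b: "dual_basis R (cobj T 0) I f g \<psi>" and f: "f ` I \<subseteq> e ` (V - {i})"
    using T_basis_0 by (auto simp: has_basis_def)
  have sub: "submodule (cdiff T 0 ` carrier (cobj T 0)) R (cobj T 1)"
  proof (rule submoduleI_left_module[OF T_modules])
    show "\<zero>\<^bsub>cobj T 1\<^esub> \<in> cdiff T 0 ` carrier (cobj T 0)"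
      using lmod_hom_zero[OF T_diff_hom T_modules T_modules] by (metis T0.M.zero_closed imageI)
    show "y \<oplus>\<^bsub>cobj T 1\<^esub> z \<in> cdiff T 0 ` carrier (cobj T 0)"
      if "y \<in> cdiff T 0 ` carrier (cobj T 0)" "z \<in> cdiff T 0 ` carrier (cobj T 0)" for y z
      using that by (auto simp: lmod_hom_add[OF T_diff_hom, symmetric])
    show "a \<odot>\<^bsub>cobj T 1\<^esub> z \<in> cdiff T 0 ` carrier (cobj T 0)"
      if "a \<in> carrier R" "z \<in> cdiff T 0 ` carrier (cobj T 0)" for a z
      using that by (auto simp: lmod_hom_smult[OF T_diff_hom, symmetric])
  qed (use lmod_hom_closed[OF T_diff_hom] in auto)
  interpret sub: submodule "cdiff T 0 ` carrier (cobj T 0)" R "cobj T 1" by (rule sub)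
  have fin: "finite I" using b by (simp add: dual_basis_def)
  have bk: "f k \<in> carrier R" "g k \<in> carrier (cobj T 0)" "f k \<odot>\<^bsub>cobj T 0\<^esub> g k = g k" "\<psi> k x \<in> carrier R"
    if "k \<in> I" for k
    using b that x by (auto simp: dual_basis_def linear_forms_def)
  have \<phi>g: "\<phi> (g k) \<in> cdiff T 0 ` carrier (cobj T 0)" if k: "k \<in> I" for k
  proof -
    obtain l where l: "l \<in> V - {i}" "f k = e l" using f k by auto
    have "e l \<odot>\<^bsub>cobj T 1\<^esub> \<phi> (g k) = \<phi> (g k)"
      using lmod_hom_smult[OF \<phi> bk(1,2)[OF k]] bk(3)[OF k] l(2) by simp
    then show ?thesis by (rule T1_coboundary[OF l(1) lmod_hom_closed[OF \<phi> bk(2)[OF k]]])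
  qed
  have "\<phi> x = \<phi> (finsum (cobj T 0) (\<lambda>k. \<psi> k x \<odot>\<^bsub>cobj T 0\<^esub> g k) I)"
    using b x by (simp add: dual_basis_def)
  also have "\<dots> = finsum (cobj T 1) (\<lambda>k. \<phi> (\<psi> k x \<odot>\<^bsub>cobj T 0\<^esub> g k)) I"
    using bk by (intro lmod_hom_finsum[OF \<phi> T_modules T_modules fin]) auto
  also have "\<dots> \<in> cdiff T 0 ` carrier (cobj T 0)"
    using bk \<phi>g by (intro submodule_finsum[OF T_modules sub fin]) (auto simp: lmod_hom_smult[OF \<phi>])
  finally show ?thesis .
qed

text \<open>T^1 is generated by one element \<epsilon> fixed by e_i. A coordinate y of
  \<phi>(\<epsilon>) lies in e_i R e_l. For a in e_l R the element a \<epsilon> is a coboundary, so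
  \<phi> kills it and a y = 0; \<open>nondeg\<close> gives y = 0.\<close>

lemma T_hom_1_0:
  assumes \<phi>: "\<phi> \<in> lmod_hom R (cobj T 1) (cobj T 0)"
    and \<phi>d: "\<And>x. x \<in> carrier (cobj T 0) \<Longrightarrow> \<phi> (cdiff T 0 x) = \<zero>\<^bsub>cobj T 0\<^esub>"
    and y: "y \<in> carrier (cobj T 1)"
  shows "\<phi> y = \<zero>\<^bsub>cobj T 0\<^esub>"
proof -
  interpret T0: left_module R "cobj T 0" by (rule T_modules)
  interpret T1: left_module R "cobj T 1" by (rule T_modules)
  obtain I f g \<psi> where b: "dual_basis R (cobj T 0) I f g \<psi>" and f: "f ` I \<subseteq> e ` (V - {i})"
    using T_basis_0 by (auto simp: has_basis_def)
  \<comment> \<open>The copy of e_i in T^1.\<close>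
  define \<epsilon> where "\<epsilon> = single V (\<lambda>j. if j = i then proj i else zero_lmod) i (\<lambda>_. e i)"
  have sh: "single V (\<lambda>j. if j = i then proj i else zero_lmod) i \<in> lmod_hom R (proj i) (cobj T 1)"
    unfolding T_obj using single_hom[of V R "\<lambda>j. if j = i then proj i else zero_lmod" i] proj_modules by simp
  have ei: "(\<lambda>_. e i) \<in> carrier (proj i)" using carrier_proj[OF i] e_closed[OF i] e_idem[OF i] by simp
  have \<epsilon>: "\<epsilon> \<in> carrier (cobj T 1)" unfolding \<epsilon>_def by (rule lmod_hom_closed[OF sh ei])
  have smult_\<epsilon>: "c \<odot>\<^bsub>cobj T 1\<^esub> \<epsilon> = single V (\<lambda>j. if j = i then proj i else zero_lmod) i (\<lambda>_. c \<otimes> e i)"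
    if "c \<in> carrier R" for c
    unfolding \<epsilon>_def using lmod_hom_smult[OF sh that ei] by (simp add: left_ideal_module_def)
  have e\<epsilon>: "e i \<odot>\<^bsub>cobj T 1\<^esub> \<epsilon> = \<epsilon>" using smult_\<epsilon>[OF e_closed[OF i]] e_idem[OF i] by (simp add: \<epsilon>_def)
  have \<phi>\<epsilon>: "\<phi> \<epsilon> \<in> carrier (cobj T 0)" by (rule lmod_hom_closed[OF \<phi> \<epsilon>])
  have fin: "finite I" using b by (simp add: dual_basis_def)
  have \<psi>0: "\<psi> k (\<phi> \<epsilon>) = \<zero>" if k: "k \<in> I" for k
  proof -
    obtain l where l: "l \<in> V - {i}" "f k = e l" using f k by auto
    have lf: "\<psi> k \<in> linear_forms R (cobj T 0)" and fk: "\<psi> k (\<phi> \<epsilon>) \<otimes> e l = \<psi> k (\<phi> \<epsilon>)"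
      using b k \<phi>\<epsilon> l(2) by (auto simp: dual_basis_def)
    have sm: "\<psi> k (a \<odot>\<^bsub>cobj T 0\<^esub> x) = a \<otimes> \<psi> k x" if "a \<in> carrier R" "x \<in> carrier (cobj T 0)" for a x
      using lf that by (auto simp: linear_forms_def)
    have cl: "\<psi> k x \<in> carrier R" if "x \<in> carrier (cobj T 0)" for x using lf that by
      (auto simp: linear_forms_def)
    have zero: "\<psi> k \<zero>\<^bsub>cobj T 0\<^esub> = \<zero>" using sm[of \<zero> "\<zero>\<^bsub>cobj T 0\<^esub>"] cl by simp
    have "a \<otimes> \<psi> k (\<phi> \<epsilon>) = \<zero>" if a: "a \<in> carrier R" "e l \<otimes> a = a" for a
    proof -
      have "e l \<odot>\<^bsub>cobj T 1\<^esub> (a \<odot>\<^bsub>cobj T 1\<^esub> \<epsilon>) = a \<odot>\<^bsub>cobj T 1\<^esub> \<epsilon>"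
        using T1.smult_assoc[of "e l" a \<epsilon>] e_closed[of l] l(1) a \<epsilon> by simp
      then obtain t where t: "t \<in> carrier (cobj T 0)" "a \<odot>\<^bsub>cobj T 1\<^esub> \<epsilon> = cdiff T 0 t"
        using T1_coboundary[OF l(1), of "a \<odot>\<^bsub>cobj T 1\<^esub> \<epsilon>"] a(1) \<epsilon> by auto
      have "a \<otimes> \<psi> k (\<phi> \<epsilon>) = \<psi> k (\<phi> (a \<odot>\<^bsub>cobj T 1\<^esub> \<epsilon>))"
        using sm[OF a(1) \<phi>\<epsilon>] lmod_hom_smult[OF \<phi> a(1) \<epsilon>] by simp
      then show ?thesis using t \<phi>d zero by simp
    qed
    moreover have "e i \<otimes> \<psi> k (\<phi> \<epsilon>) = \<psi> k (\<phi> \<epsilon>)"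
      using sm[OF e_closed[OF i] \<phi>\<epsilon>] lmod_hom_smult[OF \<phi> e_closed[OF i] \<epsilon>] e\<epsilon> by simp
    ultimately show ?thesis using nondeg[OF l(1) cl[OF \<phi>\<epsilon>] _ fk] by simp
  qed
  have "\<phi> \<epsilon> = finsum (cobj T 0) (\<lambda>k. \<psi> k (\<phi> \<epsilon>) \<odot>\<^bsub>cobj T 0\<^esub> g k) I"
    using b \<phi>\<epsilon> unfolding dual_basis_def by blast
  also have "\<dots> = \<zero>\<^bsub>cobj T 0\<^esub>"
    using b \<psi>0 by (intro T0.M.add.finprod_one_eqI) (auto simp: dual_basis_def)
  finally have zero: "\<phi> \<epsilon> = \<zero>\<^bsub>cobj T 0\<^esub>" .
  define a where "a = coord i y 0"
  have "coord i y \<in> carrier (proj i)" using coord_closed[OF y[unfolded T_obj] i] by simp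
  then have a: "coord i y = (\<lambda>_. a)" "a \<in> carrier R" "a \<otimes> e i = a"
    using carrier_proj[OF i] by (auto simp: a_def)
  have "y = a \<odot>\<^bsub>cobj T 1\<^esub> \<epsilon>"
  proof (rule dsum_eqI[OF y[unfolded T_obj]])
    show ac: "a \<odot>\<^bsub>cobj T 1\<^esub> \<epsilon> \<in> carrier (dsum V (\<lambda>j. if j = i then proj i else zero_lmod))"
      using a \<epsilon> by (simp add: T_obj[symmetric])
    fix j assume j: "j \<in> V"
    show "coord j y = coord j (a \<odot>\<^bsub>cobj T 1\<^esub> \<epsilon>)"
    proof (cases "j = i")
      case True then show ?thesis using a i by (simp add: smult_\<epsilon> coord_single)
    next
      case False
      have "coord j y \<in> carrier (zero_lmod :: ('r, nat \<Rightarrow> 'r) module)"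
        "coord j (a \<odot>\<^bsub>cobj T 1\<^esub> \<epsilon>) \<in> carrier (zero_lmod :: ('r, nat \<Rightarrow> 'r) module)"
        using coord_closed[OF y[unfolded T_obj] j] coord_closed[OF ac j] False by simp_all
      then show ?thesis unfolding carrier_zero_lmod by auto
    qed
  qed
  then show ?thesis using lmod_hom_smult[OF \<phi> a(2) \<epsilon>] zero a(2) by simp
qed

theorem tilting: "tilting_complex R T"
  unfolding tilting_complex_def
proof (intro conjI allI impI)
  show "is_cplx R T" "bounded_cplx T" using Db_objectsD[OF T.Db_object] by auto
  show "fg_projective R (cobj T k)" for k
    using T_basis has_basis_fg_projective by (auto simp: basis_cplx_def)
  show "Db_hom_zero R T (shift T r)" if "r \<noteq> 0" for r
    using T.Db_hom_zero_shift T_hom_0_1 T_hom_1_0 that by blast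
  fix P :: "('r, nat \<Rightarrow> 'r) module" assume P: "fg_projective R P"
  show "stalk P \<in> triangulated_hull R (Db_summands R T)"
    unfolding triangulated_hull_def
  proof (intro InterI)
    \<comment> \<open>The hull is an intersection, so an arbitrary triangulated S containing the
      summands of T is treated.\<close>
    fix S assume "S \<in> {S. triangulated_subcat R S \<and> Db_summands R T \<subseteq> S}"
    then have S: "triangulated_subcat R S" and sub: "Db_summands R T \<subseteq> S" by auto
    have sm: "summand j \<in> S" if "j \<in> V" for j
      using dsum_cplx_summand[of R V "e ` V" summand, OF R.ring_axioms V summand_basis that] sub by blast
    have st: "stalk (proj l) \<in> S" if "l \<in> V - {i}" for l using sm[of l] that by (simp add: summand_def)
    have P': "stalk P' \<in> S" by (rule P'_stalk[OF S st])
    have "two_term P' (proj i) d \<in> S" using sm[OF i] by (simp add: summand_def)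
    then have "stalk (proj i) \<in> S"
      by (rule cone_stalk_in_triangulated[OF R.ring_axioms S _ P' has_basis_fg[OF proj_basis[OF i]] d])
    then have "stalk (proj v) \<in> S" if "v \<in> V" for v using st that by (cases "v = i") auto
    then show "stalk P \<in> S" by (rule projective_stalks_in_triangulated[OF S _ P])
  qed
qed

end


section \<open>The path algebra\<close>

text \<open>One notation for the basis vectors of both kinds. \<open>arrow_path\<close> reads its
  source off the first arrow and so cannot serve for trivial paths.\<close>

definition path_elem :: "'v \<times> 'a list \<Rightarrow> 'v \<times> 'a list \<Rightarrow> 'k::field" where
  "path_elem p = (\<lambda>q. if q = p then 1 else 0)"

lemma trivial_path_eq: "trivial_path v = path_elem (v, [])"
  and arrow_path_eq: "arrow_path G as = path_elem (tail G (hd as), as)"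
  by (simp_all add: trivial_path_def arrow_path_def path_elem_def)

context fin_digraph
begin

abbreviation path_alg :: "('a \<times> 'b list \<Rightarrow> 'k::field) ring" where
  "path_alg \<equiv> path_algebra G"

text \<open>The end of a walk is determined by its start and its arrows, so it is computed by
  \<open>awlast\<close> instead of being quantified.\<close>

definition is_path :: "'a \<Rightarrow> 'b list \<Rightarrow> bool" where
  "is_path v as \<longleftrightarrow> awalk v as (awlast v as)"

lemma is_path_iff: "is_path v as \<longleftrightarrow> (\<exists>w. awalk v as w)"
  unfolding is_path_def by auto

lemma is_path_append [simp]: "is_path v (as @ bs) \<longleftrightarrow> is_path v as \<and> is_path (awlast v as) bs"
  by (simp add: is_path_def awlast_append)

lemma is_path_Nil [simp]: "is_path v [] \<longleftrightarrow> v \<in> verts G"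
  by (simp add: is_path_def awalk_Nil_iff)

lemma is_path_Cons [simp]: "is_path v (a # as) \<longleftrightarrow> a \<in> arcs G \<and> v = tail G a \<and> is_path (head G a) as"
  by (auto simp: is_path_def awalk_def wellformed(2))

lemma is_path_verts: "is_path v as \<Longrightarrow> v \<in> verts G"
  by (auto simp: is_path_def awalk_def)

lemma awlast_simps [simp]: "awlast v [] = v" "awlast v (as @ [a]) = head G a"
  by (simp_all add: awalk_verts_conv)

lemma path_algebra_carrier:
  "x \<in> carrier path_alg \<longleftrightarrow> finite {p. x p \<noteq> 0} \<and> (\<forall>v as. x (v, as) \<noteq> 0 \<longrightarrow> is_path v as)"
  by (simp add: path_algebra_def is_path_iff)

lemma path_algebra_zero: "\<zero>\<^bsub>path_alg\<^esub> = (\<lambda>_. 0)"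
  and path_algebra_add: "x \<oplus>\<^bsub>path_alg\<^esub> y = (\<lambda>p. x p + y p)"
  and path_algebra_one: "\<one>\<^bsub>path_alg\<^esub> = (\<lambda>(v, as). if v \<in> verts G \<and> as = [] then 1 else 0)"
  and path_algebra_mult: "(x \<otimes>\<^bsub>path_alg\<^esub> y) (v, as) =
    (\<Sum>k\<le>length as. x (v, take k as) * y (awlast v (take k as), drop k as))"
  by (simp_all add: path_algebra_def)

lemma path_algebra_mult_support:
  assumes "(x \<otimes>\<^bsub>path_alg\<^esub> y) (v, cs) \<noteq> 0"
  obtains as bs where "cs = as @ bs" "x (v, as) \<noteq> 0" "y (awlast v as, bs) \<noteq> 0"
proof -
  from assms have "\<exists>k\<le>length cs. x (v, take k cs) * y (awlast v (take k cs), drop k cs) \<noteq> 0"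
    unfolding path_algebra_mult by (meson sum.neutral atMost_iff)
  then show ?thesis using that by (metis append_take_drop_id mult_eq_0_iff)
qed

lemma path_algebra_mult_closed:
  assumes x: "x \<in> carrier path_alg" and y: "y \<in> carrier path_alg"
  shows "x \<otimes>\<^bsub>path_alg\<^esub> y \<in> carrier path_alg"
  unfolding path_algebra_carrier
proof (intro conjI allI impI)
  have "{p. (x \<otimes>\<^bsub>path_alg\<^esub> y) p \<noteq> 0} \<subseteq>
      (\<lambda>((v, as), (w, bs)). (v, as @ bs)) ` ({p. x p \<noteq> 0} \<times> {p. y p \<noteq> 0})"
  proof
    fix p assume "p \<in> {p. (x \<otimes>\<^bsub>path_alg\<^esub> y) p \<noteq> 0}"
    then obtain v cs where p: "p = (v, cs)" "(x \<otimes>\<^bsub>path_alg\<^esub> y) (v, cs) \<noteq> 0" by (cases p) auto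
    obtain as bs where "cs = as @ bs" "x (v, as) \<noteq> 0" "y (awlast v as, bs) \<noteq> 0"
      by (rule path_algebra_mult_support[OF p(2)])
    then show "p \<in> (\<lambda>((v, as), (w, bs)). (v, as @ bs)) ` ({p. x p \<noteq> 0} \<times> {p. y p \<noteq> 0})"
      unfolding p(1) by (intro image_eqI[of _ _ "((v, as), (awlast v as, bs))"]) auto
  qed
  then show "finite {p. (x \<otimes>\<^bsub>path_alg\<^esub> y) p \<noteq> 0}"
    using x y by (rule_tac finite_subset) (auto simp: path_algebra_carrier)
  fix v cs assume "(x \<otimes>\<^bsub>path_alg\<^esub> y) (v, cs) \<noteq> 0"
  then show "is_path v cs"
    by (rule path_algebra_mult_support) (use x y in \<open>auto simp: path_algebra_carrier\<close>)
qed

lemma path_algebra_one_closed: "\<one>\<^bsub>path_alg\<^esub> \<in> carrier (path_alg :: ('a \<times> 'b list \<Rightarrow> 'k::field) ring)"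
proof -
  have "{p. \<one>\<^bsub>path_alg :: ('a \<times> 'b list \<Rightarrow> 'k) ring\<^esub> p \<noteq> 0} \<subseteq> (\<lambda>v. (v, [])) ` verts G"
    by (auto simp: path_algebra_one split: if_splits)
  then show ?thesis
    unfolding path_algebra_carrier by (auto simp: path_algebra_one intro: finite_subset split: if_splits)
qed

lemma ring_path_algebra: "ring (path_alg :: ('a \<times> 'b list \<Rightarrow> 'k::field) ring)"
proof (intro ringI abelian_groupI monoidI)
  fix x y z :: "'a \<times> 'b list \<Rightarrow> 'k"
  assume x: "x \<in> carrier path_alg" and y: "y \<in> carrier path_alg"
  have "{p. x p + y p \<noteq> 0} \<subseteq> {p. x p \<noteq> 0} \<union> {p. y p \<noteq> 0}" by auto
  then show "x \<oplus>\<^bsub>path_alg\<^esub> y \<in> carrier path_alg"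
    using x y by (auto simp: path_algebra_carrier path_algebra_add intro: finite_subset)
  assume z: "z \<in> carrier path_alg"
  show "x \<otimes>\<^bsub>path_alg\<^esub> y \<otimes>\<^bsub>path_alg\<^esub> z = x \<otimes>\<^bsub>path_alg\<^esub> (y \<otimes>\<^bsub>path_alg\<^esub> z)"
  proof
    fix p :: "'a \<times> 'b list"
    obtain v as where p: "p = (v, as)" by (cases p)
    let ?n = "length as"
    \<comment> \<open>The contribution of cutting the path into pieces of lengths l, m and the rest.
      Both ways of bracketing sum it over all such cuts.\<close>
    let ?g = "\<lambda>l m. x (v, take l as) * y (awlast v (take l as), take m (drop l as)) *
      z (awlast v (take (l + m) as), drop (l + m) as)"
    have "(x \<otimes>\<^bsub>path_alg\<^esub> y \<otimes>\<^bsub>path_alg\<^esub> z) (v, as) = (\<Sum>k\<le>?n. \<Sum>l\<le>k. ?g l (k - l))"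
      unfolding path_algebra_mult sum_distrib_right
      by (intro sum.cong) (auto simp: min_def drop_take)
    also have "\<dots> = (\<Sum>(l, m)\<in>{(l, m). l + m \<le> ?n}. ?g l m)"
      by (rule sum.triangle_reindex_eq[symmetric])
    also have "{(l, m). l + m \<le> ?n} = (SIGMA l:{..?n}. {..?n - l})" by auto
    also have "(\<Sum>(l, m)\<in>\<dots>. ?g l m) = (\<Sum>l\<le>?n. \<Sum>m\<le>?n - l. ?g l m)" by (rule sum.Sigma[symmetric]) auto
    also have "\<dots> = (x \<otimes>\<^bsub>path_alg\<^esub> (y \<otimes>\<^bsub>path_alg\<^esub> z)) (v, as)"
      unfolding path_algebra_mult sum_distrib_left
      by (intro sum.cong) (auto simp: awlast_append[symmetric] take_add add.commute mult.assoc)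
    finally show "(x \<otimes>\<^bsub>path_alg\<^esub> y \<otimes>\<^bsub>path_alg\<^esub> z) p = (x \<otimes>\<^bsub>path_alg\<^esub> (y \<otimes>\<^bsub>path_alg\<^esub> z)) p"
      by (simp add: p)
  qed
  show "(x \<oplus>\<^bsub>path_alg\<^esub> y) \<otimes>\<^bsub>path_alg\<^esub> z = x \<otimes>\<^bsub>path_alg\<^esub> z \<oplus>\<^bsub>path_alg\<^esub> y \<otimes>\<^bsub>path_alg\<^esub> z"
    by (auto simp: fun_eq_iff path_algebra_mult path_algebra_add distrib_right sum.distrib)
  show "z \<otimes>\<^bsub>path_alg\<^esub> (x \<oplus>\<^bsub>path_alg\<^esub> y) = z \<otimes>\<^bsub>path_alg\<^esub> x \<oplus>\<^bsub>path_alg\<^esub> z \<otimes>\<^bsub>path_alg\<^esub> y"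
    by (auto simp: fun_eq_iff path_algebra_mult path_algebra_add distrib_left sum.distrib)
next
  fix x :: "'a \<times> 'b list \<Rightarrow> 'k"
  assume x: "x \<in> carrier path_alg"
  show "\<exists>y\<in>carrier path_alg. y \<oplus>\<^bsub>path_alg\<^esub> x = \<zero>\<^bsub>path_alg\<^esub>"
    using x by (intro bexI[of _ "\<lambda>p. - x p"])
      (auto simp: path_algebra_carrier path_algebra_add path_algebra_zero)
  show "\<one>\<^bsub>path_alg\<^esub> \<otimes>\<^bsub>path_alg\<^esub> x = x"
  proof
    fix p :: "'a \<times> 'b list"
    obtain v as where p: "p = (v, as)" by (cases p)
    have "(\<one>\<^bsub>path_alg\<^esub> \<otimes>\<^bsub>path_alg\<^esub> x) (v, as) = (\<Sum>k\<le>length as. if k = 0 then x (v, as) else 0)"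
      unfolding path_algebra_mult
      by (rule sum.cong) (use x in \<open>auto simp: path_algebra_one path_algebra_carrier dest!: is_path_verts\<close>)
    then show "(\<one>\<^bsub>path_alg\<^esub> \<otimes>\<^bsub>path_alg\<^esub> x) p = x p" by (simp add: p)
  qed
  show "x \<otimes>\<^bsub>path_alg\<^esub> \<one>\<^bsub>path_alg\<^esub> = x"
  proof
    fix p :: "'a \<times> 'b list"
    obtain v as where p: "p = (v, as)" by (cases p)
    have "(x \<otimes>\<^bsub>path_alg\<^esub> \<one>\<^bsub>path_alg\<^esub>) (v, as) = (\<Sum>k\<le>length as. if k = length as then x (v, as) else 0)"
      unfolding path_algebra_mult
      by (rule sum.cong) (use x in \<open>auto simp: path_algebra_one path_algebra_carrier is_path_def
        dest!: awalk_last_in_verts\<close>)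
    then show "(x \<otimes>\<^bsub>path_alg\<^esub> \<one>\<^bsub>path_alg\<^esub>) p = x p" by (simp add: p)
  qed
qed (fact path_algebra_mult_closed path_algebra_one_closed |
    simp add: path_algebra_carrier path_algebra_zero path_algebra_add add_ac)+

lemma path_algebra_minus:
  assumes "x \<in> carrier path_alg" "y \<in> carrier path_alg"
  shows "x \<ominus>\<^bsub>path_alg\<^esub> y = (\<lambda>p. x p - y p)"
proof -
  interpret ring path_alg by (rule ring_path_algebra)
  have "(\<lambda>p. - y p) \<in> carrier path_alg" using assms(2) by (simp add: path_algebra_carrier)
  then have "\<ominus>\<^bsub>path_alg\<^esub> y = (\<lambda>p. - y p)"
    using assms(2) by (intro minus_equality) (auto simp: path_algebra_add path_algebra_zero)
  then show ?thesis by (simp add: a_minus_def path_algebra_add)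
qed

lemma path_algebra_finsum:
  assumes "finite A" "g \<in> A \<rightarrow> carrier path_alg"
  shows "finsum path_alg g A = (\<lambda>p. \<Sum>k\<in>A. g k p)"
proof -
  interpret ring path_alg by (rule ring_path_algebra)
  show ?thesis using assms
    by (induction A) (auto simp: path_algebra_zero path_algebra_add Pi_iff)
qed

lemma path_elem_closed: "is_path v as \<Longrightarrow> path_elem (v, as) \<in> carrier path_alg"
  by (auto simp: path_algebra_carrier path_elem_def)

text \<open>The second factor is supported on \<open>bs\<close> alone, so by length only the cut
  just before \<open>bs\<close> contributes.\<close>

lemma mult_path_elem_right:
  "(x \<otimes>\<^bsub>path_alg\<^esub> path_elem (w, bs)) (v, as @ bs) = (if awlast v as = w then x (v, as) else 0)"
proof -
  have "(x \<otimes>\<^bsub>path_alg\<^esub> path_elem (w, bs)) (v, as @ bs) =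
      (\<Sum>k\<le>length (as @ bs). if k = length as then if awlast v as = w then x (v, as) else 0 else 0)"
    unfolding path_algebra_mult
  proof (rule sum.cong)
    fix k assume "k \<in> {..length (as @ bs)}"
    then have k: "k \<le> length (as @ bs)" by simp
    show "x (v, take k (as @ bs)) * path_elem (w, bs) (awlast v (take k (as @ bs)), drop k (as @ bs)) =
      (if k = length as then if awlast v as = w then x (v, as) else 0 else 0)"
    proof (cases "k = length as")
      case False
      then have "length (drop k (as @ bs)) \<noteq> length bs" using k by auto
      then have "drop k (as @ bs) \<noteq> bs" by metis
      then show ?thesis using False by (simp add: path_elem_def)
    qed (simp add: path_elem_def)
  qed simp
  then show ?thesis by simp
qed

lemma mult_path_elem_right_support:
  assumes "(x \<otimes>\<^bsub>path_alg\<^esub> path_elem (w, bs)) (v, cs) \<noteq> 0"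
  obtains as where "cs = as @ bs" "awlast v as = w" "x (v, as) \<noteq> 0"
  by (rule path_algebra_mult_support[OF assms]) (auto simp: path_elem_def split: if_splits intro: that)

lemma mult_path_elem_left:
  "(path_elem (v, as) \<otimes>\<^bsub>path_alg\<^esub> x) (v, as @ bs) = x (awlast v as, bs)"
proof -
  have "(path_elem (v, as) \<otimes>\<^bsub>path_alg\<^esub> x) (v, as @ bs) =
      (\<Sum>k\<le>length (as @ bs). if k = length as then x (awlast v as, bs) else 0)"
    unfolding path_algebra_mult
  proof (rule sum.cong)
    fix k assume "k \<in> {..length (as @ bs)}"
    then have k: "k \<le> length (as @ bs)" by simp
    show "path_elem (v, as) (v, take k (as @ bs)) * x (awlast v (take k (as @ bs)), drop k (as @ bs)) =
      (if k = length as then x (awlast v as, bs) else 0)"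
    proof (cases "k = length as")
      case False
      then have "length (take k (as @ bs)) \<noteq> length as" using k by auto
      then have "take k (as @ bs) \<noteq> as" by metis
      then show ?thesis using False by (simp add: path_elem_def)
    qed (simp add: path_elem_def)
  qed simp
  then show ?thesis by simp
qed

lemma mult_path_elem_left_support:
  assumes "(path_elem (w, as) \<otimes>\<^bsub>path_alg\<^esub> x) (v, cs) \<noteq> 0"
  obtains bs where "v = w" "cs = as @ bs" "x (awlast v as, bs) \<noteq> 0"
  by (rule path_algebra_mult_support[OF assms]) (auto simp: path_elem_def split: if_splits intro: that)

lemma path_elem_mult:
  "path_elem (v, as) \<otimes>\<^bsub>path_alg\<^esub> path_elem (awlast v as, bs) =
    (path_elem (v, as @ bs) :: 'a \<times> 'b list \<Rightarrow> 'k::field)"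
proof
  fix p :: "'a \<times> 'b list"
  obtain w cs where p: "p = (w, cs)" by (cases p)
  show "(path_elem (v, as) \<otimes>\<^bsub>path_alg\<^esub> path_elem (awlast v as, bs)) p = (path_elem (v, as @ bs) p :: 'k)"
  proof (cases "w = v \<and> cs = as @ bs")
    case True
    then show ?thesis unfolding p by (auto simp: mult_path_elem_left) (simp add: path_elem_def)
  next
    case False
    have "(path_elem (v, as) \<otimes>\<^bsub>path_alg\<^esub> path_elem (awlast v as, bs)) (w, cs) = (0 :: 'k)"
    proof (rule ccontr)
      assume "\<not> ?thesis"
      then show False
        by (rule mult_path_elem_left_support) (use False in \<open>auto simp: path_elem_def split: if_splits\<close>)
    qed
    then show ?thesis using False by (auto simp: p path_elem_def[of "(v, as @ bs)"])
  qed
qed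

lemma trivial_mult_left: "(path_elem (w, []) \<otimes>\<^bsub>path_alg\<^esub> x) (v, as) = (if v = w then x (v, as) else 0)"
  using mult_path_elem_left[of v "[]" x as] mult_path_elem_left_support[of w "[]" x v as]
  by (cases "v = w") auto

lemma trivial_mult_right:
  "(x \<otimes>\<^bsub>path_alg\<^esub> path_elem (w, [])) (v, as) = (if awlast v as = w then x (v, as) else 0)"
  using mult_path_elem_right[of x w "[]" v as] by simp

text \<open>The ring record carries no K-action. A scalar c is recovered as left multiplication by c
  times a trivial path, which scales the paths starting at that vertex.\<close>

lemma scalar_mult:
  fixes c :: "'k::field"
  assumes v: "v \<in> verts G"
  shows "(\<lambda>p. if p = (v, []) then c else 0) \<in> carrier path_alg"
    and "((\<lambda>p. if p = (v, []) then c else 0) \<otimes>\<^bsub>path_alg\<^esub> x) (w, as) = (if w = v then c * x (w, as) else 0)"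
proof -
  show "(\<lambda>p. if p = (v, []) then c else 0) \<in> carrier path_alg" using v by (simp add: path_algebra_carrier)
  have "((\<lambda>p. if p = (v, []) then c else 0) \<otimes>\<^bsub>path_alg\<^esub> x) (w, as) =
      (\<Sum>k\<le>length as. if k = 0 then (if w = v then c * x (w, as) else 0) else 0)"
    unfolding path_algebra_mult by (rule sum.cong) auto
  then show "((\<lambda>p. if p = (v, []) then c else 0) \<otimes>\<^bsub>path_alg\<^esub> x) (w, as) = (if w = v then c * x (w, as) else 0)"
    by simp
qed

text \<open>A ring ideal is closed under scalars, since scaling a path is left multiplication by a
  multiple of a trivial path. Removing one path of the support at a time gives the claim.\<close>

lemma ideal_support:
  fixes x :: "'a \<times> 'b list \<Rightarrow> 'k::field"
  assumes I: "ideal I path_alg" and x: "x \<in> carrier path_alg"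
    and supp: "\<And>v as. x (v, as) \<noteq> 0 \<Longrightarrow> path_elem (v, as) \<in> I"
  shows "x \<in> I"
proof -
  interpret I: ideal I path_alg by (rule I)
  have "finite {p. x p \<noteq> 0}" using x by (simp add: path_algebra_carrier)
  then show ?thesis using x supp
  proof (induction "{p. x p \<noteq> 0}" arbitrary: x rule: finite_induct)
    case empty
    then have "x = \<zero>\<^bsub>path_alg\<^esub>" by (auto simp: path_algebra_zero)
    then show ?case using I.zero_closed by simp
  next
    case (insert p F)
    obtain v as where p: "p = (v, as)" by (cases p)
    have xp: "x p \<noteq> 0" using insert.hyps by auto
    have path: "is_path v as" using insert.prems(1) xp by (simp add: p path_algebra_carrier)
    have v: "v \<in> verts G" using path by (rule is_path_verts)
    define y where "y = (\<lambda>q. if q = p then 0 else x q)"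
    define s :: "'a \<times> 'b list \<Rightarrow> 'k" where "s = (\<lambda>q. if q = (v, []) then x p else 0)"
    have F: "F = {q. y q \<noteq> 0}" using insert.hyps(2,4) by (auto simp: y_def)
    have "y \<in> carrier path_alg"
      using insert.prems(1) insert.hyps(1) F by (auto simp: path_algebra_carrier y_def split: if_splits)
    then have y: "y \<in> I" using insert.prems(2) by (intro insert.hyps(3)[OF F])
      (auto simp: y_def split: if_splits)
    have "s \<otimes>\<^bsub>path_alg\<^esub> path_elem p \<in> I"
      using scalar_mult(1)[OF v] insert.prems(2) xp unfolding s_def p by (intro I.I_l_closed) auto
    moreover have "x = y \<oplus>\<^bsub>path_alg\<^esub> s \<otimes>\<^bsub>path_alg\<^esub> path_elem p"
      by (auto simp: fun_eq_iff path_algebra_add s_def scalar_mult(2)[OF v] y_def path_elem_def p)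
    ultimately show ?case using additive_subgroup.a_closed[OF ideal.axioms(1)[OF I] y] by simp
  qed
qed

text \<open>A path is the product of its initial part, the middle part and the final part, so a
  middle part in the ideal pulls the whole path in.\<close>

lemma ideal_factor:
  assumes I: "ideal I path_alg" and "is_path v (us @ as @ vs)" and "path_elem (awlast v us, as) \<in> I"
  shows "path_elem (v, us @ as @ vs) \<in> I"
proof -
  interpret I: ideal I path_alg by (rule I)
  let ?w = "awlast v us"
  have "path_elem (v, us) \<otimes>\<^bsub>path_alg\<^esub> (path_elem (?w, as) \<otimes>\<^bsub>path_alg\<^esub> path_elem (awlast ?w as, vs)) \<in> I"
    using assms(2,3) by (intro I.I_l_closed I.I_r_closed path_elem_closed) auto
  then show ?thesis by (simp add: path_elem_mult)
qed

end


section \<open>The ideal of relations of a symmetric special biserial algebra\<close>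

context sb_presentation
begin

abbreviation \<sigma> :: "'a \<Rightarrow> 'a" where
  "\<sigma> \<equiv> sigma Q \<rho>"

lemma rho_arc [simp]: "\<rho> a \<in> arcs Q \<longleftrightarrow> a \<in> arcs Q"
  by (rule permutes_in_image[OF rho_permutes])

lemma rho_funpow_arc [simp]: "(\<rho> ^^ k) a \<in> arcs Q \<longleftrightarrow> a \<in> arcs Q"
  by (induction k) auto

lemma rho_inj: "\<rho> a = \<rho> b \<longleftrightarrow> a = b"
  using permutes_inj[OF rho_permutes] by (auto dest: injD)

lemma out_arc_cases:
  assumes "a \<in> arcs Q"
  obtains b where "b \<in> arcs Q" "tail Q b = head Q a" "b \<noteq> \<rho> a"
    "\<And>c. c \<in> arcs Q \<Longrightarrow> tail Q c = head Q a \<Longrightarrow> c = \<rho> a \<or> c = b"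
proof -
  have "card (out_arcs Q (head Q a)) = 2" using assms by (intro two_out) simp
  then obtain x y where xy: "out_arcs Q (head Q a) = {x, y}" "x \<noteq> y" by (auto simp: card_2_iff)
  have "\<rho> a \<in> out_arcs Q (head Q a)" using assms tail_rho by simp
  then have "\<exists>b. out_arcs Q (head Q a) = {\<rho> a, b} \<and> b \<noteq> \<rho> a" using xy by auto
  then obtain b where b: "out_arcs Q (head Q a) = {\<rho> a, b}" "b \<noteq> \<rho> a" by blast
  have out: "c \<in> out_arcs Q (head Q a) \<longleftrightarrow> c = \<rho> a \<or> c = b" for c using b by auto
  show ?thesis using out b(2) by (intro that[of b]) auto
qed

text \<open>Exactly two arrows leave the head of a, and \<rho> a is one of them, so the description
  defining \<open>sigma\<close> has a unique solution.\<close>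

lemma sigma_arc: "a \<in> arcs Q \<Longrightarrow> \<sigma> a \<in> arcs Q"
  and tail_sigma: "a \<in> arcs Q \<Longrightarrow> tail Q (\<sigma> a) = head Q a"
  and sigma_neq_rho: "a \<in> arcs Q \<Longrightarrow> \<sigma> a \<noteq> \<rho> a"
  and out_arc_rho_sigma: "a \<in> arcs Q \<Longrightarrow> c \<in> arcs Q \<Longrightarrow> tail Q c = head Q a \<Longrightarrow> c = \<rho> a \<or> c = \<sigma> a"
proof -
  have *: "\<sigma> a \<in> arcs Q \<and> tail Q (\<sigma> a) = head Q a \<and> \<sigma> a \<noteq> \<rho> a \<and>
      (\<forall>c\<in>arcs Q. tail Q c = head Q a \<longrightarrow> c = \<rho> a \<or> c = \<sigma> a)" if a: "a \<in> arcs Q" for a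
  proof -
    obtain b where b: "b \<in> arcs Q" "tail Q b = head Q a" "b \<noteq> \<rho> a"
      "\<And>c. c \<in> arcs Q \<Longrightarrow> tail Q c = head Q a \<Longrightarrow> c = \<rho> a \<or> c = b" by (rule out_arc_cases[OF a]) blast
    then have "\<sigma> a = b" unfolding sigma_def by (intro the_equality) auto
    then show ?thesis using b by auto
  qed
  then show "a \<in> arcs Q \<Longrightarrow> \<sigma> a \<in> arcs Q" "a \<in> arcs Q \<Longrightarrow> tail Q (\<sigma> a) = head Q a"
    "a \<in> arcs Q \<Longrightarrow> \<sigma> a \<noteq> \<rho> a"
    "a \<in> arcs Q \<Longrightarrow> c \<in> arcs Q \<Longrightarrow> tail Q c = head Q a \<Longrightarrow> c = \<rho> a \<or> c = \<sigma> a" by auto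
qed

section \<open>Walks along the A-cycles\<close>

definition rho_walk :: "'a \<Rightarrow> nat \<Rightarrow> 'a list" where
  "rho_walk a m = map (\<lambda>k. (\<rho> ^^ k) a) [0..<m]"

text \<open>The length of C_a^f(c), which runs f(c) times around the A-cycle c of a. Walks that go
  on beyond it vanish modulo the relations, whence the name.\<close>

definition socle_length :: "'a \<Rightarrow> nat" where
  "socle_length a = f (orbit \<rho> a) * card (orbit \<rho> a)"

lemma length_rho_walk [simp]: "length (rho_walk a m) = m"
  and nth_rho_walk: "k < m \<Longrightarrow> rho_walk a m ! k = (\<rho> ^^ k) a"
  and rho_walk_0 [simp]: "rho_walk a 0 = []"
  by (simp_all add: rho_walk_def)

lemma rho_walk_add: "rho_walk a (m + k) = rho_walk a m @ rho_walk ((\<rho> ^^ m) a) k"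
proof -
  have "[0..<m + k] = [0..<m] @ map (\<lambda>i. i + m) [0..<k]"
    using upt_add_eq_append[of 0 m k] map_add_upt[of m k] by (simp add: add.commute)
  then show ?thesis by (simp add: rho_walk_def funpow_add)
qed

lemma rho_walk_Suc: "rho_walk a (Suc m) = a # rho_walk (\<rho> a) m"
  using rho_walk_add[of a 1 m] by (simp add: rho_walk_def)

lemma is_path_rho_walk: "a \<in> arcs Q \<Longrightarrow> is_path (tail Q a) (rho_walk a m)"
  by (induction m arbitrary: a) (auto simp: rho_walk_Suc tail_rho[symmetric])

lemma awlast_rho_walk: "a \<in> arcs Q \<Longrightarrow> awlast (tail Q a) (rho_walk a m) = tail Q ((\<rho> ^^ m) a)"
proof (induction m arbitrary: a)
  case (Suc m)
  then have "awlast (tail Q (\<rho> a)) (rho_walk (\<rho> a) m) = tail Q ((\<rho> ^^ m) (\<rho> a))" by simp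
  then show ?case using Suc.prems
    by (auto simp: rho_walk_Suc awalk_verts_conv tail_rho funpow_swap1)
qed simp

lemma permutation_rho: "permutation \<rho>"
  using rho_permutes finite_arcs unfolding permutation_permutes by blast

text \<open>The iterates of a before its first return are distinct and exhaust the orbit, so the
  orbit size is the return time.\<close>

lemma orbit_card:
  assumes "a \<in> arcs Q"
  shows "(\<rho> ^^ card (orbit \<rho> a)) a = a" and "0 < card (orbit \<rho> a)"
proof -
  have self: "a \<in> orbit \<rho> a" by (rule permutation_self_in_orbit[OF permutation_rho])
  have "card (orbit \<rho> a) = funpow_dist1 \<rho> a a"
    unfolding orbit_conv_funpow_dist1[OF self] using inj_on_funpow_dist1[OF self] by (simp add: card_image)
  then show "(\<rho> ^^ card (orbit \<rho> a)) a = a" "0 < card (orbit \<rho> a)" using funpow_dist1_prop[OF self] by auto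
qed

lemma orbit_funpow: "orbit \<rho> ((\<rho> ^^ k) a) = orbit \<rho> a"
proof -
  have "(\<rho> ^^ k) a \<in> orbit \<rho> a"
    by (rule funpow_in_orbit[OF permutation_self_in_orbit[OF permutation_rho]])
  then show ?thesis using orbit_cyclic_eq3 cyclic_on_orbit[OF rho_permutes finite_arcs] by metis
qed

lemma socle_length_funpow [simp]: "socle_length ((\<rho> ^^ k) a) = socle_length a"
  by (simp add: socle_length_def orbit_funpow)

lemma funpow_multiple_orbit: "a \<in> arcs Q \<Longrightarrow> (\<rho> ^^ (m * card (orbit \<rho> a))) a = a"
  by (induction m) (simp_all add: orbit_card funpow_add)

lemma funpow_socle_length [simp]: "a \<in> arcs Q \<Longrightarrow> (\<rho> ^^ socle_length a) a = a"
  by (simp add: socle_length_def funpow_multiple_orbit)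

lemma socle_length_pos: "a \<in> arcs Q \<Longrightarrow> 0 < socle_length a"
  using mult_pos[of a] orbit_card(2)[of a] by (simp add: socle_length_def)

text \<open>A full round returns to a, so repeated rounds form one walk along \<rho>. From here on
  only prefixes and lengths of such walks matter.\<close>

lemma A_cycle_power_eq:
  assumes a: "a \<in> arcs Q"
  shows "A_cycle_power \<rho> f a = rho_walk a (socle_length a)"
proof -
  have "concat (replicate m (A_cycle \<rho> a)) = rho_walk a (m * card (orbit \<rho> a))" for m
  proof (induction m)
    case (Suc m)
    have "A_cycle \<rho> a = rho_walk a (card (orbit \<rho> a))" by (simp add: A_cycle_def rho_walk_def)
    then show ?case using Suc rho_walk_add[of a "card (orbit \<rho> a)"] orbit_card(1)[OF a] by simp
  qed simp
  then show ?thesis by (simp add: A_cycle_power_def socle_length_def)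
qed

abbreviation socle_path :: "'a \<Rightarrow> 'a list" where
  "socle_path a \<equiv> rho_walk a (socle_length a)"

lemma socle_path_hd: "a \<in> arcs Q \<Longrightarrow> hd (socle_path a) = a" "a \<in> arcs Q \<Longrightarrow> socle_path a \<noteq> []"
  using socle_length_pos[of a] by (cases "socle_length a"; simp add: rho_walk_Suc)+

end

text \<open>The dummy parameter fixes the type of the ground field.\<close>

locale sb_field = sb_presentation Q n \<rho> f
  for Q :: "(nat, 'a) pre_digraph" and n \<rho> f +
  fixes ground_field :: "'k::field itself"
begin

abbreviation A :: "(nat \<times> 'a list \<Rightarrow> 'k) ring" where
  "A \<equiv> path_algebra Q"

abbreviation pe :: "nat \<times> 'a list \<Rightarrow> nat \<times> 'a list \<Rightarrow> 'k" where
  "pe \<equiv> path_elem"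

lemma socle_path_closed: "a \<in> arcs Q \<Longrightarrow> pe (tail Q a, socle_path a) \<in> carrier A"
  by (intro path_elem_closed is_path_rho_walk)

definition rels :: "(nat \<times> 'a list \<Rightarrow> 'k) set" where
  "rels = {pe (tail Q a, [a, \<sigma> a]) |a. a \<in> arcs Q} \<union>
     {pe (tail Q a, socle_path a) \<ominus>\<^bsub>A\<^esub> pe (tail Q a, socle_path b) |a b.
        a \<in> arcs Q \<and> b \<in> arcs Q \<and> a \<noteq> b \<and> tail Q a = tail Q b}"

lemma sb_relations_eq: "sb_relations Q \<rho> f = rels"
proof -
  have "arrow_path Q (A_cycle_power \<rho> f a) = pe (tail Q a, socle_path a)" if "a \<in> arcs Q" for a
    using that by (simp add: arrow_path_eq A_cycle_power_eq socle_path_hd)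
  then have "(\<exists>a b. r = arrow_path Q (A_cycle_power \<rho> f a) \<ominus>\<^bsub>A\<^esub> arrow_path Q (A_cycle_power \<rho> f b) \<and>
        a \<in> arcs Q \<and> b \<in> arcs Q \<and> a \<noteq> b \<and> tail Q a = tail Q b) \<longleftrightarrow>
      (\<exists>a b. r = pe (tail Q a, socle_path a) \<ominus>\<^bsub>A\<^esub> pe (tail Q a, socle_path b) \<and>
        a \<in> arcs Q \<and> b \<in> arcs Q \<and> a \<noteq> b \<and> tail Q a = tail Q b)" for r
    by (intro ex_cong1) auto
  moreover have "arrow_path Q [a, \<sigma> a] = pe (tail Q a, [a, \<sigma> a])" for a
    by (simp add: arrow_path_eq)
  ultimately show ?thesis unfolding sb_relations_def rels_def by (simp only:)
qed

abbreviation sb_I :: "(nat \<times> 'a list \<Rightarrow> 'k) set" where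
  "sb_I \<equiv> sb_ideal Q \<rho> f"

lemma rels_closed: "rels \<subseteq> carrier A"
proof -
  interpret ring A by (rule ring_path_algebra)
  have "is_path (tail Q a) [a, \<sigma> a]" if "a \<in> arcs Q" for a
    using that by (simp add: sigma_arc tail_sigma)
  then have "pe (tail Q a, [a, \<sigma> a]) \<in> carrier A" if "a \<in> arcs Q" for a
    using that by (intro path_elem_closed)
  moreover have "pe (tail Q a, socle_path a) \<ominus>\<^bsub>A\<^esub> pe (tail Q a, socle_path b) \<in> carrier A"
    if "a \<in> arcs Q" "b \<in> arcs Q" "tail Q a = tail Q b" for a b
    using socle_path_closed[OF that(1)] socle_path_closed[OF that(2)] that(3) by (simp add: minus_closed)
  ultimately show ?thesis unfolding rels_def by blast
qed

lemma sb_ideal_ideal: "ideal sb_I A"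
  unfolding sb_ideal_def sb_relations_eq by (rule ring.genideal_ideal[OF ring_path_algebra rels_closed])

lemma rels_in_sb_ideal: "x \<in> rels \<Longrightarrow> x \<in> sb_I"
  using ring.genideal_self[OF ring_path_algebra rels_closed] unfolding sb_ideal_def sb_relations_eq by blast

text \<open>Somewhere the path follows a G-cycle for one step; it then contains a generator a
  \<sigma>(a) of the ideal as a subpath.\<close>

definition turns :: "'a list \<Rightarrow> bool" where
  "turns as \<longleftrightarrow> (\<exists>us a vs. as = us @ [a, \<sigma> a] @ vs)"

lemma turning_path_in_ideal:
  assumes "is_path v as" "turns as" shows "pe (v, as) \<in> sb_I"
proof -
  obtain us a vs where as: "as = us @ [a, \<sigma> a] @ vs" using assms(2) by (auto simp: turns_def)
  then have a: "a \<in> arcs Q" "awlast v us = tail Q a" using assms(1) by auto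
  then have "pe (tail Q a, [a, \<sigma> a]) \<in> rels" by (auto simp: rels_def)
  then show ?thesis unfolding as
    using ideal_factor[OF sb_ideal_ideal, of v us "[a, \<sigma> a]" vs] assms(1) rels_in_sb_ideal a(2) by
      (simp add: as)
qed

text \<open>Every arrow can only be followed by its image under \<rho> or under \<sigma>, and the
  latter is excluded.\<close>

lemma non_turning_path:
  assumes "is_path v as" "as \<noteq> []" "\<not> turns as"
  shows "as = rho_walk (hd as) (length as)"
  using assms
proof (induction as arbitrary: v)
  case (Cons a as)
  show ?case
  proof (cases as)
    case Nil then show ?thesis by (simp add: rho_walk_def)
  next
    case (Cons b bs)
    have ab: "a \<in> arcs Q" "b \<in> arcs Q" "tail Q b = head Q a" "is_path (head Q a) as"
      using Cons.prems(1) Cons by auto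
    have "\<not> turns as"
    proof
      assume "turns as"
      then obtain us c vs where "as = us @ [c, \<sigma> c] @ vs" by (auto simp: turns_def)
      then have "a # as = (a # us) @ [c, \<sigma> c] @ vs" by simp
      then show False using Cons.prems(3) unfolding turns_def by blast
    qed
    then have as: "as = rho_walk b (length as)" using Cons.IH[OF ab(4)] Cons by simp
    have "b \<noteq> \<sigma> a"
    proof
      assume "b = \<sigma> a"
      then have "a # as = [] @ [a, \<sigma> a] @ bs" using Cons by simp
      then show False using Cons.prems(3) unfolding turns_def by blast
    qed
    then have "b = \<rho> a" using out_arc_rho_sigma[OF ab(1-3)] by simp
    then show ?thesis using as by (simp add: rho_walk_Suc)
  qed
qed simp

text \<open>Let b be the other arrow starting where a starts. Modulo the relations C_a^f(c) a equals
  C_b^f(c') a, and the latter path turns at its last step. Longer walks contain C_a^f(c) a as an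
  initial part.\<close>

lemma socle_extension_in_ideal:
  assumes a: "a \<in> arcs Q" and m: "socle_length a < m"
  shows "pe (tail Q a, rho_walk a m) \<in> sb_I"
proof -
  interpret I: ideal sb_I A by (rule sb_ideal_ideal)
  have "card (out_arcs Q (tail Q a)) = 2" using a by (intro two_out) simp
  moreover have "a \<in> out_arcs Q (tail Q a)" using a by simp
  ultimately have "\<exists>b. b \<in> out_arcs Q (tail Q a) \<and> b \<noteq> a" unfolding card_2_iff by blast
  then obtain b where "b \<in> out_arcs Q (tail Q a)" "b \<noteq> a" by blast
  then have b: "b \<in> arcs Q" "tail Q b = tail Q a" "b \<noteq> a" by auto
  \<comment> \<open>One step less than the full length, so that the k-th iterate of b is the last
    arrow of its socle path, namely the preimage of b under \<rho>.\<close>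
  obtain k where k: "socle_length b = Suc k" using socle_length_pos[OF b(1)] gr0_implies_Suc by blast
  define c where "c = (\<rho> ^^ k) b"
  have c: "c \<in> arcs Q" "\<rho> c = b" using funpow_socle_length[OF b(1)] b(1) unfolding k c_def by auto
  have last: "socle_path b = rho_walk b k @ [c]"
    unfolding k using rho_walk_add[of b k 1] by (simp add: c_def rho_walk_def)
  have "head Q c = tail Q a" using tail_rho[OF c(1)] c(2) b(2) by simp
  \<comment> \<open>The arrows leaving the head of c are a and b = \<rho> c, hence a is the one
    given by \<sigma>.\<close>
  then have "a = \<sigma> c" using out_arc_rho_sigma[OF c(1) a] c(2) b(3) by auto
  then have "turns (socle_path b @ [a])" unfolding turns_def last
    by (metis append.assoc append_Cons append_Nil)
  moreover have lastb: "awlast (tail Q a) (socle_path b) = tail Q a"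
    using awlast_rho_walk[OF b(1), of "socle_length b"] b by simp
  then have pb: "is_path (tail Q a) (socle_path b @ [a])"
    using is_path_rho_walk[OF b(1), of "socle_length b"] b(2) a wellformed by simp
  ultimately have zero: "pe (tail Q a, socle_path b @ [a]) \<in> sb_I" by (intro turning_path_in_ideal)
  have lasta: "awlast (tail Q a) (socle_path a) = tail Q a"
    using awlast_rho_walk[OF a, of "socle_length a"] a by simp
  have pa: "is_path (tail Q a) [a]" using a wellformed by simp
  have cl: "pe (tail Q a, socle_path a) \<in> carrier A" "pe (tail Q a, socle_path b) \<in> carrier A"
    "pe (tail Q a, [a]) \<in> carrier A"
    using socle_path_closed[OF a] socle_path_closed[OF b(1)] b(2) path_elem_closed[OF pa] by simp_all
  have "pe (tail Q a, socle_path a) \<ominus>\<^bsub>A\<^esub> pe (tail Q a, socle_path b) \<in> rels"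
    unfolding rels_def using a b by (intro UnI2 CollectI exI[of _ a] exI[of _ b]) auto
  then have "(pe (tail Q a, socle_path a) \<ominus>\<^bsub>A\<^esub> pe (tail Q a, socle_path b)) \<otimes>\<^bsub>A\<^esub>
      pe (tail Q a, [a]) \<in> sb_I"
    using cl by (intro I.I_r_closed rels_in_sb_ideal)
  also have "(pe (tail Q a, socle_path a) \<ominus>\<^bsub>A\<^esub> pe (tail Q a, socle_path b)) \<otimes>\<^bsub>A\<^esub>
      pe (tail Q a, [a]) =
      pe (tail Q a, socle_path a @ [a]) \<ominus>\<^bsub>A\<^esub> pe (tail Q a, socle_path b @ [a])"
    using cl path_elem_mult[where 'k = 'k, of "tail Q a" "socle_path a" "[a]"] path_elem_mult[where
      'k = 'k, of "tail Q a" "socle_path b" "[a]"]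
    by (simp add: lasta lastb a_minus_def I.l_distr I.l_minus)
  finally have "(pe (tail Q a, socle_path a @ [a]) \<ominus>\<^bsub>A\<^esub> pe (tail Q a, socle_path b @ [a]))
      \<oplus>\<^bsub>A\<^esub> pe (tail Q a, socle_path b @ [a]) \<in> sb_I"
    using zero additive_subgroup.a_closed[OF ideal.axioms(1)[OF sb_ideal_ideal]] by blast
  moreover have "pe (tail Q a, socle_path a @ [a]) \<in> carrier A"
    using is_path_rho_walk[OF a, of "socle_length a"] pa lasta by (intro path_elem_closed) simp
  moreover have "pe (tail Q a, socle_path b @ [a]) \<in> carrier A" by (rule path_elem_closed[OF pb])
  ultimately have "pe (tail Q a, socle_path a @ [a]) \<in> sb_I"
    by (simp add: a_minus_def I.a_assoc I.l_neg)
  moreover have m': "rho_walk a m = [] @ (socle_path a @ [a]) @ rho_walk (\<rho> a) (m - Suc (socle_length a))"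
  proof -
    have "rho_walk a (socle_length a + Suc (m - Suc (socle_length a))) =
        socle_path a @ a # rho_walk (\<rho> a) (m - Suc (socle_length a))"
      unfolding rho_walk_add funpow_socle_length[OF a] rho_walk_Suc ..
    then show ?thesis using m by simp
  qed
  ultimately show ?thesis unfolding m'
    using is_path_rho_walk[OF a, of m, unfolded m'] by (intro ideal_factor[OF sb_ideal_ideal]) auto
qed

text \<open>A path without turns follows \<rho>, and the sum of all socle lengths bounds each single
  one. This uniform bound makes the radical nilpotent.\<close>

lemma long_path_in_ideal:
  assumes "is_path v as" "(\<Sum>a\<in>arcs Q. socle_length a) < length as"
  shows "pe (v, as) \<in> sb_I"
proof (cases "turns as")
  case True then show ?thesis using assms(1) by (rule turning_path_in_ideal[rotated])
next
  case False
  have ne: "as \<noteq> []" using assms(2) by auto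
  then have hd: "hd as \<in> arcs Q" "v = tail Q (hd as)" using assms(1) by (cases as; simp)+
  have "socle_length (hd as) \<le> (\<Sum>a\<in>arcs Q. socle_length a)" using hd(1) by (intro member_le_sum) auto
  then show ?thesis
    using socle_extension_in_ideal[OF hd(1), of "length as"] assms(2) non_turning_path[OF assms(1)
      ne False] hd(2)
    by simp
qed

text \<open>The symmetrizing form of the algebra, lifted to the path algebra.\<close>

definition sb_form :: "(nat \<times> 'a list \<Rightarrow> 'k) \<Rightarrow> 'k" where
  "sb_form x = (\<Sum>a\<in>arcs Q. x (tail Q a, socle_path a))"

text \<open>Consecutive arrows are related by \<rho>, and \<sigma> b never equals \<rho> b. So the
  form does not see the relations of length two.\<close>

lemma socle_path_not_turning: "a \<in> arcs Q \<Longrightarrow> \<not> turns (socle_path a)"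
proof
  assume a: "a \<in> arcs Q" and "turns (socle_path a)"
  then obtain us b vs where eq: "socle_path a = us @ [b, \<sigma> b] @ vs" by (auto simp: turns_def)
  let ?k = "length us"
  have len: "Suc ?k < socle_length a" using arg_cong[OF eq, of length] by simp
  have "(\<rho> ^^ ?k) a = b" "(\<rho> ^^ Suc ?k) a = \<sigma> b"
    using arg_cong[OF eq, of "\<lambda>as. as ! ?k"] arg_cong[OF eq, of "\<lambda>as. as ! Suc ?k"] len
      nth_rho_walk[of ?k "socle_length a" a] nth_rho_walk[of "Suc ?k" "socle_length a" a]
    by (simp_all add: nth_append)
  then have "b \<in> arcs Q" "\<sigma> b = \<rho> b" using rho_funpow_arc[of ?k a] a by auto
  then show False using sigma_neq_rho by blast
qed

text \<open>A socle path inside another one starts on the same orbit, hence has the same length and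
  fills it completely.\<close>

lemma socle_path_factor:
  assumes a: "a \<in> arcs Q" and b: "b \<in> arcs Q" and eq: "socle_path b = us @ socle_path a @ vs"
  shows "us = [] \<and> vs = [] \<and> b = a"
proof -
  have pos: "0 < socle_length a" by (rule socle_length_pos[OF a])
  have len: "socle_length b = length us + socle_length a + length vs" using arg_cong[OF eq, of length] by simp
  have "(us @ socle_path a @ vs) ! length us = a"
    using pos nth_rho_walk[of 0 "socle_length a" a] by (simp add: nth_append)
  moreover have "socle_path b ! length us = (\<rho> ^^ length us) b" using len pos by (intro nth_rho_walk) simp
  ultimately have ab: "a = (\<rho> ^^ length us) b" using eq by simp
  then have "socle_length a = socle_length b" by simp
  then have "us = []" "vs = []" using len by auto
  then show ?thesis using ab by simp
qed

text \<open>Any prolongation of C_a^f(c) misses every socle path, so only the trivial parts of u and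
  v contribute. The value depends on a only through its source, so the two terms of a commutation
  relation contribute equally.\<close>

lemma sb_form_relation:
  assumes a: "a \<in> arcs Q"
  shows "sb_form ((u \<otimes>\<^bsub>A\<^esub> pe (tail Q a, socle_path a)) \<otimes>\<^bsub>A\<^esub> v) =
    u (tail Q a, []) * v (tail Q a, [])"
proof -
  define p where "p = u \<otimes>\<^bsub>A\<^esub> pe (tail Q a, socle_path a)"
  let ?c = "u (tail Q a, []) * v (tail Q a, [])"
  have "(p \<otimes>\<^bsub>A\<^esub> v) (tail Q b, socle_path b) = (if b = a then ?c else 0)" if b: "b \<in> arcs Q" for b
  proof -
    have "(p \<otimes>\<^bsub>A\<^esub> v) (tail Q b, socle_path b) =
        (\<Sum>k\<le>socle_length b. if k = socle_length b then (if b = a then ?c else 0) else 0)"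
      unfolding path_algebra_mult length_rho_walk
    proof (rule sum.cong)
      fix k assume "k \<in> {..socle_length b}"
      then have k: "k \<le> socle_length b" by simp
      show "p (tail Q b, take k (socle_path b)) * v (awlast (tail Q b) (take k (socle_path b)), drop
        k (socle_path b)) =
        (if k = socle_length b then (if b = a then ?c else 0) else 0)"
      proof (cases "p (tail Q b, take k (socle_path b)) = 0")
        case True
        have "?c = 0" if "k = socle_length b" "b = a"
        proof -
          have "p (tail Q a, [] @ socle_path a) = 0" using True that by simp
          then show ?thesis unfolding p_def mult_path_elem_right by simp
        qed
        then show ?thesis using True by auto
      next
        case False
        then obtain us where us: "take k (socle_path b) = us @ socle_path a" unfolding p_def
          by (rule mult_path_elem_right_support)
        have "socle_path b = us @ socle_path a @ drop k (socle_path b)"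
          using append_take_drop_id[of k "socle_path b"] unfolding us by simp
        \<comment> \<open>A nonzero term would exhibit one socle path inside another, so they
          coincide and the cut is at the very end.\<close>
        from socle_path_factor[OF a b this] have *: "us = []" "drop k (socle_path b) = []" "b = a" by auto
        then have k': "k = socle_length b" using k by simp
        have "p (tail Q a, [] @ socle_path a) = u (tail Q a, [])" unfolding p_def mult_path_elem_right by simp
        then show ?thesis using k' * awlast_rho_walk[OF a, of "socle_length a"] a by simp
      qed
    qed simp
    then show ?thesis by simp
  qed
  then show ?thesis using a by (simp add: sb_form_def p_def)
qed

text \<open>The kernel of the form is not visibly an ideal; the largest ideal inside it is compared
  with the generated ideal instead.\<close>

lemma sb_form_ideal:
  assumes "x \<in> sb_I" shows "sb_form x = 0"
proof -
  interpret R: ring A by (rule ring_path_algebra)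
  have zero: "sb_form \<zero>\<^bsub>A\<^esub> = (0 :: 'k)" by (simp add: sb_form_def path_algebra_zero)
  \<comment> \<open>The largest two-sided ideal on which the form vanishes.\<close>
  define K where "K = {x \<in> carrier A. \<forall>u\<in>carrier A. \<forall>v\<in>carrier A.
    sb_form ((u \<otimes>\<^bsub>A\<^esub> x) \<otimes>\<^bsub>A\<^esub> v) = (0 :: 'k)}"
  have add: "sb_form (x \<oplus>\<^bsub>A\<^esub> y) = sb_form x + sb_form y" for x y :: "nat \<times> 'a list \<Rightarrow> 'k"
    by (simp add: sb_form_def path_algebra_add sum.distrib)
  have minus: "sb_form (x \<ominus>\<^bsub>A\<^esub> y) = sb_form x - sb_form y"
    if "x \<in> carrier A" "y \<in> carrier A" for x y :: "nat \<times> 'a list \<Rightarrow> 'k"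
    by (simp add: sb_form_def path_algebra_minus[OF that] sum_subtractf)
  have K_minus: "x \<ominus>\<^bsub>A\<^esub> y \<in> K"
    if x: "x \<in> carrier A" and y: "y \<in> carrier A"
      and eq: "\<And>u v. u \<in> carrier A \<Longrightarrow> v \<in> carrier A \<Longrightarrow>
        sb_form ((u \<otimes>\<^bsub>A\<^esub> x) \<otimes>\<^bsub>A\<^esub> v) = sb_form ((u \<otimes>\<^bsub>A\<^esub> y) \<otimes>\<^bsub>A\<^esub> v)" for x y
  proof -
    have "(u \<otimes>\<^bsub>A\<^esub> (x \<ominus>\<^bsub>A\<^esub> y)) \<otimes>\<^bsub>A\<^esub> v =
        ((u \<otimes>\<^bsub>A\<^esub> x) \<otimes>\<^bsub>A\<^esub> v) \<ominus>\<^bsub>A\<^esub> ((u \<otimes>\<^bsub>A\<^esub> y) \<otimes>\<^bsub>A\<^esub> v)"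
      if "u \<in> carrier A" "v \<in> carrier A" for u v
      using that x y by (simp add: a_minus_def R.l_distr R.r_distr R.l_minus R.r_minus)
    then show ?thesis using x y eq by (simp add: K_def minus)
  qed
  have "ideal K A"
  proof (rule idealI)
    show "subgroup K (add_monoid A)"
    proof (rule R.add.subgroupI)
      show "K \<noteq> {}" by (auto simp: K_def zero intro!: exI[of _ "\<zero>\<^bsub>A\<^esub>"])
      show "\<ominus>\<^bsub>A\<^esub> x \<in> K" if "x \<in> K" for x
      proof -
        have "\<zero>\<^bsub>A\<^esub> \<ominus>\<^bsub>A\<^esub> x \<in> K"
          using that by (intro K_minus) (auto simp: K_def zero)
        then show ?thesis using that by (simp add: a_minus_def K_def)
      qed
    qed (auto simp: K_def R.l_distr R.r_distr add)
    show "a \<otimes>\<^bsub>A\<^esub> x \<in> K" if "x \<in> K" "a \<in> carrier A" for x a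
      using that by (auto simp: K_def R.m_assoc[symmetric])
    show "x \<otimes>\<^bsub>A\<^esub> a \<in> K" if "x \<in> K" "a \<in> carrier A" for x a
    proof -
      have "(u \<otimes>\<^bsub>A\<^esub> (x \<otimes>\<^bsub>A\<^esub> a)) \<otimes>\<^bsub>A\<^esub> v = (u \<otimes>\<^bsub>A\<^esub> x) \<otimes>\<^bsub>A\<^esub> (a \<otimes>\<^bsub>A\<^esub> v)"
        if "u \<in> carrier A" "v \<in> carrier A" for u v
        using that \<open>x \<in> K\<close> \<open>a \<in> _\<close> by (simp add: K_def R.m_assoc)
      then show ?thesis using that by (simp add: K_def)
    qed
  qed (rule R.ring_axioms)
  moreover have "rels \<subseteq> K"
  proof
    fix r :: "nat \<times> 'a list \<Rightarrow> 'k" assume "r \<in> rels"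
    then consider a where "a \<in> arcs Q" "r = pe (tail Q a, [a, \<sigma> a])"
      | a b where "a \<in> arcs Q" "b \<in> arcs Q" "tail Q a = tail Q b"
          "r = pe (tail Q a, socle_path a) \<ominus>\<^bsub>A\<^esub> pe (tail Q a, socle_path b)"
      by (auto simp: rels_def)
    then show "r \<in> K"
    proof cases
      case 1
      \<comment> \<open>A nonzero coefficient at a socle path would make this path contain a
        \<sigma>(a), but socle paths do not turn.\<close>
      have "((u \<otimes>\<^bsub>A\<^esub> r) \<otimes>\<^bsub>A\<^esub> v) (tail Q b, socle_path b) = 0" if b: "b \<in> arcs Q" for u v b
      proof (rule ccontr)
        assume "\<not> ?thesis"
        then obtain as bs where s: "socle_path b = as @ bs" and "(u \<otimes>\<^bsub>A\<^esub> r) (tail Q b, as) \<noteq> 0"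
          by (rule path_algebra_mult_support)
        then obtain us where "as = us @ [a, \<sigma> a]" unfolding 1(2) by (auto elim: mult_path_elem_right_support)
        then have "turns (socle_path b)" unfolding s turns_def by auto
        then show False using socle_path_not_turning[OF b] by blast
      qed
      moreover have "r \<in> carrier A" using rels_closed \<open>r \<in> rels\<close> by blast
      ultimately show ?thesis by (simp add: K_def sb_form_def)
    next
      case 2
      show ?thesis unfolding 2(4)
        using socle_path_closed[OF 2(1)] socle_path_closed[OF 2(2)] sb_form_relation[OF 2(1)]
          sb_form_relation[OF 2(2)] 2(3)
        by (intro K_minus) simp_all
    qed
  qed
  ultimately have "sb_I \<subseteq> K" unfolding sb_ideal_def sb_relations_eq by (rule R.genideal_minimal)
  then have "x \<in> K" using assms by blast
  then have "sb_form ((\<one>\<^bsub>A\<^esub> \<otimes>\<^bsub>A\<^esub> x) \<otimes>\<^bsub>A\<^esub> \<one>\<^bsub>A\<^esub>) = 0" "x \<in> carrier A"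
    unfolding K_def using R.one_closed by blast+
  then show ?thesis by simp
qed

text \<open>The coefficient of \<open>x\<close> at a proper initial part of a socle path is the value of the form on the
  product of the complementary part with \<open>x\<close>.\<close>

lemma sb_form_nondegenerate:
  assumes x: "x \<in> carrier A" and il: "i \<noteq> l"
    and supp: "\<And>v as. x (v, as) \<noteq> 0 \<Longrightarrow> v = i \<and> awlast v as = l"
    and zero: "\<And>as. is_path l as \<Longrightarrow> awlast l as = i \<Longrightarrow> pe (l, as) \<otimes>\<^bsub>A\<^esub> x \<in> sb_I"
  shows "x \<in> sb_I"
proof (rule ideal_support[OF sb_ideal_ideal x])
  fix v as assume nz: "x (v, as) \<noteq> 0"
  have path: "is_path v as" using x nz by (simp add: path_algebra_carrier)
  have v: "v = i" "awlast i as = l" using supp[OF nz] by auto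
  have ne: "as \<noteq> []" using v il by auto
  define a where "a = hd as"
  have a: "a \<in> arcs Q" "tail Q a = i" using path ne v by (cases as; simp add: a_def)+
  define m where "m = length as"
  show "pe (v, as) \<in> sb_I"
  proof (cases "turns as")
    case True then show ?thesis by (rule turning_path_in_ideal[OF path])
  next
    case False
    then have as: "as = rho_walk a m" using non_turning_path[OF path ne] by (simp add: a_def m_def)
    consider "m < socle_length a" | "m = socle_length a" | "socle_length a < m" by linarith
    then show ?thesis
    proof cases
      case 1
      \<comment> \<open>The arrow that continues \<open>as\<close> along its A-cycle. The walk of
        length k from b closes up at i and, followed by \<open>as\<close>, is the socle path of
        b.\<close>
      define b where "b = (\<rho> ^^ m) a"
      define k where "k = socle_length a - m"
      have k: "0 < k" "m + k = socle_length a" using 1 by (auto simp: k_def)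
      have b: "b \<in> arcs Q" using a by (simp add: b_def)
      have tb: "tail Q b = l" using awlast_rho_walk[OF a(1), of m] v a by (simp add: as b_def)
      have bk: "(\<rho> ^^ k) b = a"
        using funpow_socle_length[OF a(1)] unfolding b_def k(2)[symmetric]
        by (metis add.commute comp_apply funpow_add)
      have sb: "socle_path b = rho_walk b k @ as"
      proof -
        have "socle_length b = k + m" using k by (simp add: b_def)
        then show ?thesis using rho_walk_add[of b k m] by (simp add: bk as)
      qed
      have q: "is_path l (rho_walk b k)" "awlast l (rho_walk b k) = i"
        using is_path_rho_walk[OF b, of k] awlast_rho_walk[OF b, of k] tb bk a by simp_all
      \<comment> \<open>Socle paths are told apart by their first arrow, so after multiplying by the
        nonempty walk from b only that of b can carry a coefficient. The form thus returns x(i, as),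
        which must vanish against the choice of \<open>as\<close>.\<close>
      have "(pe (l, rho_walk b k) \<otimes>\<^bsub>A\<^esub> x) (tail Q c, socle_path c) = (if c = b then x (i, as) else 0)"
        if c: "c \<in> arcs Q" for c
      proof (cases "c = b")
        case True
        have "(pe (l, rho_walk b k) \<otimes>\<^bsub>A\<^esub> x) (l, rho_walk b k @ as) = x (i, as)"
          unfolding mult_path_elem_left q(2) ..
        then show ?thesis using True by (simp add: sb tb)
      next
        case False
        have "(pe (l, rho_walk b k) \<otimes>\<^bsub>A\<^esub> x) (tail Q c, socle_path c) = 0"
        proof (rule ccontr)
          assume "\<not> ?thesis"
          then obtain bs where "socle_path c = rho_walk b k @ bs" by (rule mult_path_elem_left_support)
          then have "hd (socle_path c) = hd (rho_walk b k @ bs)" by simp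
          also have "\<dots> = b" using k(1) by (cases k) (simp_all add: rho_walk_Suc)
          finally show False using False socle_path_hd[OF c] by simp
        qed
        then show ?thesis using False by simp
      qed
      then have "sb_form (pe (l, rho_walk b k) \<otimes>\<^bsub>A\<^esub> x) = x (i, as)"
        using b by (simp add: sb_form_def)
      then show ?thesis using sb_form_ideal[OF zero[OF q]] nz v by simp
    next
      \<comment> \<open>A full socle path is closed, which is excluded by i \<noteq> l.\<close>
      case 2
      have "l = i" using awlast_rho_walk[OF a(1), of m] v a by (simp add: as 2)
      then show ?thesis using il by simp
    next
      case 3
      then show ?thesis using socle_extension_in_ideal[OF a(1)] a v by (simp add: as)
    qed
  qed
qed

end


section \<open>Symmetric special biserial algebras\<close>

lemma right_mult_hom:
  assumes R: "ring R" and e: "e \<in> carrier R" "e \<otimes>\<^bsub>R\<^esub> e = e" and e': "e' \<in> carrier R" "e' \<otimes>\<^bsub>R\<^esub> e' = e'"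
    and a: "a \<in> carrier R" "a \<otimes>\<^bsub>R\<^esub> e' = a"
  shows "right_mult R a \<in> lmod_hom R (left_ideal_module R e) (left_ideal_module R e')"
proof -
  interpret ring R by (rule R)
  show ?thesis
  proof (rule lmod_homI)
    fix x assume "x \<in> carrier (left_ideal_module R e)"
    then have x: "x 0 \<in> carrier R" using carrier_left_ideal[OF R e] by blast
    then show "right_mult R a x \<in> carrier (left_ideal_module R e')"
      using a e' by (simp add: carrier_left_ideal[OF R e'] right_mult_def m_assoc)
    show "right_mult R a (b \<odot>\<^bsub>left_ideal_module R e\<^esub> x) = b \<odot>\<^bsub>left_ideal_module R e'\<^esub> right_mult R a x"
      if "b \<in> carrier R" for b
      using x a that by (simp add: left_ideal_module_def right_mult_def m_assoc)
    fix y assume "y \<in> carrier (left_ideal_module R e)"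
    then have "y 0 \<in> carrier R" using carrier_left_ideal[OF R e] by blast
    then show "right_mult R a (x \<oplus>\<^bsub>left_ideal_module R e\<^esub> y) =
        right_mult R a x \<oplus>\<^bsub>left_ideal_module R e'\<^esub> right_mult R a y"
      using x a by (simp add: left_ideal_module_def right_mult_def l_distr)
  qed
qed

lemma right_mult2_hom:
  assumes R: "ring R" and e: "e \<in> carrier R" "e \<otimes>\<^bsub>R\<^esub> e = e" and e1: "e1 \<in> carrier R" "e1 \<otimes>\<^bsub>R\<^esub> e1 = e1"
    and e2: "e2 \<in> carrier R" "e2 \<otimes>\<^bsub>R\<^esub> e2 = e2"
    and a: "a \<in> carrier R" "a \<otimes>\<^bsub>R\<^esub> e = a" and b: "b \<in> carrier R" "b \<otimes>\<^bsub>R\<^esub> e = b"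
  shows "right_mult2 R a b \<in> lmod_hom R (dsum2 (left_ideal_module R e1) (left_ideal_module R e2))
    (left_ideal_module R e)"
proof -
  let ?D = "dsum2 (left_ideal_module R e1) (left_ideal_module R e2)"
  have "coord 0 \<in> lmod_hom R ?D (left_ideal_module R e1)" "coord 1 \<in> lmod_hom R ?D (left_ideal_module R e2)"
    using coord_hom[of 0 "{0, 1}" R "two (left_ideal_module R e1) (left_ideal_module R e2)"]
      coord_hom[of 1 "{0, 1}" R "two (left_ideal_module R e1) (left_ideal_module R e2)"] by simp_all
  from lmod_hom_addf[OF left_module_left_ideal[OF R e(1)]
      lmod_hom_compose[OF this(1) right_mult_hom[OF R e1 e a]] lmod_hom_compose[OF this(2)
        right_mult_hom[OF R e2 e b]]]
  show ?thesis by (simp add: right_mult2_def[abs_def] right_mult_def left_ideal_module_def)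
qed

context sb_presentation
begin

text \<open>Two loops use up both outgoing and both incoming arrows of i, so i is cut off from every
  other vertex, against connectedness and n \<ge> 2. This makes the loop in the definition of the
  complex unique and the other incoming arrow start elsewhere.\<close>

lemma no_two_loops:
  assumes n: "n \<ge> 2" and a: "a \<in> loops_at Q i" and b: "b \<in> loops_at Q i"
  shows "a = b"
proof (rule ccontr)
  assume ne: "a \<noteq> b"
  have ab: "a \<in> arcs Q" "b \<in> arcs Q" "tail Q a = i" "tail Q b = i" "head Q a = i" "head Q b = i"
    using a b by (auto simp: loops_at_def)
  have i: "i \<in> verts Q" using ab(1,3) by auto
  have two: "S = {a, b}" if "card S = 2" "a \<in> S" "b \<in> S" for S
    using that ne by (auto simp: card_2_iff)
  have out: "out_arcs Q i = {a, b}" by (rule two[OF two_out[OF i]]) (use ab in auto)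
  have inn: "in_arcs Q i = {a, b}" by (rule two[OF two_in[OF i]]) (use ab in auto)
  \<comment> \<open>Connectedness refers to the symmetric closure, so neighbours along incoming
    arrows have to be considered as well.\<close>
  have loop: "v = i" if "(i, v) \<in> parcs (mk_symmetric Q)" for v
  proof -
    from that obtain c where c: "c \<in> arcs Q" "tail Q c = i \<and> head Q c = v \<or> head Q c = i \<and> tail Q c = v"
      by (auto simp: mk_symmetric_def)
    then have "c \<in> out_arcs Q i \<or> c \<in> in_arcs Q i" by auto
    then have "c = a \<or> c = b" using out inn by auto
    then show ?thesis using c(2) ab by auto
  qed
  have "\<exists>j\<in>verts Q. j \<noteq> i"
    using n unfolding verts_eq by (intro bexI[of _ "if i = 1 then 2 else 1"]) auto
  then obtain j where j: "j \<in> verts Q" "j \<noteq> i" by blast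
  have "i \<rightarrow>\<^sup>*\<^bsub>with_proj (mk_symmetric Q)\<^esub> j"
    using connected_Q i j(1) by (auto simp: connected_def strongly_connected_def mk_symmetric_def)
  then have "(i, j) \<in> (arcs_ends (with_proj (mk_symmetric Q)))\<^sup>*" by (rule reachable_rtranclI)
  then have "j = i" by (induction rule: rtrancl_induct) (auto dest: loop)
  then show False using j(2) by simp
qed

lemma in_arcs_pair:
  assumes "b \<in> in_arcs Q i"
  obtains c where "c \<noteq> b" "in_arcs Q i = {b, c}"
proof -
  have "i \<in> verts Q" using assms by auto
  then have "card (in_arcs Q i) = 2" by (rule two_in)
  then obtain x y where xy: "in_arcs Q i = {x, y}" "x \<noteq> y" by (auto simp: card_2_iff)
  then show ?thesis using assms that[of x] that[of y] by (cases "b = x") auto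
qed

end

context sb_field
begin

abbreviation Lam :: "('a, 'k) sb_elt ring" where
  "Lam \<equiv> sb_algebra Q \<rho> f"

abbreviation cl :: "(nat \<times> 'a list \<Rightarrow> 'k) \<Rightarrow> ('a, 'k) sb_elt" where
  "cl \<equiv> sb_class Q \<rho> f"

abbreviation el :: "nat \<Rightarrow> ('a, 'k) sb_elt" where
  "el v \<equiv> cl (pe (v, []))"

section \<open>The quotient algebra, its idempotents and its radical filtration\<close>

lemma ring_A: "ring A" by (rule ring_path_algebra)

lemma ring_Lam: "ring Lam"
  unfolding sb_algebra_def by (rule ideal.quotient_is_ring[OF sb_ideal_ideal])

lemma cl_hom: "ring_hom_ring A Lam cl"
proof -
  have "cl = (+>\<^bsub>A\<^esub>) sb_I" by (simp add: sb_class_def fun_eq_iff)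
  then show ?thesis unfolding sb_algebra_def using ideal.rcos_ring_hom_ring[OF sb_ideal_ideal] by simp
qed

interpretation A: ring A by (rule ring_A)
interpretation Lam: ring Lam by (rule ring_Lam)
interpretation cl: ring_hom_ring A Lam cl by (rule cl_hom)
interpretation sb_I: ideal sb_I A by (rule sb_ideal_ideal)

lemma Lam_elem: "a \<in> carrier Lam \<longleftrightarrow> (\<exists>x\<in>carrier A. a = cl x)"
  by (auto simp: sb_algebra_def FactRing_def A_RCOSETS_def' sb_class_def)

lemma zero_Lam: "\<zero>\<^bsub>Lam\<^esub> = sb_I" by (simp add: sb_algebra_def FactRing_def)

lemma cl_zero_iff: "x \<in> carrier A \<Longrightarrow> cl x = \<zero>\<^bsub>Lam\<^esub> \<longleftrightarrow> x \<in> sb_I"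
  unfolding zero_Lam sb_class_def
  using sb_I.rcos_const_imp_mem A.a_rcos_zero[OF sb_ideal_ideal] by blast

lemma cl_eqI:
  assumes "x \<in> carrier A" "y \<in> carrier A" "x \<ominus>\<^bsub>A\<^esub> y \<in> sb_I"
  shows "cl x = cl y"
proof -
  have "cl x \<ominus>\<^bsub>Lam\<^esub> cl y = \<zero>\<^bsub>Lam\<^esub>"
    using assms cl_zero_iff[of "x \<ominus>\<^bsub>A\<^esub> y"] by (simp add: a_minus_def)
  then show ?thesis
    using assms Lam.minus_equality[of "cl x" "\<ominus>\<^bsub>Lam\<^esub> cl y"] by (simp add: a_minus_def)
qed

lemma pe_trivial_closed: "v \<in> verts Q \<Longrightarrow> pe (v, []) \<in> carrier A"
  by (rule path_elem_closed) simp

lemma el_closed: "v \<in> verts Q \<Longrightarrow> el v \<in> carrier Lam"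
  using pe_trivial_closed by simp

lemma el_idem: "v \<in> verts Q \<Longrightarrow> el v \<otimes>\<^bsub>Lam\<^esub> el v = el v"
  using pe_trivial_closed[of v] path_elem_mult[where 'k = 'k, of v "[]" "[]"] by (simp flip: cl.hom_mult)

lemma el_sum: "finsum Lam el (verts Q) = \<one>\<^bsub>Lam\<^esub>"
proof -
  have "finsum Lam (\<lambda>v. cl (pe (v, []))) S = cl (finsum A (\<lambda>v. pe (v, [])) S)" if "S \<subseteq> verts Q" for S
  proof -
    have "finite S" using that finite_verts by (rule finite_subset)
    then show ?thesis using that
    proof (induction S)
      case (insert v S)
      then have "(\<lambda>v. pe (v, [])) \<in> S \<rightarrow> carrier A" "pe (v, []) \<in> carrier A" using pe_trivial_closed by auto
      moreover have "(\<lambda>v. cl (pe (v, []))) \<in> S \<rightarrow> carrier Lam" using insert.prems by (auto intro!: el_closed)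
      ultimately show ?case using insert by simp
    qed simp
  qed
  moreover have "finsum A (\<lambda>v. pe (v, [])) (verts Q) = \<one>\<^bsub>A\<^esub>"
  proof -
    have "(\<Sum>v\<in>verts Q. pe (v, []) p) = \<one>\<^bsub>A\<^esub> p" for p
    proof -
      obtain w as where p: "p = (w, as)" by (cases p)
      have "(\<Sum>v\<in>verts Q. pe (v, []) p) = (\<Sum>v\<in>verts Q. if v = w then if as = [] then 1 else 0 else 0)"
        by (rule sum.cong) (auto simp: path_elem_def p)
      then show ?thesis by (simp add: path_algebra_one p)
    qed
    then show ?thesis using pe_trivial_closed by (subst path_algebra_finsum) (auto simp: fun_eq_iff)
  qed
  ultimately show ?thesis by simp
qed

text \<open>The m-th power of the arrow ideal, in terms of supports. It is enough that some
  representative avoids shorter paths, so multiplicativity is just addition of lengths.\<close>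

definition rad :: "nat \<Rightarrow> ('a, 'k) sb_elt set" where
  "rad m = cl ` {x \<in> carrier A. \<forall>v as. x (v, as) \<noteq> 0 \<longrightarrow> m \<le> length as}"

text \<open>One more than the bound beyond which all paths lie in the ideal.\<close>

definition rad_length :: nat where
  "rad_length = Suc (\<Sum>a\<in>arcs Q. socle_length a)"

lemma rad_closed: "a \<in> rad m \<Longrightarrow> a \<in> carrier Lam"
  by (auto simp: rad_def)

lemma rad_mono: "m \<le> k \<Longrightarrow> rad k \<subseteq> rad m"
  unfolding rad_def by (intro image_mono Collect_mono) (meson le_trans)

lemma rad_0: "rad 0 = carrier Lam"
  using Lam_elem by (auto simp: rad_def)

lemma rad_zero: "\<zero>\<^bsub>Lam\<^esub> \<in> rad m"
  unfolding rad_def by (rule image_eqI[of _ _ "\<zero>\<^bsub>A\<^esub>"])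
    (auto simp: path_algebra_zero[symmetric], simp add: path_algebra_zero)

lemma rad_add: "a \<in> rad m \<Longrightarrow> b \<in> rad m \<Longrightarrow> a \<oplus>\<^bsub>Lam\<^esub> b \<in> rad m"
proof -
  assume "a \<in> rad m" "b \<in> rad m"
  then obtain x y where xy: "x \<in> carrier A" "\<forall>v as. x (v, as) \<noteq> 0 \<longrightarrow> m \<le> length as" "a = cl x"
    "y \<in> carrier A" "\<forall>v as. y (v, as) \<noteq> 0 \<longrightarrow> m \<le> length as" "b = cl y" by (auto simp: rad_def)
  have "x (v, as) \<noteq> 0 \<or> y (v, as) \<noteq> 0" if "(x \<oplus>\<^bsub>A\<^esub> y) (v, as) \<noteq> 0" for v as
    using that by (auto simp: path_algebra_add)
  then show ?thesis unfolding rad_def using xy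
    by (intro image_eqI[of _ _ "x \<oplus>\<^bsub>A\<^esub> y"]) (simp_all, blast)
qed

lemma rad_minus: "a \<in> rad m \<Longrightarrow> \<ominus>\<^bsub>Lam\<^esub> a \<in> rad m"
proof -
  assume "a \<in> rad m"
  then obtain x where x: "x \<in> carrier A" "\<forall>v as. x (v, as) \<noteq> 0 \<longrightarrow> m \<le> length as" "a = cl x" by
    (auto simp: rad_def)
  have "\<ominus>\<^bsub>A\<^esub> x = (\<lambda>p. - x p)"
    using path_algebra_minus[of "\<zero>\<^bsub>A\<^esub>" x] x(1) by (simp add: a_minus_def) (simp add: path_algebra_zero)
  then have "\<forall>v as. (\<ominus>\<^bsub>A\<^esub> x) (v, as) \<noteq> 0 \<longrightarrow> m \<le> length as" using x(2) by simp
  moreover have "\<ominus>\<^bsub>Lam\<^esub> a = cl (\<ominus>\<^bsub>A\<^esub> x)" using x by simp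
  ultimately show ?thesis unfolding rad_def using x(1) by (intro image_eqI[of _ _ "\<ominus>\<^bsub>A\<^esub> x"]) auto
qed

lemma rad_mult: "a \<in> rad p \<Longrightarrow> b \<in> rad q \<Longrightarrow> a \<otimes>\<^bsub>Lam\<^esub> b \<in> rad (p + q)"
proof -
  assume "a \<in> rad p" "b \<in> rad q"
  then obtain x y where xy: "x \<in> carrier A" "\<forall>v as. x (v, as) \<noteq> 0 \<longrightarrow> p \<le> length as" "a = cl x"
    "y \<in> carrier A" "\<forall>v as. y (v, as) \<noteq> 0 \<longrightarrow> q \<le> length as" "b = cl y" by (auto simp: rad_def)
  have "p + q \<le> length cs" if nz: "(x \<otimes>\<^bsub>A\<^esub> y) (v, cs) \<noteq> 0" for v cs
  proof (rule path_algebra_mult_support[OF nz])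
    fix as bs assume "cs = as @ bs" "x (v, as) \<noteq> 0" "y (awlast v as, bs) \<noteq> 0"
    then show ?thesis using xy(2,5) add_mono[of p "length as" q "length bs"] by simp
  qed
  then show ?thesis unfolding rad_def using xy by (intro image_eqI[of _ _ "x \<otimes>\<^bsub>A\<^esub> y"]) simp_all
qed

lemma rad_nilpotent: "rad rad_length \<subseteq> {\<zero>\<^bsub>Lam\<^esub>}"
proof
  fix a assume "a \<in> rad rad_length"
  then obtain x where x: "x \<in> carrier A" "\<forall>v as. x (v, as) \<noteq> 0 \<longrightarrow> rad_length \<le> length as" "a = cl x"
    by (auto simp: rad_def)
  have "x \<in> sb_I"
  proof (rule ideal_support[OF sb_ideal_ideal x(1)])
    fix v as assume nz: "x (v, as) \<noteq> 0"
    then show "pe (v, as) \<in> sb_I"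
      using x by (intro long_path_in_ideal) (auto simp: rad_length_def Suc_le_eq path_algebra_carrier)
  qed
  then show "a \<in> {\<zero>\<^bsub>Lam\<^esub>}" using x cl_zero_iff by simp
qed

text \<open>Multiplying any representative by both idempotents moves it into the corner of the path
  algebra, so supports can be inspected instead of cosets.\<close>

lemma corner:
  assumes "a \<in> carrier Lam" "v \<in> verts Q" "w \<in> verts Q" "el v \<otimes>\<^bsub>Lam\<^esub> a = a" "a \<otimes>\<^bsub>Lam\<^esub> el w = a"
  obtains x where "x \<in> carrier A" "a = cl x" "\<And>u as. x (u, as) \<noteq> 0 \<Longrightarrow> u = v \<and> awlast u as = w"
proof -
  obtain y where y: "y \<in> carrier A" "a = cl y" using assms(1) Lam_elem by blast
  let ?x = "pe (v, []) \<otimes>\<^bsub>A\<^esub> y \<otimes>\<^bsub>A\<^esub> pe (w, [])"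
  show ?thesis
  proof (rule that[of ?x])
    show "?x \<in> carrier A" "a = cl ?x" using y assms pe_trivial_closed by simp_all
    show "u = v \<and> awlast u as = w" if "?x (u, as) \<noteq> 0" for u as
      using that by (auto simp: trivial_mult_left trivial_mult_right split: if_splits)
  qed
qed

lemma corner_right:
  assumes "x \<in> carrier A" "w \<in> verts Q" "\<And>u as. x (u, as) \<noteq> 0 \<Longrightarrow> awlast u as = w"
  shows "cl x \<otimes>\<^bsub>Lam\<^esub> el w = cl x"
proof -
  have "x \<otimes>\<^bsub>A\<^esub> pe (w, []) = x" using assms(3) by (auto simp: fun_eq_iff trivial_mult_right)
  then show ?thesis using assms pe_trivial_closed cl.hom_mult by metis
qed

lemma corner_left:
  assumes "x \<in> carrier A" "v \<in> verts Q" "\<And>u as. x (u, as) \<noteq> 0 \<Longrightarrow> u = v"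
  shows "el v \<otimes>\<^bsub>Lam\<^esub> cl x = cl x"
proof -
  have "pe (v, []) \<otimes>\<^bsub>A\<^esub> x = x" using assms(3) by (auto simp: fun_eq_iff trivial_mult_left)
  then show ?thesis using assms pe_trivial_closed cl.hom_mult by metis
qed

text \<open>Newton iteration: a left inverse up to \<open>r\<close> is improved to one up to \<open>r\<^sup>2\<close>.\<close>

lemma left_inverse:
  assumes v: "v \<in> verts Q" and a: "a \<in> carrier Lam" "el v \<otimes>\<^bsub>Lam\<^esub> a = a" "a \<otimes>\<^bsub>Lam\<^esub> el v = a" and "a \<notin> rad 1"
  shows "\<exists>b\<in>carrier Lam. b \<otimes>\<^bsub>Lam\<^esub> a = el v"
proof -
  obtain x where x: "x \<in> carrier A" "a = cl x" and supp: "\<And>u as. x (u, as) \<noteq> 0 \<Longrightarrow> u = v \<and> awlast u as = v"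
    by (rule corner[OF a(1) v v a(2,3)]) blast
  define c where "c = x (v, [])"
  \<comment> \<open>The constant term: without it a would have a representative supported on paths
    of positive length.\<close>
  have c: "c \<noteq> 0"
  proof
    assume "c = 0"
    then have "1 \<le> length as" if "x (u, as) \<noteq> 0" for u as
      using that supp[OF that] by (cases as) (auto simp: c_def)
    then have "a \<in> rad 1" unfolding rad_def x(2) using x(1) by blast
    then show False using \<open>a \<notin> rad 1\<close> by simp
  qed
  have "\<exists>b\<in>carrier Lam. \<exists>r\<in>rad (Suc m). el v \<otimes>\<^bsub>Lam\<^esub> r = r \<and> r \<otimes>\<^bsub>Lam\<^esub> el v = r \<and>
      b \<otimes>\<^bsub>Lam\<^esub> a = el v \<oplus>\<^bsub>Lam\<^esub> r" for m
  proof (induction m)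
    case 0
    \<comment> \<open>Start of the iteration: dividing by the constant term makes a equal to e_v up
      to paths of positive length.\<close>
    define s where "s = (\<lambda>p :: nat \<times> 'a list. if p = (v, []) then inverse c else 0)"
    define y where "y = (\<lambda>p. if p = (v, []) then 0 else inverse c * x p)"
    have s: "s \<in> carrier A" unfolding s_def by (rule scalar_mult(1)[OF v])
    have y: "y \<in> carrier A" using x(1) by (auto simp: path_algebra_carrier y_def intro: finite_subset)
    have ys: "u = v \<and> awlast u as = v \<and> as \<noteq> []" if "y (u, as) \<noteq> 0" for u as
    proof -
      have "x (u, as) \<noteq> 0" "(u, as) \<noteq> (v, [])" using that by (auto simp: y_def split: if_splits)
      then show ?thesis using supp by auto
    qed
    have "s \<otimes>\<^bsub>A\<^esub> x = pe (v, []) \<oplus>\<^bsub>A\<^esub> y"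
    proof
      fix p :: "nat \<times> 'a list"
      obtain u as where p: "p = (u, as)" by (cases p)
      have "x (u, as) = 0 \<or> u = v" using supp by blast
      then show "(s \<otimes>\<^bsub>A\<^esub> x) p = (pe (v, []) \<oplus>\<^bsub>A\<^esub> y) p"
        using c by (auto simp: p s_def scalar_mult(2)[OF v] path_algebra_add y_def path_elem_def c_def)
    qed
    then have "cl s \<otimes>\<^bsub>Lam\<^esub> a = el v \<oplus>\<^bsub>Lam\<^esub> cl y"
      using s x y pe_trivial_closed[OF v] by (metis cl.hom_mult cl.hom_add)
    moreover have "cl y \<in> rad (Suc 0)" unfolding rad_def using y ys by (force simp: Suc_le_eq)
    moreover have "el v \<otimes>\<^bsub>Lam\<^esub> cl y = cl y" "cl y \<otimes>\<^bsub>Lam\<^esub> el v = cl y"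
      using corner_left[OF y v] corner_right[OF y v] ys by auto
    ultimately show ?case using s by (intro bexI[of _ "cl s"] bexI[of _ "cl y"]) auto
  next
    case (Suc m)
    then obtain b r where b: "b \<in> carrier Lam" and r: "r \<in> rad (Suc m)" "el v \<otimes>\<^bsub>Lam\<^esub> r = r" "r \<otimes>\<^bsub>Lam\<^esub> el v = r"
      and ba: "b \<otimes>\<^bsub>Lam\<^esub> a = el v \<oplus>\<^bsub>Lam\<^esub> r" by blast
    note rc = rad_closed[OF r(1)] and ec = el_closed[OF v]
    \<comment> \<open>From (e - r)(e + r) = e - r^2; the square lies at least one level deeper than
      r.\<close>
    let ?r = "\<ominus>\<^bsub>Lam\<^esub> (r \<otimes>\<^bsub>Lam\<^esub> r)"
    have "((el v \<ominus>\<^bsub>Lam\<^esub> r) \<otimes>\<^bsub>Lam\<^esub> b) \<otimes>\<^bsub>Lam\<^esub> a = (el v \<oplus>\<^bsub>Lam\<^esub> \<ominus>\<^bsub>Lam\<^esub> r) \<otimes>\<^bsub>Lam\<^esub> (el v \<oplus>\<^bsub>Lam\<^esub> r)"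
      using rc ec b a(1) ba by (simp add: a_minus_def Lam.m_assoc)
    also have "\<dots> = (el v \<oplus>\<^bsub>Lam\<^esub> \<ominus>\<^bsub>Lam\<^esub> r) \<oplus>\<^bsub>Lam\<^esub> (r \<oplus>\<^bsub>Lam\<^esub> ?r)"
      using rc ec r(2,3) el_idem[OF v] by (simp add: Lam.l_distr Lam.r_distr Lam.l_minus)
    also have "\<dots> = el v \<oplus>\<^bsub>Lam\<^esub> ((\<ominus>\<^bsub>Lam\<^esub> r \<oplus>\<^bsub>Lam\<^esub> r) \<oplus>\<^bsub>Lam\<^esub> ?r)"
      using rc ec by (simp add: Lam.a_assoc)
    also have "\<dots> = el v \<oplus>\<^bsub>Lam\<^esub> ?r" using rc by (simp add: Lam.l_neg)
    finally have "((el v \<ominus>\<^bsub>Lam\<^esub> r) \<otimes>\<^bsub>Lam\<^esub> b) \<otimes>\<^bsub>Lam\<^esub> a = el v \<oplus>\<^bsub>Lam\<^esub> ?r" .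
    moreover have "?r \<in> rad (Suc (Suc m))"
      using rad_minus[OF rad_mult[OF r(1) r(1)]] rad_mono[of "Suc (Suc m)" "Suc m + Suc m"] by auto
    moreover have "el v \<otimes>\<^bsub>Lam\<^esub> ?r = ?r" "?r \<otimes>\<^bsub>Lam\<^esub> el v = ?r"
      using rc ec r(2,3) by (simp_all add: Lam.l_minus Lam.r_minus Lam.m_assoc) (simp_all flip: Lam.m_assoc)
    ultimately show ?case using b rc ec
      by (intro bexI[of _ "(el v \<ominus>\<^bsub>Lam\<^esub> r) \<otimes>\<^bsub>Lam\<^esub> b"] bexI[of _ ?r]) auto
  qed
  \<comment> \<open>By now the error lies so deep in the filtration that it is zero.\<close>
  from this[of rad_length] obtain b r where b: "b \<in> carrier Lam" "b \<otimes>\<^bsub>Lam\<^esub> a = el v \<oplus>\<^bsub>Lam\<^esub> r"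
    and "r \<in> rad (Suc rad_length)" by blast
  then have "r = \<zero>\<^bsub>Lam\<^esub>" using rad_mono[of rad_length "Suc rad_length"] rad_nilpotent by auto
  then show ?thesis using b el_closed[OF v] by auto
qed

text \<open>Between different vertices there is no trivial path, so the corner lies in
  \<open>rad 1\<close> and the hypothesis forces v = w.\<close>

lemma local_corner:
  assumes v: "v \<in> verts Q" "w \<in> verts Q"
    and a: "a \<in> carrier Lam" "el v \<otimes>\<^bsub>Lam\<^esub> a = a" "a \<otimes>\<^bsub>Lam\<^esub> el w = a" "a \<notin> rad 1"
  shows "v = w \<and> (\<exists>b\<in>carrier Lam. b \<otimes>\<^bsub>Lam\<^esub> a = el w)"
proof -
  obtain x where x: "x \<in> carrier A" "a = cl x" "\<And>u as. x (u, as) \<noteq> 0 \<Longrightarrow> u = v \<and> awlast u as = w"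
    by (rule corner[OF a(1) v a(2,3)]) blast
  have "v = w"
  proof (rule ccontr)
    assume "v \<noteq> w"
    then have "1 \<le> length as" if "x (u, as) \<noteq> 0" for u as
      using x(3)[OF that] by (cases as) auto
    then have "a \<in> rad 1" unfolding rad_def x(2) using x(1) by blast
    then show False using a(4) by simp
  qed
  then show ?thesis using left_inverse v a by simp
qed

sublocale local_idempotents Lam "verts Q" el rad rad_length
  by unfold_locales
    (fact finite_verts el_closed el_idem el_sum rad_0 rad_zero rad_add rad_mult rad_nilpotent local_corner)+

text \<open>Only annihilation by the classes of paths from l to i enters; it is what the form test
  on a corner representative of y asks for.\<close>

lemma Lam_nondegenerate:
  assumes i: "i \<in> verts Q" and l: "l \<in> verts Q - {i}" and y: "y \<in> carrier Lam"
    "el i \<otimes>\<^bsub>Lam\<^esub> y = y" "y \<otimes>\<^bsub>Lam\<^esub> el l = y"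
    and ann: "\<And>a. a \<in> carrier Lam \<Longrightarrow> el l \<otimes>\<^bsub>Lam\<^esub> a = a \<Longrightarrow> a \<otimes>\<^bsub>Lam\<^esub> el i = a \<Longrightarrow> a \<otimes>\<^bsub>Lam\<^esub> y = \<zero>\<^bsub>Lam\<^esub>"
  shows "y = \<zero>\<^bsub>Lam\<^esub>"
proof -
  obtain x where x: "x \<in> carrier A" "y = cl x" "\<And>u as. x (u, as) \<noteq> 0 \<Longrightarrow> u = i \<and> awlast u as = l"
    using corner[OF y(1) i _ y(2,3)] l by auto
  have "x \<in> sb_I"
  proof (rule sb_form_nondegenerate[OF x(1)])
    show "i \<noteq> l" using l by auto
    show "v = i \<and> awlast v as = l" if "x (v, as) \<noteq> 0" for v as
      using x(3)[OF that] by auto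
    fix as assume as: "is_path l as" "awlast l as = i"
    have q: "pe (l, as) \<in> carrier A" by (rule path_elem_closed[OF as(1)])
    have "cl (pe (l, as)) \<otimes>\<^bsub>Lam\<^esub> y = \<zero>\<^bsub>Lam\<^esub>"
    proof (rule ann)
      show "el l \<otimes>\<^bsub>Lam\<^esub> cl (pe (l, as)) = cl (pe (l, as))"
        using l by (intro corner_left[OF q]) (auto simp: path_elem_def split: if_splits)
      show "cl (pe (l, as)) \<otimes>\<^bsub>Lam\<^esub> el i = cl (pe (l, as))"
        using as(2) by (intro corner_right[OF q i]) (auto simp: path_elem_def split: if_splits)
    qed (use q in simp)
    then show "pe (l, as) \<otimes>\<^bsub>A\<^esub> x \<in> sb_I" using q x cl_zero_iff[of "pe (l, as) \<otimes>\<^bsub>A\<^esub> x"] by simp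
  qed
  then show ?thesis using x cl_zero_iff by simp
qed

text \<open>Right division by the path \<open>bs\<close>: the product of \<open>strip bs x\<close>
  with \<open>bs\<close> is the part of x supported on paths ending in \<open>bs\<close>.\<close>

definition strip :: "'a list \<Rightarrow> (nat \<times> 'a list \<Rightarrow> 'k) \<Rightarrow> nat \<times> 'a list \<Rightarrow> 'k" where
  "strip bs x = (\<lambda>(v, as). x (v, as @ bs))"

lemma strip:
  assumes x: "x \<in> carrier A" and bs: "bs \<noteq> []"
  shows "strip bs x \<in> carrier A"
    and "strip bs x (v, as) \<noteq> 0 \<Longrightarrow> awlast v as = tail Q (hd bs)"
    and "(strip bs x \<otimes>\<^bsub>A\<^esub> pe (tail Q (hd bs), bs)) (v, cs) = (if \<exists>as. cs = as @ bs then x (v, cs) else 0)"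
proof -
  have path: "is_path v (as @ bs)" if "strip bs x (v, as) \<noteq> 0" for v as
  proof -
    have "x (v, as @ bs) \<noteq> 0" using that by (simp add: strip_def)
    then show ?thesis using x unfolding path_algebra_carrier by blast
  qed
  have "finite {p. x p \<noteq> 0}" using x by (simp add: path_algebra_carrier)
  then have "finite ((\<lambda>(v, as). (v, as @ bs)) -` {p. x p \<noteq> 0})"
    by (intro finite_vimageI) (auto simp: inj_on_def)
  moreover have "{p. strip bs x p \<noteq> 0} = (\<lambda>(v, as). (v, as @ bs)) -` {p. x p \<noteq> 0}"
    by (auto simp: strip_def)
  ultimately show "strip bs x \<in> carrier A" using path by (simp add: path_algebra_carrier)
  show last: "awlast v as = tail Q (hd bs)" if "strip bs x (v, as) \<noteq> 0" for v as
    using path[OF that] bs by (cases bs) auto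
  show "(strip bs x \<otimes>\<^bsub>A\<^esub> pe (tail Q (hd bs), bs)) (v, cs) = (if \<exists>as. cs = as @ bs then x (v, cs) else 0)"
  proof (cases "\<exists>as. cs = as @ bs")
    case True
    then obtain as where cs: "cs = as @ bs" by blast
    show ?thesis using last[of v as] unfolding cs mult_path_elem_right by (auto simp: strip_def)
  next
    case False
    have "(strip bs x \<otimes>\<^bsub>A\<^esub> pe (tail Q (hd bs), bs)) (v, cs) = 0"
    proof (rule ccontr)
      assume "\<not> ?thesis"
      then show False by (rule mult_path_elem_right_support) (use False in blast)
    qed
    then show ?thesis using False by simp
  qed
qed

abbreviation arr :: "'a list \<Rightarrow> ('a, 'k) sb_elt" where
  "arr bs \<equiv> cl (arrow_path Q bs)"

lemma arr:
  assumes "bs \<noteq> []" "is_path (tail Q (hd bs)) bs" "awlast (tail Q (hd bs)) bs = i" "i \<in> verts Q"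
  shows "arr bs \<in> carrier Lam" "arr bs \<otimes>\<^bsub>Lam\<^esub> el i = arr bs"
proof -
  have c: "arrow_path Q bs \<in> carrier A" unfolding arrow_path_eq by (rule path_elem_closed[OF assms(2)])
  then show "arr bs \<in> carrier Lam" by simp
  show "arr bs \<otimes>\<^bsub>Lam\<^esub> el i = arr bs"
    by (rule corner_right[OF c assms(4)])
      (use assms(3) in \<open>auto simp: arrow_path_eq path_elem_def split: if_splits\<close>)
qed

lemma strip_class:
  assumes "x \<in> carrier A" "bs \<noteq> []" "tail Q (hd bs) \<in> verts Q"
  shows "cl (strip bs x) \<in> carrier Lam" "cl (strip bs x) \<otimes>\<^bsub>Lam\<^esub> el (tail Q (hd bs)) = cl (strip bs x)"
  using strip[OF assms(1,2)] corner_right[OF strip(1)[OF assms(1,2)] assms(3)] by auto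

lemma sb_proj_eq: "sb_proj Q \<rho> f j = proj j"
  by (simp add: sb_proj_def trivial_path_eq)

text \<open>A criterion for both cases with two summands: d is an approximation as soon as every
  path from another vertex to i ends in \<open>b1\<close> or in \<open>b2\<close> or is a relation.
  Different last arrows ensure that no path is counted twice.\<close>

lemma tilting_two:
  assumes i: "i \<in> verts Q"
    and b1: "b1 \<noteq> []" "is_path (tail Q (hd b1)) b1" "awlast (tail Q (hd b1)) b1 = i" "tail Q (hd b1) \<noteq> i"
    and b2: "b2 \<noteq> []" "is_path (tail Q (hd b2)) b2" "awlast (tail Q (hd b2)) b2 = i" "tail Q (hd b2) \<noteq> i"
    and last: "last b1 \<noteq> last b2"
    and ends: "\<And>v cs. v \<noteq> i \<Longrightarrow> is_path v cs \<Longrightarrow> awlast v cs = i \<Longrightarrow> \<nexists>as. cs = as @ b1 \<Longrightarrow> \<nexists>as. cs = as @ b2 \<Longrightarrow>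
      pe (v, cs) \<in> sb_I"
    and diag: "sb_T_diag Q \<rho> f i = two_term (dsum2 (proj (tail Q (hd b1))) (proj (tail Q (hd b2)))) (proj i)
      (right_mult2 Lam (arr b1) (arr b2))"
  shows "tilting_complex Lam (sb_tilt Q n \<rho> f i)"
proof -
  let ?j1 = "tail Q (hd b1)" and ?j2 = "tail Q (hd b2)"
  let ?P = "dsum2 (proj ?j1) (proj ?j2)" and ?d = "right_mult2 Lam (arr b1) (arr b2)"
  have j: "?j1 \<in> verts Q - {i}" "?j2 \<in> verts Q - {i}" using b1 b2 is_path_verts by auto
  note a1 = arr[OF b1(1-3) i] and a2 = arr[OF b2(1-3) i]
  have basis: "has_basis Lam (el ` (verts Q - {i})) (proj l)" if "l \<in> verts Q - {i}" for l
    using has_basis_mono[OF proj_basis[of l]] that by auto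
  interpret approximation Lam "verts Q" el rad rad_length i ?P ?d
  proof
    show "has_basis Lam (el ` (verts Q - {i})) ?P"
      using basis j by (intro has_basis_dsum ring_Lam) auto
    show "stalk ?P \<in> S" if "triangulated_subcat Lam S" "\<And>l. l \<in> verts Q - {i} \<Longrightarrow> stalk (proj l) \<in> S" for S
      using that(2)[OF j(1)] that(2)[OF j(2)] basis[OF j(1)] basis[OF j(2)]
      by (intro dsum_stalk_in_triangulated[OF ring_Lam that(1)]) auto
    show "?d \<in> lmod_hom Lam ?P (proj i)"
      using j i el_closed el_idem a1 a2 by (intro right_mult2_hom ring_Lam) auto
    show "(\<lambda>_. a) \<in> ?d ` carrier ?P"
      if l: "l \<in> verts Q - {i}" and a: "a \<in> carrier Lam" "el l \<otimes>\<^bsub>Lam\<^esub> a = a" "a \<otimes>\<^bsub>Lam\<^esub> el i = a" for l a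
    proof -
      obtain x where x: "x \<in> carrier A" "a = cl x" and supp: "\<And>u as. x (u, as) \<noteq> 0 \<Longrightarrow> u = l \<and> awlast u as = i"
        using corner[OF a(1) _ i a(2,3)] l by auto
      let ?p1 = "arrow_path Q b1" and ?p2 = "arrow_path Q b2"
      have p: "?p1 \<in> carrier A" "?p2 \<in> carrier A"
        unfolding arrow_path_eq using b1(2) b2(2) by (auto intro: path_elem_closed)
      note x1 = strip(1)[OF x(1) b1(1)] and x2 = strip(1)[OF x(1) b2(1)]
      \<comment> \<open>The part of x whose paths end in one of the two prescribed ones; it visibly
        factors through d, and the rest lies in the ideal by \<open>ends\<close>.\<close>
      let ?y = "strip b1 x \<otimes>\<^bsub>A\<^esub> ?p1 \<oplus>\<^bsub>A\<^esub> strip b2 x \<otimes>\<^bsub>A\<^esub> ?p2"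
      have y: "?y \<in> carrier A" using x1 x2 p by simp
      have "x \<ominus>\<^bsub>A\<^esub> ?y \<in> sb_I"
      proof (rule ideal_support[OF sb_ideal_ideal])
        show "x \<ominus>\<^bsub>A\<^esub> ?y \<in> carrier A" using x y by simp
        fix v cs assume nz: "(x \<ominus>\<^bsub>A\<^esub> ?y) (v, cs) \<noteq> 0"
        \<comment> \<open>Otherwise such a coefficient would be subtracted twice.\<close>
        have "\<not> ((\<exists>as. cs = as @ b1) \<and> (\<exists>as. cs = as @ b2))"
          using last b1(1) b2(1) by (metis last_appendR)
        then have "x (v, cs) \<noteq> 0 \<and> (\<nexists>as. cs = as @ b1) \<and> (\<nexists>as. cs = as @ b2)"
          using nz unfolding path_algebra_minus[OF x(1) y] unfolding path_algebra_add arrow_path_eq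
            strip(3)[OF x(1) b1(1)] strip(3)[OF x(1) b2(1)] by (auto split: if_splits)
        then show "pe (v, cs) \<in> sb_I"
          using supp[of v cs] l x(1) by (intro ends) (auto simp: path_algebra_carrier)
      qed
      then have a': "a = cl (strip b1 x) \<otimes>\<^bsub>Lam\<^esub> arr b1 \<oplus>\<^bsub>Lam\<^esub> cl (strip b2 x) \<otimes>\<^bsub>Lam\<^esub> arr b2"
        using cl_eqI[OF x(1) y] x x1 x2 p by simp
      let ?z = "pack {0, 1} (two (\<lambda>_. cl (strip b1 x)) (\<lambda>_. cl (strip b2 x)))"
      have z: "?z \<in> carrier ?P"
        by (rule pack_closed)
          (use j strip_class[OF x(1) b1(1)] strip_class[OF x(1) b2(1)] in \<open>auto simp: carrier_proj\<close>)
      have "(\<lambda>_. a) = ?d ?z" unfolding a' right_mult2_def by (simp add: fun_eq_iff)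
      then show ?thesis using z by blast
    qed
  qed (use i Lam_nondegenerate in auto)
  have "sb_tilt Q n \<rho> f i = T"
    unfolding sb_tilt_def verts_eq[symmetric]
    by (intro arg_cong[of _ _ "dsum_cplx (verts Q)"] ext) (simp only: sb_T_def summand_def diag sb_proj_eq)
  then show ?thesis using tilting by simp
qed

text \<open>The same criterion for a single prescribed path, as needed when the loop at i is an
  A-cycle by itself.\<close>

lemma tilting_one:
  assumes i: "i \<in> verts Q"
    and b: "b \<noteq> []" "is_path (tail Q (hd b)) b" "awlast (tail Q (hd b)) b = i" "tail Q (hd b) \<noteq> i"
    and ends: "\<And>v cs. v \<noteq> i \<Longrightarrow> is_path v cs \<Longrightarrow> awlast v cs = i \<Longrightarrow> \<nexists>as. cs = as @ b \<Longrightarrow> pe (v, cs) \<in> sb_I"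
    and diag: "sb_T_diag Q \<rho> f i = two_term (proj (tail Q (hd b))) (proj i) (right_mult Lam (arr b))"
  shows "tilting_complex Lam (sb_tilt Q n \<rho> f i)"
proof -
  let ?j = "tail Q (hd b)"
  let ?P = "proj ?j" and ?d = "right_mult Lam (arr b)"
  have j: "?j \<in> verts Q - {i}" using b is_path_verts by auto
  note a = arr[OF b(1-3) i]
  interpret approximation Lam "verts Q" el rad rad_length i ?P ?d
  proof
    show "has_basis Lam (el ` (verts Q - {i})) ?P"
      using has_basis_mono[OF proj_basis[of ?j]] j by auto
    show "stalk ?P \<in> S" if "triangulated_subcat Lam S" "\<And>l. l \<in> verts Q - {i} \<Longrightarrow> stalk (proj l) \<in> S" for S
      by (rule that(2)[OF j])
    show "?d \<in> lmod_hom Lam ?P (proj i)"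
      using j i el_closed el_idem a by (intro right_mult_hom ring_Lam) auto
    show "(\<lambda>_. a) \<in> ?d ` carrier ?P"
      if l: "l \<in> verts Q - {i}" and a: "a \<in> carrier Lam" "el l \<otimes>\<^bsub>Lam\<^esub> a = a" "a \<otimes>\<^bsub>Lam\<^esub> el i = a" for l a
    proof -
      obtain x where x: "x \<in> carrier A" "a = cl x" and supp: "\<And>u as. x (u, as) \<noteq> 0 \<Longrightarrow> u = l \<and> awlast u as = i"
        using corner[OF a(1) _ i a(2,3)] l by auto
      let ?p = "arrow_path Q b"
      have p: "?p \<in> carrier A" unfolding arrow_path_eq using b(2) by (rule path_elem_closed)
      note x1 = strip(1)[OF x(1) b(1)]
      let ?y = "strip b x \<otimes>\<^bsub>A\<^esub> ?p"
      have y: "?y \<in> carrier A" using x1 p by simp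
      have "x \<ominus>\<^bsub>A\<^esub> ?y \<in> sb_I"
      proof (rule ideal_support[OF sb_ideal_ideal])
        show "x \<ominus>\<^bsub>A\<^esub> ?y \<in> carrier A" using x y by simp
        fix v cs assume nz: "(x \<ominus>\<^bsub>A\<^esub> ?y) (v, cs) \<noteq> 0"
        then have "x (v, cs) \<noteq> 0 \<and> (\<nexists>as. cs = as @ b)"
          unfolding path_algebra_minus[OF x(1) y] unfolding arrow_path_eq strip(3)[OF x(1) b(1)] by
            (auto split: if_splits)
        then show "pe (v, cs) \<in> sb_I"
          using supp[of v cs] l x(1) by (intro ends) (auto simp: path_algebra_carrier)
      qed
      then have a': "a = cl (strip b x) \<otimes>\<^bsub>Lam\<^esub> arr b"
        using cl_eqI[OF x(1) y] x x1 p by simp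
      let ?z = "\<lambda>_. cl (strip b x)"
      have z: "?z \<in> carrier ?P" using j strip_class[OF x(1) b(1)] by (auto simp: carrier_proj)
      have "(\<lambda>_. a) = ?d ?z" unfolding a' right_mult_def by (simp add: fun_eq_iff)
      then show ?thesis using z by blast
    qed
  qed (use i Lam_nondegenerate in auto)
  have "sb_tilt Q n \<rho> f i = T"
    unfolding sb_tilt_def verts_eq[symmetric]
    by (intro arg_cong[of _ _ "dsum_cplx (verts Q)"] ext) (simp only: sb_T_def summand_def diag sb_proj_eq)
  then show ?thesis using tilting by simp
qed

section \<open>The three cases in the definition of the complex at i\<close>

lemma path_end_arc:
  assumes "is_path v cs" "cs \<noteq> []" "awlast v cs = i"
  shows "last cs \<in> in_arcs Q i"
  using assms by (cases cs rule: rev_cases) auto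

theorem tilting_sb:
  assumes n: "n \<ge> 2" and i: "i \<in> verts Q"
  shows "tilting_complex Lam (sb_tilt Q n \<rho> f i)"
proof -
  consider (1) "\<exists>a\<in>loops_at Q i. \<rho> a = a"
    | (2) "\<not> (\<exists>a\<in>loops_at Q i. \<rho> a = a)" "\<exists>a\<in>loops_at Q i. \<sigma> a = a"
    | (3) "\<not> (\<exists>a\<in>loops_at Q i. \<rho> a = a)" "\<not> (\<exists>a\<in>loops_at Q i. \<sigma> a = a)" by blast
  then show ?thesis
  proof cases
    case 1
    then obtain a where a: "a \<in> loops_at Q i" "\<rho> a = a" by blast
    then have a': "a \<in> arcs Q" "tail Q a = i" "head Q a = i" by (auto simp: loops_at_def)
    have "a \<in> in_arcs Q i" using a' by simp
    then obtain b where b: "b \<noteq> a" "in_arcs Q i = {a, b}" by (rule in_arcs_pair)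
    then have b': "b \<in> arcs Q" "head Q b = i" by auto
    have tb: "tail Q b \<noteq> i" using no_two_loops[OF n a(1), of b] b(1) b' by (auto simp: loops_at_def)
    \<comment> \<open>\<rho> is injective and already sends the loop to itself, so b is followed by
      the loop on a G-cycle.\<close>
    have "\<rho> b \<noteq> a" using rho_inj[of b a] a(2) b(1) by simp
    then have sb: "\<sigma> b = a" using out_arc_rho_sigma[OF b'(1) a'(1)] a' b' by auto
    have the_a: "(THE a. a \<in> loops_at Q i \<and> \<rho> a = a) = a"
      using a no_two_loops[OF n] by (intro the_equality) auto
    have the_b: "(THE c. c \<in> in_arcs Q i \<and> c \<noteq> a \<and> \<sigma> c = a) = b"
      using b sb by (intro the_equality) auto
    show ?thesis
    proof (rule tilting_one[OF i, of "[b]"])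
      show "sb_T_diag Q \<rho> f i = two_term (proj (tail Q (hd [b]))) (proj i) (right_mult Lam (arr [b]))"
        using 1 unfolding sb_T_diag_def Let_def the_a the_b by (simp add: sb_proj_eq)
      fix v cs assume v: "v \<noteq> i" and path: "is_path v cs" "awlast v cs = i" and nb: "\<nexists>as. cs = as @ [b]"
      have ne: "cs \<noteq> []" using v path by auto
      have "last cs \<noteq> b" using nb ne by (metis append_butlast_last_id)
      then have "last cs = a" using path_end_arc[OF path(1) ne path(2)] b(2) by auto
      then have "a \<in> set cs" using ne last_in_set by metis
      \<comment> \<open>The loop may be repeated without turning, so the turn occurs where the path
        first enters it. The arrow before that point ends at i and is not the loop, hence it is
        b.\<close>
      then obtain us vs where cs: "cs = us @ a # vs" "a \<notin> set us" by (meson split_list_first)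
      have us: "us \<noteq> []" using path(1) v a' unfolding cs by (cases us) auto
      have pus: "is_path v us" "awlast v us = i" using path(1) a' unfolding cs by auto
      have "last us \<in> in_arcs Q i" by (rule path_end_arc[OF pus(1) us pus(2)])
      moreover have "last us \<noteq> a" using cs(2) us last_in_set by metis
      ultimately have "last us = b" using b(2) by auto
      then have "cs = butlast us @ [b, \<sigma> b] @ vs" using us sb unfolding cs
        by (metis append.assoc append_Cons append_Nil append_butlast_last_id)
      then have "turns cs" unfolding turns_def by blast
      then show "pe (v, cs) \<in> sb_I" by (rule turning_path_in_ideal[OF path(1)])
    qed (use b' tb i in auto)
  next
    case 2
    then obtain a where a: "a \<in> loops_at Q i" "\<sigma> a = a" by blast
    then have a': "a \<in> arcs Q" "tail Q a = i" "head Q a = i" by (auto simp: loops_at_def)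
    have "a \<in> in_arcs Q i" using a' by simp
    then obtain b where b: "b \<noteq> a" "in_arcs Q i = {a, b}" by (rule in_arcs_pair)
    then have b': "b \<in> arcs Q" "head Q b = i" by auto
    have tb: "tail Q b \<noteq> i" using no_two_loops[OF n a(1), of b] b(1) b' by (auto simp: loops_at_def)
    have ra: "\<rho> a \<noteq> a" using sigma_neq_rho[OF a'(1)] a(2) by simp
    \<comment> \<open>The preimage of the loop under \<rho> ends at i. It is not the loop, on which
      \<sigma> and not \<rho> is the identity, so it is b.\<close>
    obtain c where c: "c \<in> arcs Q" "\<rho> c = a"
      using permutes_surj[OF rho_permutes] rho_arc a'(1) by (metis surjD)
    then have "c \<in> in_arcs Q i" using tail_rho[OF c(1)] a' by simp
    then have rb: "\<rho> b = a" using b(2) c(2) ra by auto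
    have the_a: "(THE a. a \<in> loops_at Q i \<and> \<sigma> a = a) = a"
      using a no_two_loops[OF n] by (intro the_equality) auto
    have the_b: "(THE c. c \<in> in_arcs Q i \<and> c \<noteq> a \<and> \<rho> c = a) = b"
      using b rb by (intro the_equality) auto
    show ?thesis
    proof (rule tilting_two[OF i, of "[b]" "[b, a]"])
      show "sb_T_diag Q \<rho> f i = two_term (dsum2 (proj (tail Q (hd [b]))) (proj (tail Q (hd [b, a])))) (proj i)
          (right_mult2 Lam (arr [b]) (arr [b, a]))"
        using 2 unfolding sb_T_diag_def Let_def the_a the_b by (simp add: sb_proj_eq)
      fix v cs assume v: "v \<noteq> i" and path: "is_path v cs" "awlast v cs = i"
        and nb: "\<nexists>as. cs = as @ [b]" and nba: "\<nexists>as. cs = as @ [b, a]"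
      have ne: "cs \<noteq> []" using v path by auto
      have "last cs \<noteq> b" using nb ne by (metis append_butlast_last_id)
      then have "last cs = a" using path_end_arc[OF path(1) ne path(2)] b(2) by auto
      then obtain us where cs: "cs = us @ [a]" using ne by (metis append_butlast_last_id)
      have us: "us \<noteq> []" using path(1) v a' unfolding cs by (cases us) auto
      have pus: "is_path v us" "awlast v us = i" using path(1) a' unfolding cs by auto
      \<comment> \<open>Before the final loop comes b or the loop again. The first possibility is a
        path ending in \<open>[b, a]\<close>, the second contains the turn a \<sigma>(a) = a
        a.\<close>
      have "last us \<in> in_arcs Q i" by (rule path_end_arc[OF pus(1) us pus(2)])
      moreover have us': "us = butlast us @ [last us]" using us by simp
      then have "last us \<noteq> b" using nba unfolding cs by (metis append.assoc append_Cons append_Nil)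
      ultimately have "last us = a" using b(2) by auto
      then have "cs = butlast us @ [a, \<sigma> a] @ []" using us' a(2) unfolding cs
        by (metis append.assoc append_Cons append_Nil)
      then have "turns cs" unfolding turns_def by blast
      then show "pe (v, cs) \<in> sb_I" by (rule turning_path_in_ideal[OF path(1)])
    qed (use b b' a' tb i in auto)
  next
    case 3
    let ?Q = "\<lambda>(b1, b2). b1 \<noteq> b2 \<and> b1 \<in> in_arcs Q i \<and> b2 \<in> in_arcs Q i"
    obtain x y where xy: "in_arcs Q i = {x, y}" "x \<noteq> y" using two_in[OF i] unfolding card_2_iff by blast
    have "?Q (x, y)" unfolding xy(1) using xy(2) by simp
    then have "\<exists>p. ?Q p" by blast
    then have "?Q (SOME p. ?Q p)" by (rule someI_ex)
    moreover obtain b1 b2 where p: "(SOME p. ?Q p) = (b1, b2)" by (cases "SOME p. ?Q p")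
    ultimately have b: "b1 \<noteq> b2" "b1 \<in> in_arcs Q i" "b2 \<in> in_arcs Q i" by auto
    have in_arcs: "in_arcs Q i = {b1, b2}"
      using in_arcs_pair[OF b(2)] b by (metis insertE singletonD)
    \<comment> \<open>A loop is one of the two arrows leaving its own head, so it is fixed by \<rho>
      or by \<sigma>, which are the excluded cases.\<close>
    have no_loop: "tail Q c \<noteq> i" if c: "c \<in> in_arcs Q i" for c
    proof
      assume "tail Q c = i"
      then have l: "c \<in> loops_at Q i" using c by (auto simp: loops_at_def)
      then have "c = \<rho> c \<or> c = \<sigma> c" using out_arc_rho_sigma[of c c] by (auto simp: loops_at_def)
      then show False using 3 l by metis
    qed
    show ?thesis
    proof (rule tilting_two[OF i, of "[b1]" "[b2]"])
      show "sb_T_diag Q \<rho> f i = two_term (dsum2 (proj (tail Q (hd [b1]))) (proj (tail Q (hd [b2])))) (proj i)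
          (right_mult2 Lam (arr [b1]) (arr [b2]))"
        using 3 unfolding sb_T_diag_def Let_def p by (simp add: sb_proj_eq)
      fix v cs assume v: "v \<noteq> i" and path: "is_path v cs" "awlast v cs = i"
        and nb: "\<nexists>as. cs = as @ [b1]" "\<nexists>as. cs = as @ [b2]"
      have ne: "cs \<noteq> []" using v path by auto
      then have "last cs \<noteq> b1" "last cs \<noteq> b2" using nb by (metis append_butlast_last_id)+
      then show "pe (v, cs) \<in> sb_I" using path_end_arc[OF path(1) ne path(2)] in_arcs by auto
    qed (use b i no_loop in auto)
  qed
qed

end

theorem proposition4p1:
  fixes Q :: "(nat, 'a) pre_digraph" and n :: nat and \<rho> :: "'a \<Rightarrow> 'a" and f :: "'a set \<Rightarrow> nat"
    and i :: nat
  assumes "sb_presentation Q n \<rho> f"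
    and "n \<ge> 2"
    and "i \<in> verts Q"
  shows "tilting_complex (sb_algebra Q \<rho> f :: ('a, 'k::field) sb_elt ring) (sb_tilt Q n \<rho> f i)"
proof -
  interpret sb_field Q n \<rho> f "TYPE('k)" using assms(1) by (simp add: sb_field_def)
  show ?thesis using assms(2,3) by (rule tilting_sb)
qed

end
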